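(* Let $n\ge1$, let $\Omega\subset\mathbb{R}^n$ be a domain, $T>0$, $\lambda\ge0$, $\beta\in(0,1)\cup(1,2)$, and let $m$ be a symmetric probability density function on the unit sphere of $\mathbb{R}^n$. Let $p_0\in L^2(\Omega)$, $f\in L^2(0,T;L^2(\Omega))$ and $g\in L^2(0,T;\mathbb{V}')$. If $m$ is nondegenerate, then there exists a unique weak solution of the Neumann problem $$\begin{cases}\dfrac{\partial p(X,t)}{\partial t}-\Delta_m^{\beta/2,\lambda}p(X,t)=f(X,t)&\text{in }\Omega,\\ \Delta_m^{\beta/2,\lambda}p(X,t)=g(X,t)&\text{in }\mathbb{R}^n\setminus\Omega,\\ p(X,0)=p_0(X)&\text{in }\Omega.\end{cases}$$ Here a weak solution is a function $p\in L^2(0,T;\mathbb{V})\cap H^1(0,T;\mathbb{V}')$ with $p(\cdot,0)=p_0$ in $\Omega$ satisfying $$\int_0^T\!\!\int_\Omega\frac{\partial p}{\partial t}\,q\,dX\,dt+\frac{1}{2|\Gamma(-\beta)|}\int_0^Ta(p,q)\,dt=\int_0^T\!\!\int_\Omega f\,q\,dX\,dt-\int_0^T\!\!\int_{\mathbb{R}^n\setminus\Omega}g\,q\,dX\,dt$$ for all $q\in L^2(0,T;\mathbb{V})$, where $$a(p,q)=\iint_{\mathbb{R}^n\times\mathbb{R}^n}\frac{(p(X)-p(Y))(q(X)-q(Y))}{e^{\lambda|X-Y|}|X-Y|^{n+\beta}}\,m(X-Y)\,dX\,dY .$$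
   Context: A probability density function on the unit sphere $\{|\phi|=1\}\subset\mathbb{R}^n$ is a function $m\ge0$ with $\int_{|\phi|=1}m(\phi)\,d\phi=1$ ($d\phi$ surface measure; counting measure on $\{\pm1\}$ if $n=1$). For $Y\neq0$, $m(Y)$ means $m(Y/|Y|)$; $m$ is symmetric if $m(-\phi)=m(\phi)$; $m$ is nondegenerate if $\{\phi:m(\phi)\neq0\}$ spans $\mathbb{R}^n$. The operator (acting in $X$) is $$\Delta_m^{\beta/2,\lambda}p(X)=\frac{1}{|\Gamma(-\beta)|}\int_{\mathbb{R}^n\setminus\{0\}}[p(X-Y)-p(X)]\frac{m(Y)}{e^{\lambda|Y|}|Y|^{n+\beta}}\,dY$$ (principal value at the origin when $1<\beta<2$). $\mathbb{V}$ is the Hilbert space of real measurable functions $p$ on $\mathbb{R}^n$ (modulo a.e. equality) with $p\in L^2(\Omega)$ and finite norm $$\|p\|_{\mathbb{V}}^2=\|p\|_{L^2(\Omega)}^2+\int_{\mathbb{R}^n}\int_{\mathbb{R}^n}\frac{(p(X)-p(Y))^2}{e^{\lambda|X-Y|}|X-Y|^{n+\beta}}\,m(X-Y)\,dX\,dY,$$ and $\mathbb{V}'$ is its dual. The datum $g$ is extended by $0$ to $\Omega$, and $\int_{\mathbb{R}^n\setminus\Omega}g\,q\,dX$ denotes the duality pairing $\langle g,q\rangle_{\mathbb{V}',\mathbb{V}}$. The requirement $p\in H^1(0,T;\mathbb{V}')$ and the term $\int_\Omega\partial_tp\,q\,dX$ are understood by identifying $p(\cdot,t)$ with the functional $q\mapsto\int_\Omega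 p(X,t)q(X)\,dX$ on $\mathbb{V}$. *)

theory Defs
  imports "HOL-Analysis.Analysis"
begin

section \<open>Densities on the unit sphere\<close>

text \<open>Surface measure as cone measure: \<open>\<sigma> A\<close> is \<open>n\<close> times the volume of
  \<open>{r *\<^sub>R \<phi> | 0 < r < 1, \<phi> \<in> A}\<close>. In dimension one this is the counting
  measure on the two unit vectors.\<close>

definition sphere_measure :: "'a::euclidean_space measure" where
  "sphere_measure = completion (scale_measure (of_nat DIM('a))
     (distr (restrict_space lborel (ball 0 1 - {0})) (restrict_space borel (sphere 0 1)) sgn))"

definition sphere_density :: "('a::euclidean_space \<Rightarrow> real) \<Rightarrow> bool" where
  "sphere_density m \<longleftrightarrow> (\<forall>\<phi>\<in>sphere 0 1. 0 \<le> m \<phi>) \<and> has_bochner_integral sphere_measure m 1"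

definition symmetric_density :: "('a::euclidean_space \<Rightarrow> real) \<Rightarrow> bool" where
  "symmetric_density m \<longleftrightarrow> (\<forall>\<phi>\<in>sphere 0 1. m (- \<phi>) = m \<phi>)"

definition nondegenerate :: "('a::euclidean_space \<Rightarrow> real) \<Rightarrow> bool" where
  "nondegenerate m \<longleftrightarrow> span {\<phi> \<in> sphere 0 1. m \<phi> \<noteq> 0} = UNIV"

section \<open>The energy space and its form\<close>

text \<open>Functions are not quotiented by a.e. equality: all (semi)norms below only see
  a.e. classes. Double integrals are taken with respect to Lebesgue measure on
  \<open>'a \<times> 'a\<close>, for which \<open>(X, Y) \<mapsto> m (sgn (X - Y))\<close> is measurable even if
  \<open>m\<close> is not Borel. The function \<open>m\<close> is extended off the sphere by \<open>m (sgn Z)\<close>; the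
  kernel vanishes at \<open>Z = 0\<close>. The tempering parameter \<open>lambda\<close> is called \<open>\<kappa>\<close>, since
  the symbol is reserved for abstraction.\<close>

definition kernel :: "('a::euclidean_space \<Rightarrow> real) \<Rightarrow> real \<Rightarrow> real \<Rightarrow> 'a \<Rightarrow> real" where
  "kernel m \<kappa> \<beta> Z = m (sgn Z) / (exp (\<kappa> * norm Z) * norm Z powr (real DIM('a) + \<beta>))"

definition energy_form ::
    "('a::euclidean_space \<Rightarrow> real) \<Rightarrow> real \<Rightarrow> real \<Rightarrow> ('a \<Rightarrow> real) \<Rightarrow> ('a \<Rightarrow> real) \<Rightarrow> real" where
  "energy_form m \<kappa> \<beta> p q =
     (LINT (X, Y)|lebesgue. (p X - p Y) * (q X - q Y) * kernel m \<kappa> \<beta> (X - Y))"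

definition L2 :: "'a::euclidean_space set \<Rightarrow> ('a \<Rightarrow> real) set" where
  "L2 \<Omega> = {p \<in> borel_measurable (lebesgue_on \<Omega>). integrable (lebesgue_on \<Omega>) (\<lambda>X. (p X)\<^sup>2)}"

definition L2_norm :: "'a::euclidean_space set \<Rightarrow> ('a \<Rightarrow> real) \<Rightarrow> real" where
  "L2_norm \<Omega> p = sqrt (LINT X|lebesgue_on \<Omega>. (p X)\<^sup>2)"

definition V_space ::
    "('a::euclidean_space \<Rightarrow> real) \<Rightarrow> real \<Rightarrow> real \<Rightarrow> 'a set \<Rightarrow> ('a \<Rightarrow> real) set" where
  "V_space m \<kappa> \<beta> \<Omega> = {p \<in> borel_measurable lebesgue. p \<in> L2 \<Omega> \<and>
     integrable lebesgue (\<lambda>(X, Y). (p X - p Y)\<^sup>2 * kernel m \<kappa> \<beta> (X - Y))}"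

definition V_norm ::
    "('a::euclidean_space \<Rightarrow> real) \<Rightarrow> real \<Rightarrow> real \<Rightarrow> 'a set \<Rightarrow> ('a \<Rightarrow> real) \<Rightarrow> real" where
  "V_norm m \<kappa> \<beta> \<Omega> p = sqrt ((L2_norm \<Omega> p)\<^sup>2 +
     (LINT (X, Y)|lebesgue. (p X - p Y)\<^sup>2 * kernel m \<kappa> \<beta> (X - Y)))"

section \<open>Dual spaces and Bochner spaces\<close>

text \<open>A (semi)normed space is given by a carrier \<open>S\<close> of real-valued functions with pointwise
  operations and a (semi)norm \<open>N\<close> on \<open>S\<close>. Functionals are total functions of which only the
  restriction to \<open>S\<close> matters.\<close>

definition dual_space ::
    "('x \<Rightarrow> real) set \<Rightarrow> (('x \<Rightarrow> real) \<Rightarrow> real) \<Rightarrow> (('x \<Rightarrow> real) \<Rightarrow> real) set" where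
  "dual_space S N = {F.
     (\<forall>u\<in>S. \<forall>v\<in>S. F (\<lambda>x. u x + v x) = F u + F v) \<and>
     (\<forall>c. \<forall>u\<in>S. F (\<lambda>x. c * u x) = c * F u) \<and>
     (\<exists>C. \<forall>u\<in>S. \<bar>F u\<bar> \<le> C * N u)}"

definition dual_norm ::
    "('x \<Rightarrow> real) set \<Rightarrow> (('x \<Rightarrow> real) \<Rightarrow> real) \<Rightarrow> (('x \<Rightarrow> real) \<Rightarrow> real) \<Rightarrow> real" where
  "dual_norm S N F = Sup {\<bar>F u\<bar> | u. u \<in> S \<and> N u \<le> 1}"

definition strongly_measurable ::
    "'t measure \<Rightarrow> ('x \<Rightarrow> real) set \<Rightarrow> (('x \<Rightarrow> real) \<Rightarrow> real) \<Rightarrow> ('t \<Rightarrow> 'x \<Rightarrow> real) \<Rightarrow> bool" where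
  "strongly_measurable M S N u \<longleftrightarrow> (AE t in M. u t \<in> S) \<and>
     (\<exists>s :: nat \<Rightarrow> 't \<Rightarrow> 'x \<Rightarrow> real.
        (\<forall>k. simple_function M (s k) \<and> s k ` space M \<subseteq> S) \<and>
        (AE t in M. (\<lambda>k. N (\<lambda>x. s k t x - u t x)) \<longlonglongrightarrow> 0))"

definition L2_time ::
    "real \<Rightarrow> ('x \<Rightarrow> real) set \<Rightarrow> (('x \<Rightarrow> real) \<Rightarrow> real) \<Rightarrow> (real \<Rightarrow> 'x \<Rightarrow> real) set" where
  "L2_time T S N = {u. strongly_measurable (lebesgue_on {0<..<T}) S N u \<and>
     integrable (lebesgue_on {0<..<T}) (\<lambda>t. (N (u t))\<^sup>2)}"

definition test_function :: "real \<Rightarrow> (real \<Rightarrow> real) \<Rightarrow> bool" where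
  "test_function T \<psi> \<longleftrightarrow> (\<forall>k t. (deriv ^^ k) \<psi> differentiable (at t)) \<and>
     closure {t. \<psi> t \<noteq> 0} \<subseteq> {0<..<T}"

text \<open>\<open>F'\<close> is the distributional derivative on \<open>(0, T)\<close> of the dual-valued function \<open>F\<close>: the
  Bochner integrals of \<open>\<psi>' F\<close> and \<open>- \<psi> F'\<close> agree, which is expressed by applying
  these functionals to every element of \<open>S\<close>.\<close>

definition has_weak_time_deriv ::
    "real \<Rightarrow> ('x \<Rightarrow> real) set \<Rightarrow> (real \<Rightarrow> ('x \<Rightarrow> real) \<Rightarrow> real) \<Rightarrow>
     (real \<Rightarrow> ('x \<Rightarrow> real) \<Rightarrow> real) \<Rightarrow> bool" where
  "has_weak_time_deriv T S F F' \<longleftrightarrow> (\<forall>\<psi>. test_function T \<psi> \<longrightarrow> (\<forall>v\<in>S.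
     (LINT t|lebesgue_on {0<..<T}. deriv \<psi> t * F t v) =
     - (LINT t|lebesgue_on {0<..<T}. \<psi> t * F' t v)))"

text \<open>The value at time \<open>0\<close> of an element of \<open>H\<^sup>1(0, T; S')\<close> is that of its representative in
  \<open>C([0, T]; S')\<close>.\<close>

definition has_initial_value ::
    "real \<Rightarrow> ('x \<Rightarrow> real) set \<Rightarrow> (('x \<Rightarrow> real) \<Rightarrow> real) \<Rightarrow>
     (real \<Rightarrow> ('x \<Rightarrow> real) \<Rightarrow> real) \<Rightarrow> (('x \<Rightarrow> real) \<Rightarrow> real) \<Rightarrow> bool" where
  "has_initial_value T S N F F0 \<longleftrightarrow> (\<exists>G.
     (\<forall>t\<in>{0..T}. G t \<in> dual_space S N \<and>
        ((\<lambda>s. dual_norm S N (\<lambda>v. G s v - G t v)) \<longlongrightarrow> 0) (at t within {0..T})) \<and>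
     (AE t in lebesgue_on {0<..<T}. \<forall>v\<in>S. G t v = F t v) \<and>
     (\<forall>v\<in>S. G 0 v = F0 v))"

section \<open>Weak solutions of the Neumann problem\<close>

definition L2_functional :: "'a::euclidean_space set \<Rightarrow> ('a \<Rightarrow> real) \<Rightarrow> ('a \<Rightarrow> real) \<Rightarrow> real" where
  "L2_functional \<Omega> p q = (LINT X|lebesgue_on \<Omega>. p X * q X)"

text \<open>\<open>D\<close> is the time derivative of \<open>p\<close>, both regarded as functions into the dual of \<open>V\<close>
  through \<open>L2_functional\<close>. The Neumann datum \<open>g\<close> is dual-valued, and \<open>g t (q t)\<close> is the duality
  pairing.\<close>

definition weak_solution ::
    "('a::euclidean_space \<Rightarrow> real) \<Rightarrow> real \<Rightarrow> real \<Rightarrow> 'a set \<Rightarrow> real \<Rightarrow>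
     (real \<Rightarrow> 'a \<Rightarrow> real) \<Rightarrow> (real \<Rightarrow> ('a \<Rightarrow> real) \<Rightarrow> real) \<Rightarrow> ('a \<Rightarrow> real) \<Rightarrow>
     (real \<Rightarrow> 'a \<Rightarrow> real) \<Rightarrow> bool" where
  "weak_solution m \<kappa> \<beta> \<Omega> T f g p0 p \<longleftrightarrow>
    (let V = V_space m \<kappa> \<beta> \<Omega>; N = V_norm m \<kappa> \<beta> \<Omega>;
         V' = dual_space V N; N' = dual_norm V N; I = lebesgue_on {0<..<T};
         F = (\<lambda>t. L2_functional \<Omega> (p t))
     in p \<in> L2_time T V N \<and> F \<in> L2_time T V' N' \<and>
        has_initial_value T V N F (L2_functional \<Omega> p0) \<and>
        (\<exists>D \<in> L2_time T V' N'. has_weak_time_deriv T V F D \<and>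
          (\<forall>q \<in> L2_time T V N.
             (LINT t|I. D t (q t)) +
               1 / (2 * \<bar>Gamma (- \<beta>)\<bar>) * (LINT t|I. energy_form m \<kappa> \<beta> (p t) (q t)) =
             (LINT t|I. (LINT X|lebesgue_on \<Omega>. f t X * q t X)) - (LINT t|I. g t (q t)))))"

end

theory Submission
  imports Defs "HOL-Library.Function_Algebras" "HOL-Computational_Algebra.Polynomial"
begin

text \<open>The squared norm of \<open>V\<close> is \<open>b(u, u) + a(u, u)\<close> with \<open>b\<close> the inner product of \<open>L\<^sup>2(\<Omega>)\<close> and \<open>a\<close> the
  energy form, so the problem is the degenerate Cauchy problem \<open>(b p)' + c a p = F\<close> in \<open>V'\<close>, where \<open>b\<close>
  need not be definite on \<open>V\<close>.

  Completeness of \<open>V\<close>: along a rapidly Cauchy sequence, the set of points of convergence contains almost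
  all of \<open>\<Omega>\<close> and is invariant under almost every translation in the cone where the kernel is positive.
  The translations leaving it invariant modulo null sets form a group containing a set of positive measure,
  hence, by Steinhaus, all translations; so the set has full measure.

  Existence: with \<open>K\<close> representing the weak form, \<open>\<integral>ip(p, K \<phi>) = - \<integral>b(p, \<phi>') + c \<integral>a(p, \<phi>)\<close> for smooth \<open>\<phi>\<close> with
  \<open>\<phi>(T) = 0\<close>, pairing \<open>K \<phi>\<close> with \<open>(1 + t) \<phi>\<close> bounds \<open>\<phi>\<close> in \<open>L\<^sup>2(0, T; V)\<close> and \<open>b(\<phi>(0), \<phi>(0))\<close> by the norm of
  \<open>K \<phi>\<close>, and the Riesz theorem applied on the range of \<open>K\<close> gives \<open>p\<close>.

  Uniqueness: the difference \<open>p\<close> of two solutions satisfies \<open>b(p(t), v) + c \<integral>\<^sub>0\<^sup>t a(p(s), v) ds = 0\<close>. Put \<open>v = p(t)\<close>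
  and integrate: by symmetry of \<open>a\<close> the double integral is \<open>a(P, P) / 2 \<ge> 0\<close> with \<open>P = \<integral>\<^sub>0\<^sup>T p\<close>, so \<open>b(p, p) = 0\<close>.\<close>

text \<open>The obstacle is that \<open>b\<close> does not see values outside \<Omega>: a function
  in V may vanish on \<Omega> and be nonzero elsewhere, so V need not embed into L2(\<Omega>) and
  there is no Gelfand triple from which existence, continuity in time and uniqueness could be read
  off. The time derivative controls only the restriction to \<Omega>; the rest has to be recovered
  from the energy form. Hence the weight 1 + t: its derivative produces the integral of b(\<phi>,
  \<phi>), which together with that of a(\<phi>, \<phi>) makes up the full norm. Hence also a second
  stage of uniqueness: once b(p, p) = 0, the equation says that the primitive of a(p, v) vanishes
  for every v, which gives a(p, p) = 0, and only both together force p = 0 almost everywhere. As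
  functions are not identified up to null sets, all spaces carry seminorms, and representing vectors
  are unique only modulo vectors of seminorm zero. Integrals with values in V or V' are defined
  through their pairings with a fixed vector; strong measurability then turns "for every v, for
  almost every t" into "for almost every t, for every v".\<close>

instantiation "fun" :: (type, real_vector) real_vector
begin
definition scaleR_fun :: "real \<Rightarrow> ('a \<Rightarrow> 'b) \<Rightarrow> 'a \<Rightarrow> 'b" where
  "scaleR_fun c f = (\<lambda>x. c *\<^sub>R f x)"
instance
  by standard (auto simp: scaleR_fun_def fun_eq_iff algebra_simps)
end

lemma scaleR_fun_apply [simp]: "(c *\<^sub>R f) x = c *\<^sub>R f x"
  by (simp add: scaleR_fun_def)

section \<open>Semi-inner product spaces\<close>

lemma squeeze_zero:
  fixes f g :: "nat \<Rightarrow> real"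
  assumes "g \<longlonglongrightarrow> 0" "\<And>k. \<bar>f k\<bar> \<le> g k"
  shows "f \<longlonglongrightarrow> 0"
  using assms by (intro Lim_null_comparison[OF _ assms(1)]) simp

locale seminormed =
  fixes S :: "'v::real_vector set" and N :: "'v \<Rightarrow> real"
  assumes subspace: "subspace S"
    and triangle: "\<lbrakk>u \<in> S; v \<in> S\<rbrakk> \<Longrightarrow> N (u + v) \<le> N u + N v"
    and scale: "u \<in> S \<Longrightarrow> N (c *\<^sub>R u) = \<bar>c\<bar> * N u"
begin

lemma mem [simp, intro]:
  shows "0 \<in> S"
    and "\<lbrakk>u \<in> S; v \<in> S\<rbrakk> \<Longrightarrow> u + v \<in> S"
    and "\<lbrakk>u \<in> S; v \<in> S\<rbrakk> \<Longrightarrow> u - v \<in> S"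
    and "u \<in> S \<Longrightarrow> c *\<^sub>R u \<in> S"
    and "u \<in> S \<Longrightarrow> - u \<in> S"
  using subspace by (auto simp: subspace_0 subspace_add subspace_diff subspace_scale subspace_neg)

lemma zero [simp]: "N 0 = 0"
  using scale[of 0 0] by simp

lemma uminus: "u \<in> S \<Longrightarrow> N (- u) = N u"
  using scale[of u "-1"] by simp

lemma nonneg: "u \<in> S \<Longrightarrow> 0 \<le> N u"
  using triangle[of u "- u"] uminus[of u] by simp

lemma minus_commute: "\<lbrakk>u \<in> S; v \<in> S\<rbrakk> \<Longrightarrow> N (u - v) = N (v - u)"
  using uminus[of "u - v"] by simp

lemma triangle_diff: "\<lbrakk>u \<in> S; v \<in> S\<rbrakk> \<Longrightarrow> N (u - v) \<le> N u + N v"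
  using triangle[of u "- v"] uminus[of v] by simp

lemma triangle3: "\<lbrakk>u \<in> S; v \<in> S; w \<in> S\<rbrakk> \<Longrightarrow> N (u - w) \<le> N (u - v) + N (v - w)"
  using triangle[of "u - v" "v - w"] by simp

lemma reverse_triangle: "\<lbrakk>u \<in> S; v \<in> S\<rbrakk> \<Longrightarrow> \<bar>N u - N v\<bar> \<le> N (u - v)"
  using triangle[of "u - v" v] triangle[of "v - u" u] minus_commute[of u v] by simp

end

locale semi_inner =
  fixes S :: "'v::real_vector set" and ip :: "'v \<Rightarrow> 'v \<Rightarrow> real"
  assumes subspace: "subspace S"
    and add_left: "\<lbrakk>u \<in> S; v \<in> S; w \<in> S\<rbrakk> \<Longrightarrow> ip (u + v) w = ip u w + ip v w"
    and scale_left: "\<lbrakk>u \<in> S; w \<in> S\<rbrakk> \<Longrightarrow> ip (c *\<^sub>R u) w = c * ip u w"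
    and commute: "\<lbrakk>u \<in> S; v \<in> S\<rbrakk> \<Longrightarrow> ip u v = ip v u"
    and ip_nonneg: "u \<in> S \<Longrightarrow> 0 \<le> ip u u"
begin

lemma mem' [simp, intro]:
  shows "0 \<in> S"
    and "\<lbrakk>u \<in> S; v \<in> S\<rbrakk> \<Longrightarrow> u + v \<in> S"
    and "\<lbrakk>u \<in> S; v \<in> S\<rbrakk> \<Longrightarrow> u - v \<in> S"
    and "u \<in> S \<Longrightarrow> c *\<^sub>R u \<in> S"
    and "u \<in> S \<Longrightarrow> - u \<in> S"
  using subspace by (auto simp: subspace_0 subspace_add subspace_diff subspace_scale subspace_neg)

lemma add_right: "\<lbrakk>u \<in> S; v \<in> S; w \<in> S\<rbrakk> \<Longrightarrow> ip w (u + v) = ip w u + ip w v"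
  using add_left[of u v w] by (simp add: commute[of w])

lemma scale_right: "\<lbrakk>u \<in> S; w \<in> S\<rbrakk> \<Longrightarrow> ip w (c *\<^sub>R u) = c * ip w u"
  using scale_left[of u w] by (simp add: commute[of w])

lemma diff_left: "\<lbrakk>u \<in> S; v \<in> S; w \<in> S\<rbrakk> \<Longrightarrow> ip (u - v) w = ip u w - ip v w"
  using add_left[of u "(-1) *\<^sub>R v" w] scale_left[of v w "-1"] by simp

lemma diff_right: "\<lbrakk>u \<in> S; v \<in> S; w \<in> S\<rbrakk> \<Longrightarrow> ip w (u - v) = ip w u - ip w v"
  using diff_left[of u v w] by (simp add: commute[of w])

lemma zero_left [simp]: "w \<in> S \<Longrightarrow> ip 0 w = 0"
  using scale_left[of 0 w 0] by simp

lemmas bilinear = add_left add_right scale_left scale_right diff_left diff_right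

lemma ip_expand: "\<lbrakk>u \<in> S; v \<in> S\<rbrakk> \<Longrightarrow> ip (u + t *\<^sub>R v) (u + t *\<^sub>R v) = ip u u + 2 * t * ip u v + t\<^sup>2 * ip v v"
  by (simp add: bilinear commute[of v u] power2_eq_square algebra_simps)

lemma Cauchy_Schwarz_sq: 
  assumes "u \<in> S" "v \<in> S"
  shows "(ip u v)\<^sup>2 \<le> ip u u * ip v v"
proof (cases "ip v v = 0")
  case True
  have "ip u v = 0"
  proof (rule ccontr)
    assume h: "ip u v \<noteq> 0"
    have "0 \<le> ip u u + 2 * (- (ip u u + 1) / (2 * ip u v)) * ip u v + (- (ip u u + 1) / (2 * ip u v))\<^sup>2 * ip v v"
      using ip_nonneg[of "u + (- (ip u u + 1) / (2 * ip u v)) *\<^sub>R v"] assms by (subst ip_expand[symmetric]) auto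
    then show False using True h by (simp add: field_simps)
  qed
  then show ?thesis using True by simp
next
  case False
  then have p: "ip v v > 0" using ip_nonneg[OF assms(2)] by simp
  have "0 \<le> ip u u + 2 * (- ip u v / ip v v) * ip u v + (- ip u v / ip v v)\<^sup>2 * ip v v"
    using ip_nonneg[of "u + (- ip u v / ip v v) *\<^sub>R v"] assms by (subst ip_expand[symmetric]) auto
  also have "\<dots> = ip u u - (ip u v)\<^sup>2 / ip v v" using p by (simp add: field_simps power2_eq_square)
  finally show ?thesis using p by (simp add: field_simps)
qed

lemma Cauchy_Schwarz: 
  assumes "u \<in> S" "v \<in> S"
  shows "\<bar>ip u v\<bar> \<le> sqrt (ip u u) * sqrt (ip v v)"
  using Cauchy_Schwarz_sq[OF assms] by (metis real_sqrt_abs real_sqrt_le_iff real_sqrt_mult)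

sublocale seminormed S "\<lambda>u. sqrt (ip u u)"
proof
  show "subspace S" by (rule subspace)
  fix u v assume u: "u \<in> S" and v: "v \<in> S"
  have "ip (u + v) (u + v) = ip u u + 2 * ip u v + ip v v"
    using ip_expand[OF u v, of 1] by simp
  also have "\<dots> \<le> (sqrt (ip u u) + sqrt (ip v v))\<^sup>2"
    using Cauchy_Schwarz[OF u v] u v by (simp add: power2_sum ip_nonneg)
  finally show "sqrt (ip (u + v) (u + v)) \<le> sqrt (ip u u) + sqrt (ip v v)"
    by (intro real_le_lsqrt add_nonneg_nonneg real_sqrt_ge_zero ip_nonneg u v) auto
next
  fix c :: real and u assume "u \<in> S"
  then show "sqrt (ip (c *\<^sub>R u) (c *\<^sub>R u)) = \<bar>c\<bar> * sqrt (ip u u)"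
    by (simp add: bilinear real_sqrt_mult)
qed

text \<open>Minimise \<open>ip u u - 2 * L u\<close>: the parallelogram identity makes a minimising
  sequence Cauchy, and perturbing it in a direction \<open>v\<close> shows that
  \<open>ip (u k) v\<close> approaches \<open>L v\<close>. The statement stops before taking a limit
  because it is also applied to the space of test functions, where a limit need not exist and only
  the images of the sequence under \<open>K\<close> converge.\<close>

lemma Riesz_sequence:
  assumes Ladd: "\<And>u v. u \<in> S \<Longrightarrow> v \<in> S \<Longrightarrow> L (u + v) = L u + L v"
    and Lscale: "\<And>c u. u \<in> S \<Longrightarrow> L (c *\<^sub>R u) = c * L u"
    and Lbound: "\<And>u. u \<in> S \<Longrightarrow> \<bar>L u\<bar> \<le> C * sqrt (ip u u)"
  obtains u where "\<And>k. u k \<in> S"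
    "\<And>k. sqrt (ip (u (Suc k) - u k) (u (Suc k) - u k)) \<le> (1/2) ^ k"
    "\<And>v. v \<in> S \<Longrightarrow> (\<lambda>k. ip (u k) v) \<longlonglongrightarrow> L v"
proof -
  define J where "J u = ip u u - 2 * L u" for u
  define d where "d = Inf (J ` S)"
  have J_lb: "- C\<^sup>2 \<le> J u" if "u \<in> S" for u
  proof -
    have "0 \<le> (sqrt (ip u u) - C)\<^sup>2" by simp
    also have "\<dots> = ip u u - 2 * (C * sqrt (ip u u)) + C\<^sup>2"
      using ip_nonneg[OF that] by (simp add: power2_diff)
    also have "\<dots> \<le> J u + C\<^sup>2" using Lbound[OF that] by (simp add: J_def)
    finally show ?thesis by simp
  qed
  have bdd: "bdd_below (J ` S)" using J_lb by (intro bdd_belowI2)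
  have d: "d \<le> J u" if "u \<in> S" for u
    unfolding d_def using bdd that by (intro cInf_lower) auto
  \<comment> \<open>Powers of 1/4, because the squared distance of consecutive terms will be bounded
    by \<open>2 * (\<epsilon> (Suc k) + \<epsilon> k)\<close>, which has to stay below the square of
    \<open>(1/2) ^ k\<close>.\<close>
  define \<epsilon> :: "nat \<Rightarrow> real" where "\<epsilon> k = (1/4) ^ Suc k" for k
  have \<epsilon>: "\<epsilon> k > 0" for k by (simp add: \<epsilon>_def)
  have "\<exists>u\<in>S. J u < d + \<epsilon> k" for k
  proof -
    have "\<exists>x\<in>J ` S. x < d + \<epsilon> k"
      using cInf_less_iff[of "J ` S" "d + \<epsilon> k"] bdd \<epsilon>[of k] mem'(1) unfolding d_def[symmetric]
      by (metis empty_iff image_eqI less_add_same_cancel1)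
    then show ?thesis by blast
  qed
  then obtain u where u: "\<And>k. u k \<in> S" and Ju: "\<And>k. J (u k) < d + \<epsilon> k" by metis
  \<comment> \<open>The midpoint has value at least \<open>d\<close>, so two near-minimisers cannot
    be far apart.\<close>
  have half: "J ((1/2) *\<^sub>R (x + y)) = J x / 2 + J y / 2 - ip (x - y) (x - y) / 4" if "x \<in> S" "y \<in> S" for x y
    using that by (simp add: J_def bilinear Ladd Lscale commute[of y x] field_simps)
  show ?thesis
  proof (rule that)
    show "u k \<in> S" for k by (rule u)
    fix k
    have "ip (u (Suc k) - u k) (u (Suc k) - u k) \<le> 2 * (\<epsilon> (Suc k) + \<epsilon> k)"
      using half[OF u u, of "Suc k" k] d[of "(1/2) *\<^sub>R (u (Suc k) + u k)"] Ju[of k] Ju[of "Suc k"] u by simp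
    also have "\<dots> \<le> (1/4) ^ k" by (simp add: \<epsilon>_def field_simps)
    also have "\<dots> = ((1/2) ^ k)\<^sup>2" by (simp add: power_mult[symmetric] power2_eq_square power_mult_distrib[symmetric])
    finally show "sqrt (ip (u (Suc k) - u k) (u (Suc k) - u k)) \<le> (1/2) ^ k"
      by (intro real_le_lsqrt) auto
  next
    fix v assume v: "v \<in> S"
    have est: "\<bar>ip (u k) v - L v\<bar> \<le> sqrt (\<epsilon> k) * (1 + ip v v) / 2" for k
    proof -
      define e where "e = ip (u k) v - L v"
      \<comment> \<open>A step of length \<open>sqrt (\<epsilon> k)\<close> against the sign of the
        defect \<open>e\<close>: the gain is linear in
        \<open>sqrt (\<epsilon> k) * \<bar>e\<bar>\<close>, while the gap to the infimum and the
        quadratic cost are both of order \<open>\<epsilon> k\<close>. So \<open>e\<close> is at most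
        of order \<open>sqrt (\<epsilon> k)\<close>.\<close>
      define t where "t = - sgn e * sqrt (\<epsilon> k)"
      have "d \<le> J (u k + t *\<^sub>R v)" using d u v by simp
      also have "\<dots> = J (u k) + 2 * t * e + t\<^sup>2 * ip v v"
        using u v by (simp add: J_def ip_expand Ladd Lscale e_def algebra_simps)
      finally have "- (2 * t * e) \<le> \<epsilon> k + t\<^sup>2 * ip v v" using Ju[of k] by simp
      moreover have "- (2 * t * e) = 2 * sqrt (\<epsilon> k) * \<bar>e\<bar>" by (simp add: t_def abs_sgn mult_ac)
      moreover have "t\<^sup>2 * ip v v \<le> \<epsilon> k * ip v v"
        using \<epsilon>[of k] ip_nonneg[OF v] by (intro mult_right_mono) (auto simp: t_def power_mult_distrib sgn_if)
      ultimately have "2 * sqrt (\<epsilon> k) * \<bar>e\<bar> \<le> \<epsilon> k * (1 + ip v v)"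
        by (simp add: distrib_left)
      also have "\<epsilon> k * (1 + ip v v) = sqrt (\<epsilon> k) * (sqrt (\<epsilon> k) * (1 + ip v v))"
        using \<epsilon>[of k] by (simp add: mult.assoc[symmetric])
      finally have "2 * sqrt (\<epsilon> k) * \<bar>e\<bar> \<le> sqrt (\<epsilon> k) * (sqrt (\<epsilon> k) * (1 + ip v v))" .
      then have "sqrt (\<epsilon> k) * (2 * \<bar>e\<bar>) \<le> sqrt (\<epsilon> k) * (sqrt (\<epsilon> k) * (1 + ip v v))" by (simp add: mult_ac)
      then have "2 * \<bar>e\<bar> \<le> sqrt (\<epsilon> k) * (1 + ip v v)" using \<epsilon>[of k] by (subst (asm) mult_le_cancel_left_pos) auto
      then show ?thesis by (simp add: e_def)
    qed
    have "\<epsilon> \<longlonglongrightarrow> 0" unfolding \<epsilon>_def by (rule LIMSEQ_Suc) (intro LIMSEQ_power_zero, simp)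
    then have "(\<lambda>k. sqrt (\<epsilon> k) * (1 + ip v v) / 2) \<longlonglongrightarrow> sqrt 0 * (1 + ip v v) / 2"
      by (intro tendsto_intros) auto
    then have "(\<lambda>k. sqrt (\<epsilon> k) * (1 + ip v v) / 2) \<longlonglongrightarrow> 0" by simp
    from squeeze_zero[OF this est] have "(\<lambda>k. ip (u k) v - L v) \<longlonglongrightarrow> 0" .
    then show "(\<lambda>k. ip (u k) v) \<longlonglongrightarrow> L v" by (simp add: LIM_zero_iff)
  qed
qed

end

text \<open>Sequences with summable increments suffice for completeness, since every Cauchy sequence
  has such a subsequence, and for them almost everywhere convergence can be extracted. Limits are
  unique only up to seminorm zero.\<close>

locale semi_hilbert = semi_inner +
  assumes complete: "\<lbrakk>\<And>k. u k \<in> S; summable (\<lambda>k. sqrt (ip (u (Suc k) - u k) (u (Suc k) - u k)))\<rbrakk>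
    \<Longrightarrow> \<exists>l\<in>S. (\<lambda>k. sqrt (ip (u k - l) (u k - l))) \<longlonglongrightarrow> 0"
begin

lemma tendsto_ip:
  assumes "\<And>k. u k \<in> S" "l \<in> S" "v \<in> S" "(\<lambda>k. sqrt (ip (u k - l) (u k - l))) \<longlonglongrightarrow> 0"
  shows "(\<lambda>k. ip (u k) v) \<longlonglongrightarrow> ip l v"
proof -
  have "(\<lambda>k. sqrt (ip (u k - l) (u k - l)) * sqrt (ip v v)) \<longlonglongrightarrow> 0"
    using tendsto_mult_left_zero[OF assms(4)] .
  from squeeze_zero[OF this Cauchy_Schwarz] have "(\<lambda>k. ip (u k - l) v) \<longlonglongrightarrow> 0"
    using assms by simp
  then show ?thesis using assms by (simp add: diff_left LIM_zero_iff)
qed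

lemma Riesz:
  assumes "\<And>u v. u \<in> S \<Longrightarrow> v \<in> S \<Longrightarrow> L (u + v) = L u + L v"
    and "\<And>c u. u \<in> S \<Longrightarrow> L (c *\<^sub>R u) = c * L u"
    and "\<And>u. u \<in> S \<Longrightarrow> \<bar>L u\<bar> \<le> C * sqrt (ip u u)"
  obtains w where "w \<in> S" "\<And>v. v \<in> S \<Longrightarrow> ip w v = L v"
proof -
  obtain u where u: "\<And>k. u k \<in> S"
    "\<And>k. sqrt (ip (u (Suc k) - u k) (u (Suc k) - u k)) \<le> (1/2) ^ k"
    "\<And>v. v \<in> S \<Longrightarrow> (\<lambda>k. ip (u k) v) \<longlonglongrightarrow> L v"
    using Riesz_sequence[of L C] assms by metis
  have "summable (\<lambda>k. sqrt (ip (u (Suc k) - u k) (u (Suc k) - u k)))"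
    using u(1,2) by (intro summable_comparison_test_ev[OF _ summable_geometric[of "1/2"]]) (auto simp: ip_nonneg)
  then obtain w where w: "w \<in> S" "(\<lambda>k. sqrt (ip (u k - w) (u k - w))) \<longlonglongrightarrow> 0"
    using complete[of u] u(1) by metis
  show ?thesis
    using that[OF w(1)] LIMSEQ_unique[OF u(3) tendsto_ip[OF u(1) w(1) _ w(2)]] by metis
qed

end

section \<open>Square-integrable functions\<close>

definition sqint :: "'a measure \<Rightarrow> ('a \<Rightarrow> real) set" where
  "sqint M = {f \<in> borel_measurable M. integrable M (\<lambda>x. (f x)\<^sup>2)}"

lemma sqint_integrable_mult:
  assumes "f \<in> sqint M" "g \<in> sqint M"
  shows "integrable M (\<lambda>x. f x * g x)"
proof (rule Bochner_Integration.integrable_bound)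
  show "integrable M (\<lambda>x. (f x)\<^sup>2 + (g x)\<^sup>2)" using assms by (auto simp: sqint_def)
  show "(\<lambda>x. f x * g x) \<in> borel_measurable M" using assms by (auto simp: sqint_def)
  have "\<bar>f x * g x\<bar> \<le> (f x)\<^sup>2 + (g x)\<^sup>2" for x
    using sum_squares_bound[of "\<bar>f x\<bar>" "\<bar>g x\<bar>"] mult_nonneg_nonneg[of "\<bar>f x\<bar>" "\<bar>g x\<bar>"]
    unfolding abs_mult power2_abs by linarith
  then show "AE x in M. norm (f x * g x) \<le> norm ((f x)\<^sup>2 + (g x)\<^sup>2)" by simp
qed

lemma semi_inner_sqint: "semi_inner (sqint M) (\<lambda>f g. LINT x|M. f x * g x)"
proof
  show "subspace (sqint M)"
  proof (rule subspaceI)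
    show "0 \<in> sqint M" by (simp add: sqint_def zero_fun_def)
  next
    fix f g assume fg: "f \<in> sqint M" "g \<in> sqint M"
    have "integrable M (\<lambda>x. (f x)\<^sup>2 + (g x)\<^sup>2 + 2 * (f x * g x))"
      using fg sqint_integrable_mult[OF fg] by (auto simp: sqint_def)
    moreover have "f + g \<in> borel_measurable M" using fg by (auto simp: sqint_def plus_fun_def)
    ultimately show "f + g \<in> sqint M" by (simp add: sqint_def power2_sum mult.assoc)
  next
    fix c f assume "f \<in> sqint M"
    then show "c *\<^sub>R f \<in> sqint M" by (auto simp: sqint_def scaleR_fun_def power_mult_distrib)
  qed
  fix f g h :: "'a \<Rightarrow> real" and c :: real
  assume f: "f \<in> sqint M"
  { assume g: "g \<in> sqint M" and h: "h \<in> sqint M"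
    show "(LINT x|M. (f + g) x * h x) = (LINT x|M. f x * h x) + (LINT x|M. g x * h x)"
      using Bochner_Integration.integral_add[OF sqint_integrable_mult[OF f h] sqint_integrable_mult[OF g h]]
      by (simp add: distrib_right) }
  { assume g: "g \<in> sqint M"
    show "(LINT x|M. (c *\<^sub>R f) x * g x) = c * (LINT x|M. f x * g x)" by (simp add: mult.assoc)
    show "(LINT x|M. f x * g x) = (LINT x|M. g x * f x)" by (simp add: mult.commute) }
  show "0 \<le> (LINT x|M. f x * f x)" by (rule integral_nonneg_AE) simp
qed

text \<open>The bound is asked only from index \<open>k\<close> on because the lemma is applied to
  the differences \<open>u j - u k\<close> of a Cauchy sequence with \<open>k\<close> fixed.\<close>

lemma sqint_Fatou:
  assumes f: "\<And>j. f j \<in> sqint M" and l: "l \<in> borel_measurable M"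
    and lim: "AE x in M. (\<lambda>j. f j x) \<longlonglongrightarrow> l x"
    and bound: "\<And>j. j \<ge> k \<Longrightarrow> (LINT x|M. (f j x)\<^sup>2) \<le> r"
  shows "l \<in> sqint M" "(LINT x|M. (l x)\<^sup>2) \<le> r"
proof -
  have [measurable]: "f j \<in> borel_measurable M" "l \<in> borel_measurable M" for j using f l by (auto simp: sqint_def)
  have int: "integrable M (\<lambda>x. (f j x)\<^sup>2)" for j using f by (auto simp: sqint_def)
  have r: "0 \<le> r" by (rule order_trans[OF integral_nonneg_AE bound[of k]]) auto
  have "(\<integral>\<^sup>+x. ennreal ((l x)\<^sup>2) \<partial>M) = (\<integral>\<^sup>+x. liminf (\<lambda>j. ennreal ((f j x)\<^sup>2)) \<partial>M)"
  proof (rule nn_integral_cong_AE, use lim in eventually_elim)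
    fix x assume "(\<lambda>j. f j x) \<longlonglongrightarrow> l x"
    then have "(\<lambda>j. ennreal ((f j x)\<^sup>2)) \<longlonglongrightarrow> ennreal ((l x)\<^sup>2)" by (intro tendsto_intros tendsto_ennrealI)
    then show "ennreal ((l x)\<^sup>2) = liminf (\<lambda>j. ennreal ((f j x)\<^sup>2))" by (metis lim_imp_Liminf sequentially_bot)
  qed
  also have "\<dots> \<le> liminf (\<lambda>j. \<integral>\<^sup>+x. ennreal ((f j x)\<^sup>2) \<partial>M)" by (rule nn_integral_liminf) simp
  also have "\<dots> \<le> ennreal r"
  proof (rule order_trans[OF Liminf_mono[of _ "\<lambda>_. ennreal r"]])
    show "\<forall>\<^sub>F j in sequentially. (\<integral>\<^sup>+x. ennreal ((f j x)\<^sup>2) \<partial>M) \<le> ennreal r"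
      using eventually_ge_at_top[of k] by eventually_elim (simp add: nn_integral_eq_integral[OF int] bound ennreal_leI)
  qed (simp add: Liminf_const)
  finally have *: "(\<integral>\<^sup>+x. ennreal ((l x)\<^sup>2) \<partial>M) \<le> ennreal r" .
  have i: "integrable M (\<lambda>x. (l x)\<^sup>2)"
  proof (rule integrableI_bounded)
    show "(\<integral>\<^sup>+x. ennreal (norm ((l x)\<^sup>2)) \<partial>M) < \<infinity>" using * by (simp add: le_less_trans[OF _ ennreal_less_top])
  qed simp
  then show "l \<in> sqint M" using l by (simp add: sqint_def)
  show "(LINT x|M. (l x)\<^sup>2) \<le> r" using * r by (simp add: nn_integral_eq_integral[OF i])
qed

text \<open>On a space of infinite measure a square-integrable function need not be integrable, so
  the sums are not estimated in L1. Instead \<open>\<bar>f k x\<bar> \<le> \<epsilon> k + (f k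
  x)\<^sup>2 / \<epsilon> k\<close> with \<open>\<epsilon> k\<close> slightly above the norm of
  \<open>f k\<close>: the first terms are summable, the second have integral at most
  \<open>\<epsilon> k\<close>, so their sum is finite almost everywhere.\<close>

lemma AE_summable_sqint:
  assumes f: "\<And>k. f k \<in> sqint M" and s: "summable (\<lambda>k. sqrt (LINT x|M. (f k x)\<^sup>2))"
  shows "AE x in M. summable (\<lambda>k. \<bar>f k x\<bar>)"
proof -
  have [measurable]: "f j \<in> borel_measurable M" for j using f by (auto simp: sqint_def)
  have int: "integrable M (\<lambda>x. (f j x)\<^sup>2)" for j using f by (auto simp: sqint_def)
  \<comment> \<open>The summand \<open>(1/2)^k\<close> keeps the divisor positive when
    \<open>f k\<close> has norm zero.\<close>
  define \<epsilon> where "\<epsilon> k = sqrt (LINT x|M. (f k x)\<^sup>2) + (1/2)^k" for k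
  have pos: "\<epsilon> k > 0" for k unfolding \<epsilon>_def by (intro add_nonneg_pos) (auto intro: integral_nonneg_AE)
  have sum: "summable \<epsilon>" unfolding \<epsilon>_def by (intro summable_add s summable_geometric) simp
  have le: "(LINT x|M. (f k x)\<^sup>2 / \<epsilon> k) \<le> \<epsilon> k" for k
  proof -
    have "(LINT x|M. (f k x)\<^sup>2) = (sqrt (LINT x|M. (f k x)\<^sup>2))\<^sup>2" by (simp add: integral_nonneg_AE)
    also have "\<dots> \<le> (\<epsilon> k)\<^sup>2" unfolding \<epsilon>_def by (intro power_mono) (auto intro: integral_nonneg_AE)
    finally show ?thesis using pos[of k] by (simp add: field_simps power2_eq_square)
  qed
  have "(\<integral>\<^sup>+x. (\<Sum>k. ennreal ((f k x)\<^sup>2 / \<epsilon> k)) \<partial>M) = (\<Sum>k. \<integral>\<^sup>+x. ennreal ((f k x)\<^sup>2 / \<epsilon> k) \<partial>M)"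
    by (rule nn_integral_suminf) simp
  also have "\<dots> \<le> (\<Sum>k. ennreal (\<epsilon> k))"
  proof (rule suminf_le)
    fix k show "(\<integral>\<^sup>+x. ennreal ((f k x)\<^sup>2 / \<epsilon> k) \<partial>M) \<le> ennreal (\<epsilon> k)"
      using le[of k] int[of k] pos[of k] by (subst nn_integral_eq_integral) (auto intro: ennreal_leI)
  qed auto
  also have "\<dots> = ennreal (suminf \<epsilon>)" using sum pos by (intro suminf_ennreal2) (auto simp: less_imp_le)
  also have "\<dots> < \<infinity>" by simp
  finally have "(\<integral>\<^sup>+x. (\<Sum>k. ennreal ((f k x)\<^sup>2 / \<epsilon> k)) \<partial>M) \<noteq> \<infinity>" by simp
  then have "AE x in M. (\<Sum>k. ennreal ((f k x)\<^sup>2 / \<epsilon> k)) \<noteq> \<infinity>"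
    by (intro nn_integral_noteq_infinite) auto
  then show ?thesis
  proof eventually_elim
    fix x assume "(\<Sum>k. ennreal ((f k x)\<^sup>2 / \<epsilon> k)) \<noteq> \<infinity>"
    then have 1: "summable (\<lambda>k. (f k x)\<^sup>2 / \<epsilon> k)"
      using pos by (intro summable_suminf_not_top) (auto simp: less_imp_le)
    have "\<bar>f k x\<bar> \<le> \<epsilon> k + (f k x)\<^sup>2 / \<epsilon> k" for k
    proof -
      have "\<bar>f k x\<bar> * \<epsilon> k \<le> \<epsilon> k * \<epsilon> k + (f k x)\<^sup>2"
        using sum_squares_bound[of "\<bar>f k x\<bar>" "\<epsilon> k"] mult_nonneg_nonneg[of "\<bar>f k x\<bar>" "\<epsilon> k"] pos[of k]
        unfolding power2_eq_square[symmetric] power2_abs by linarith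
      then show ?thesis using pos[of k] by (simp add: field_simps)
    qed
    then show "summable (\<lambda>k. \<bar>f k x\<bar>)"
      by (intro summable_comparison_test[OF _ summable_add[OF sum 1]]) auto
  qed
qed

lemma (in seminormed) telescope_bound:
  assumes u: "\<And>k. u k \<in> S" and "k \<le> j"
  shows "N (u j - u k) \<le> (\<Sum>i<j. N (u (Suc i) - u i)) - (\<Sum>i<k. N (u (Suc i) - u i))"
  using \<open>k \<le> j\<close>
proof (induction j rule: dec_induct)
  case (step n)
  have "N (u (Suc n) - u k) \<le> N (u (Suc n) - u n) + N (u n - u k)" using u by (intro triangle3)
  then show ?case using step by simp
qed simp

lemma (in seminormed) tail_bound:
  assumes u: "\<And>k. u k \<in> S" and s: "summable (\<lambda>k. N (u (Suc k) - u k))" and "k \<le> j"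
  shows "N (u j - u k) \<le> (\<Sum>i. N (u (Suc i) - u i)) - (\<Sum>i<k. N (u (Suc i) - u i))"
proof -
  have "(\<Sum>i<j. N (u (Suc i) - u i)) \<le> (\<Sum>i. N (u (Suc i) - u i))"
    using sum_le_suminf[OF s] u nonneg by auto
  then show ?thesis using telescope_bound[of u, OF u \<open>k \<le> j\<close>] by simp
qed

lemma tail_tendsto_zero:
  fixes f :: "nat \<Rightarrow> real"
  assumes "summable f"
  shows "(\<lambda>k. suminf f - (\<Sum>i<k. f i)) \<longlonglongrightarrow> 0"
  using tendsto_diff[OF tendsto_const[of "suminf f"] summable_LIMSEQ[OF assms]] by simp

lemma convergent_of_summable:
  fixes f :: "nat \<Rightarrow> real"
  assumes "summable (\<lambda>k. \<bar>f (Suc k) - f k\<bar>)"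
  shows "convergent f"
proof -
  have "summable (\<lambda>k. f (Suc k) - f k)" using assms by (rule summable_rabs_cancel)
  then have "convergent (\<lambda>n. \<Sum>k<n. f (Suc k) - f k)" by (simp add: summable_iff_convergent)
  then have "convergent (\<lambda>n. f n - f 0)" by (simp add: sum_lessThan_telescope)
  then show ?thesis using convergent_diff_const_right_iff[of f "f 0"] by simp
qed

text \<open>The limit \<open>l\<close> is supplied from outside: in the energy space one and the
  same pointwise limit has to serve for the norm over \<Omega> and for the norm of increments on the
  product space. Fatou applied to \<open>u j - u k\<close> as \<open>j\<close> grows bounds the
  distance from \<open>u k\<close> to \<open>l\<close> by the tail of the series of
  increments.\<close>

lemma sqint_complete:
  assumes u: "\<And>k. u k \<in> sqint M" and s: "summable (\<lambda>k. sqrt (LINT x|M. (u (Suc k) x - u k x)\<^sup>2))"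
  shows "AE x in M. convergent (\<lambda>k. u k x)"
    and "\<lbrakk>l \<in> borel_measurable M; AE x in M. (\<lambda>k. u k x) \<longlonglongrightarrow> l x\<rbrakk> \<Longrightarrow>
      l \<in> sqint M \<and> (\<lambda>k. sqrt (LINT x|M. (u k x - l x)\<^sup>2)) \<longlonglongrightarrow> 0"
proof -
  interpret semi_inner "sqint M" "\<lambda>f g. LINT x|M. f x * g x" by (rule semi_inner_sqint)
  have diff: "(\<lambda>x. u j x - u k x) \<in> sqint M" for j k
    using mem(3)[OF u u, of j k] by (simp add: fun_diff_def)
  have s': "summable (\<lambda>k. sqrt (LINT x|M. (u (Suc k) - u k) x * (u (Suc k) - u k) x))"
    using s by (simp add: power2_eq_square)
  have "AE x in M. summable (\<lambda>k. \<bar>u (Suc k) x - u k x\<bar>)"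
    using AE_summable_sqint[of "\<lambda>k x. u (Suc k) x - u k x" M] diff s by simp
  then show "AE x in M. convergent (\<lambda>k. u k x)" by eventually_elim (rule convergent_of_summable)
  assume l: "l \<in> borel_measurable M" and lim: "AE x in M. (\<lambda>k. u k x) \<longlonglongrightarrow> l x"
  define r where "r k = (\<Sum>i. sqrt (LINT x|M. (u (Suc i) x - u i x)\<^sup>2)) - (\<Sum>i<k. sqrt (LINT x|M. (u (Suc i) x - u i x)\<^sup>2))" for k
  have tail: "sqrt (LINT x|M. (u j x - u k x)\<^sup>2) \<le> r k" if "k \<le> j" for k j
    using tail_bound[of u k j, OF u s' that] by (simp add: r_def power2_eq_square)
  have r0: "0 \<le> r k" for k using tail[of k k] by simp
  have "(LINT x|M. (u j x - u k x)\<^sup>2) \<le> (r k)\<^sup>2" if "k \<le> j" for k j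
    using tail[OF that] by (rule sqrt_le_D)
  moreover have "AE x in M. (\<lambda>j. u j x - u k x) \<longlonglongrightarrow> l x - u k x" for k
    using lim by eventually_elim (intro tendsto_intros)
  moreover have "(\<lambda>x. l x - u k x) \<in> borel_measurable M" for k
    using l u[of k] by (auto simp: sqint_def)
  ultimately have *: "(\<lambda>x. l x - u k x) \<in> sqint M" "(LINT x|M. (l x - u k x)\<^sup>2) \<le> (r k)\<^sup>2" for k
    using sqint_Fatou[of "\<lambda>j x. u j x - u k x" M "\<lambda>x. l x - u k x" k "(r k)\<^sup>2", OF diff] by auto
  have "(\<lambda>x. l x - u 0 x) + u 0 \<in> sqint M" by (rule mem(2)[OF *(1) u])
  moreover have "(\<lambda>x. l x - u 0 x) + u 0 = l" by (simp add: fun_eq_iff)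
  moreover have "(\<lambda>k. sqrt (LINT x|M. (u k x - l x)\<^sup>2)) \<longlonglongrightarrow> 0"
  proof (rule squeeze_zero)
    show "r \<longlonglongrightarrow> 0" unfolding r_def by (rule tail_tendsto_zero[OF s])
    fix k
    have "sqrt (LINT x|M. (l x - u k x)\<^sup>2) \<le> r k" using *(2)[of k] r0[of k] by (rule real_le_lsqrt[rotated]) 
    then show "\<bar>sqrt (LINT x|M. (u k x - l x)\<^sup>2)\<bar> \<le> r k"
      by (simp add: power2_commute integral_nonneg_AE)
  qed
  ultimately show "l \<in> sqint M \<and> (\<lambda>k. sqrt (LINT x|M. (u k x - l x)\<^sup>2)) \<longlonglongrightarrow> 0" by simp
qed

section \<open>Strong measurability\<close>

lemma (in complete_measure) borel_measurable_AE_cong: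
  fixes f g :: "'a \<Rightarrow> real"
  assumes f: "f \<in> borel_measurable M" and ae: "AE x in M. f x = g x"
  shows "g \<in> borel_measurable M"
proof (rule measurableI)
  fix A :: "real set" assume A: "A \<in> sets borel"
  show "g -` A \<inter> space M \<in> sets M"
  proof (rule in_sets_AE)
    show "AE x in M. x \<in> f -` A \<inter> space M \<longleftrightarrow> x \<in> g -` A \<inter> space M"
      using ae by eventually_elim simp
    show "f -` A \<inter> space M \<in> sets M" using f A by (rule measurable_sets)
  qed simp
qed simp

lemma (in complete_measure) borel_measurable_AE_LIMSEQ:
  fixes f :: "nat \<Rightarrow> 'a \<Rightarrow> real"
  assumes f: "\<And>k. f k \<in> borel_measurable M" and lim: "AE x in M. (\<lambda>k. f k x) \<longlonglongrightarrow> g x"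
  shows "g \<in> borel_measurable M"
proof (rule borel_measurable_AE_cong)
  show "(\<lambda>x. lim (\<lambda>k. f k x)) \<in> borel_measurable M" using f by (rule borel_measurable_lim_metric)
  show "AE x in M. lim (\<lambda>k. f k x) = g x" using lim by eventually_elim (rule limI)
qed

text \<open>Strong measurability with the approximating sequence made explicit, so that two
  functions can be paired along their sequences.\<close>

definition approx ::
    "'t measure \<Rightarrow> ('x \<Rightarrow> real) set \<Rightarrow> (('x \<Rightarrow> real) \<Rightarrow> real) \<Rightarrow> (nat \<Rightarrow> 't \<Rightarrow> 'x \<Rightarrow> real) \<Rightarrow> ('t \<Rightarrow> 'x \<Rightarrow> real) \<Rightarrow> bool"
  where "approx M S N s u \<longleftrightarrow> (\<forall>k. simple_function M (s k)) \<and> (\<forall>k. \<forall>t\<in>space M. s k t \<in> S) \<and>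
    (AE t in M. u t \<in> S \<and> (\<lambda>k. N (s k t - u t)) \<longlonglongrightarrow> 0)"

lemma strongly_measurable_iff: "strongly_measurable M S N u \<longleftrightarrow> (\<exists>s. approx M S N s u)"
  by (auto simp: strongly_measurable_def approx_def fun_diff_def image_subset_iff)

lemma approxD:
  assumes "approx M S N s u"
  shows "simple_function M (s k)" "t \<in> space M \<Longrightarrow> s k t \<in> S" "AE t in M. u t \<in> S" 
    "AE t in M. (\<lambda>k. N (s k t - u t)) \<longlonglongrightarrow> 0"
  using assms by (auto simp: approx_def)

lemma approxE:
  assumes "approx M S N s u"
  shows "AE t in M. t \<in> space M \<and> u t \<in> S \<and> (\<forall>k. s k t \<in> S) \<and> (\<lambda>k. N (s k t - u t)) \<longlonglongrightarrow> 0"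
  using assms AE_space[of M] by (auto simp: approx_def elim!: eventually_elim2)

lemma approx_cong_AE:
  assumes "approx M S N s u" "AE t in M. u t = w t"
  shows "approx M S N s w"
proof -
  have "AE t in M. w t \<in> S \<and> (\<lambda>k. N (s k t - w t)) \<longlonglongrightarrow> 0"
    using approxE[OF assms(1)] assms(2) by eventually_elim auto
  then show ?thesis using assms(1) by (auto simp: approx_def)
qed

lemma strongly_measurable_cong_AE:
  "strongly_measurable M S N u \<Longrightarrow> AE t in M. u t = w t \<Longrightarrow> strongly_measurable M S N w"
  unfolding strongly_measurable_iff using approx_cong_AE by blast

lemma strongly_measurable_image:
  assumes S: "seminormed S N" and u: "strongly_measurable M S N u"
    and \<Phi>: "\<And>v. v \<in> S \<Longrightarrow> \<Phi> v \<in> S'" and C: "\<And>v w. v \<in> S \<Longrightarrow> w \<in> S \<Longrightarrow> N' (\<Phi> v - \<Phi> w) \<le> C * N (v - w)"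
    and S': "seminormed S' N'"
  shows "strongly_measurable M S' N' (\<lambda>t. \<Phi> (u t))"
proof -
  interpret seminormed S N by fact
  interpret S': seminormed S' N' by fact
  obtain s where s: "approx M S N s u" using u strongly_measurable_iff by metis
  have "approx M S' N' (\<lambda>k t. \<Phi> (s k t)) (\<lambda>t. \<Phi> (u t))"
    unfolding approx_def
  proof (intro conjI allI ballI)
    show "simple_function M (\<lambda>t. \<Phi> (s k t))" for k using approxD(1)[OF s] by (rule simple_function_compose1)
    show "\<Phi> (s k t) \<in> S'" if "t \<in> space M" for k t using approxD(2)[OF s that] by (rule \<Phi>)
    show "AE t in M. \<Phi> (u t) \<in> S' \<and> (\<lambda>k. N' (\<Phi> (s k t) - \<Phi> (u t))) \<longlonglongrightarrow> 0"
      using approxE[OF s]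
    proof eventually_elim
      fix t assume h: "t \<in> space M \<and> u t \<in> S \<and> (\<forall>k. s k t \<in> S) \<and> (\<lambda>k. N (s k t - u t)) \<longlonglongrightarrow> 0"
      then have "(\<lambda>k. C * N (s k t - u t)) \<longlonglongrightarrow> 0" by (intro tendsto_mult_right_zero) auto
      then have "(\<lambda>k. N' (\<Phi> (s k t) - \<Phi> (u t))) \<longlonglongrightarrow> 0"
        using h C \<Phi> S'.nonneg by (elim squeeze_zero) (simp add: abs_of_nonneg)
      then show "\<Phi> (u t) \<in> S' \<and> (\<lambda>k. N' (\<Phi> (s k t) - \<Phi> (u t))) \<longlonglongrightarrow> 0" using h \<Phi> by auto
    qed
  qed
  then show ?thesis using strongly_measurable_iff by metis
qed

lemma strongly_measurable_add:
  assumes S: "seminormed S N" and u: "strongly_measurable M S N u" and w: "strongly_measurable M S N w"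
  shows "strongly_measurable M S N (\<lambda>t. u t + w t)"
proof -
  interpret seminormed S N by fact
  obtain s where s: "approx M S N s u" using u strongly_measurable_iff by metis
  obtain r where r: "approx M S N r w" using w strongly_measurable_iff by metis
  have "approx M S N (\<lambda>k t. s k t + r k t) (\<lambda>t. u t + w t)"
    unfolding approx_def
  proof (intro conjI allI ballI)
    show "simple_function M (\<lambda>t. s k t + r k t)" for k
      using approxD(1)[OF s] approxD(1)[OF r] by (rule simple_function_compose2)
    show "s k t + r k t \<in> S" if "t \<in> space M" for k t using approxD(2)[OF s that] approxD(2)[OF r that] by simp
    show "AE t in M. u t + w t \<in> S \<and> (\<lambda>k. N ((s k t + r k t) - (u t + w t))) \<longlonglongrightarrow> 0"
      using approxE[OF s] approxE[OF r]
    proof eventually_elim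
      fix t assume h: "t \<in> space M \<and> u t \<in> S \<and> (\<forall>k. s k t \<in> S) \<and> (\<lambda>k. N (s k t - u t)) \<longlonglongrightarrow> 0"
        and h': "t \<in> space M \<and> w t \<in> S \<and> (\<forall>k. r k t \<in> S) \<and> (\<lambda>k. N (r k t - w t)) \<longlonglongrightarrow> 0"
      have "(\<lambda>k. N (s k t - u t) + N (r k t - w t)) \<longlonglongrightarrow> 0" using h h' by (intro tendsto_add_zero) auto
      moreover have "\<bar>N ((s k t + r k t) - (u t + w t))\<bar> \<le> N (s k t - u t) + N (r k t - w t)" for k
        using triangle[of "s k t - u t" "r k t - w t"] nonneg[of "(s k t + r k t) - (u t + w t)"] h h'
        by (simp add: algebra_simps)
      ultimately have "(\<lambda>k. N ((s k t + r k t) - (u t + w t))) \<longlonglongrightarrow> 0" by (rule squeeze_zero)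
      then show "u t + w t \<in> S \<and> (\<lambda>k. N ((s k t + r k t) - (u t + w t))) \<longlonglongrightarrow> 0" using h h' by auto
    qed
  qed
  then show ?thesis using strongly_measurable_iff by metis
qed

lemma strongly_measurable_scale:
  assumes "seminormed S N" "strongly_measurable M S N u"
  shows "strongly_measurable M S N (\<lambda>t. c *\<^sub>R u t)"
proof -
  interpret seminormed S N by fact
  show ?thesis
    by (rule strongly_measurable_image[OF assms, where C="\<bar>c\<bar>" and \<Phi>="(*\<^sub>R) c"])
      (simp_all add: scaleR_diff_right[symmetric] scale assms(1))
qed

context complete_measure
begin

text \<open>The approximants are simple, so \<open>B\<close> of them is measurable whatever
  \<open>B\<close> is, and convergence along the two sequences is all that remains to be asked.
  Norms and duality pairings are instances; completeness of the measure absorbs the exceptional null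
  set.\<close>

lemma pairing_measurable:
  assumes s: "approx M S N s u" and r: "approx M S' N' r w"
    and lim: "\<And>t. \<lbrakk>u t \<in> S; w t \<in> S'; \<And>k. s k t \<in> S; \<And>k. r k t \<in> S'; (\<lambda>k. N (s k t - u t)) \<longlonglongrightarrow> 0;
      (\<lambda>k. N' (r k t - w t)) \<longlonglongrightarrow> 0\<rbrakk> \<Longrightarrow> (\<lambda>k. B (s k t) (r k t)) \<longlonglongrightarrow> B (u t) (w t)"
  shows "(\<lambda>t. B (u t) (w t) :: real) \<in> borel_measurable M"
proof (rule borel_measurable_AE_LIMSEQ)
  show "(\<lambda>t. B (s k t) (r k t)) \<in> borel_measurable M" for k
    by (intro borel_measurable_simple_function simple_function_compose2[where h=B] approxD(1)[OF s] approxD(1)[OF r])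
  show "AE t in M. (\<lambda>k. B (s k t) (r k t)) \<longlonglongrightarrow> B (u t) (w t)"
    using approxE[OF s] approxE[OF r] by eventually_elim (rule lim, auto)
qed

lemma norm_measurable:
  assumes "seminormed S N" "strongly_measurable M S N u"
  shows "(\<lambda>t. N (u t)) \<in> borel_measurable M"
proof -
  interpret seminormed S N by fact
  obtain s where s: "approx M S N s u" using assms strongly_measurable_iff by metis
  show ?thesis
  proof (rule pairing_measurable[OF s s, where B="\<lambda>x y. N x"])
    fix t assume "u t \<in> S" "\<And>k. s k t \<in> S" and l: "(\<lambda>k. N (s k t - u t)) \<longlonglongrightarrow> 0"
    then have "(\<lambda>k. N (s k t) - N (u t)) \<longlonglongrightarrow> 0" using squeeze_zero[OF l reverse_triangle] by auto
    then show "(\<lambda>k. N (s k t)) \<longlonglongrightarrow> N (u t)" by (simp add: LIM_zero_iff)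
  qed
qed

end

definition L2t :: "'t measure \<Rightarrow> ('x \<Rightarrow> real) set \<Rightarrow> (('x \<Rightarrow> real) \<Rightarrow> real) \<Rightarrow> ('t \<Rightarrow> 'x \<Rightarrow> real) set" where
  "L2t M S N = {u. strongly_measurable M S N u \<and> integrable M (\<lambda>t. (N (u t))\<^sup>2)}"

lemma L2_time_eq: "L2_time T S N = L2t (lebesgue_on {0<..<T}) S N"
  by (simp add: L2_time_def L2t_def)

lemma L2t_AE: "u \<in> L2t M S N \<Longrightarrow> AE t in M. u t \<in> S"
  by (simp add: L2t_def strongly_measurable_def)

lemma L2t_cong_AE:
  assumes u: "u \<in> L2t M S N" and ae: "AE t in M. u t = w t" and c: "complete_measure M" and S: "seminormed S N"
  shows "w \<in> L2t M S N"
proof -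
  interpret complete_measure M by fact
  have sw: "strongly_measurable M S N w" using u ae strongly_measurable_cong_AE by (auto simp: L2t_def)
  have "integrable M (\<lambda>t. (N (w t))\<^sup>2) = integrable M (\<lambda>t. (N (u t))\<^sup>2)"
  proof (rule integrable_cong_AE)
    show "AE t in M. (N (w t))\<^sup>2 = (N (u t))\<^sup>2" using ae by eventually_elim simp
  qed (use norm_measurable[OF S] u sw in \<open>auto simp: L2t_def\<close>)
  then show ?thesis using u sw by (simp add: L2t_def)
qed

context complete_measure
begin

lemma L2t_sqint: "seminormed S N \<Longrightarrow> u \<in> L2t M S N \<Longrightarrow> (\<lambda>t. N (u t)) \<in> sqint M"
  using norm_measurable by (auto simp: L2t_def sqint_def)

text \<open>\<open>\<Phi>\<close> is not assumed linear, hence two separate bounds: the Lipschitz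
  bound gives strong measurability, the growth bound gives square integrability.\<close>

lemma L2t_image:
  assumes S: "seminormed S N" and u: "u \<in> L2t M S N"
    and \<Phi>: "\<And>v. v \<in> S \<Longrightarrow> \<Phi> v \<in> S'" and C: "\<And>v w. v \<in> S \<Longrightarrow> w \<in> S \<Longrightarrow> N' (\<Phi> v - \<Phi> w) \<le> C * N (v - w)"
    and C': "\<And>v. v \<in> S \<Longrightarrow> N' (\<Phi> v) \<le> C * N v"
    and S': "seminormed S' N'"
  shows "(\<lambda>t. \<Phi> (u t)) \<in> L2t M S' N'"
proof -
  interpret S: seminormed S N by fact
  interpret S': seminormed S' N' by fact
  have sm: "strongly_measurable M S' N' (\<lambda>t. \<Phi> (u t))"
    using u by (intro strongly_measurable_image[OF S _ \<Phi> C S']) (auto simp: L2t_def)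
  have "integrable M (\<lambda>t. (N' (\<Phi> (u t)))\<^sup>2)"
  proof (rule Bochner_Integration.integrable_bound)
    show "integrable M (\<lambda>t. C\<^sup>2 * (N (u t))\<^sup>2)" using u by (simp add: L2t_def)
    show "(\<lambda>t. (N' (\<Phi> (u t)))\<^sup>2) \<in> borel_measurable M" using norm_measurable[OF S' sm] by simp
    show "AE t in M. norm ((N' (\<Phi> (u t)))\<^sup>2) \<le> norm (C\<^sup>2 * (N (u t))\<^sup>2)"
      using L2t_AE[OF u]
    proof eventually_elim
      fix t assume "u t \<in> S"
      then have "(N' (\<Phi> (u t)))\<^sup>2 \<le> (C * N (u t))\<^sup>2" using C' S'.nonneg \<Phi> by (intro power_mono) auto
      then show "norm ((N' (\<Phi> (u t)))\<^sup>2) \<le> norm (C\<^sup>2 * (N (u t))\<^sup>2)" by (simp add: power_mult_distrib)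
    qed
  qed
  then show ?thesis using sm by (simp add: L2t_def)
qed

lemma L2t_scale:
  assumes S: "seminormed S N" and u: "u \<in> L2t M S N"
  shows "(\<lambda>t. c *\<^sub>R u t) \<in> L2t M S N"
proof -
  interpret seminormed S N by fact
  show ?thesis
    by (rule L2t_image[OF assms, where C="\<bar>c\<bar>" and \<Phi>="(*\<^sub>R) c"])
      (simp_all add: scaleR_diff_right[symmetric] scale S)
qed

lemma L2t_add:
  assumes S: "seminormed S N" and u: "u \<in> L2t M S N" and w: "w \<in> L2t M S N"
  shows "(\<lambda>t. u t + w t) \<in> L2t M S N"
proof -
  interpret S: seminormed S N by fact
  have sm: "strongly_measurable M S N (\<lambda>t. u t + w t)"
    using u w by (intro strongly_measurable_add[OF S]) (auto simp: L2t_def)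
  have "integrable M (\<lambda>t. (N (u t + w t))\<^sup>2)"
  proof (rule Bochner_Integration.integrable_bound)
    show "integrable M (\<lambda>t. 2 * (N (u t))\<^sup>2 + 2 * (N (w t))\<^sup>2)" using u w by (simp add: L2t_def)
    show "(\<lambda>t. (N (u t + w t))\<^sup>2) \<in> borel_measurable M" using norm_measurable[OF S sm] by simp
    show "AE t in M. norm ((N (u t + w t))\<^sup>2) \<le> norm (2 * (N (u t))\<^sup>2 + 2 * (N (w t))\<^sup>2)"
      using L2t_AE[OF u] L2t_AE[OF w]
    proof eventually_elim
      fix t assume "u t \<in> S" "w t \<in> S"
      then have "(N (u t + w t))\<^sup>2 \<le> (N (u t) + N (w t))\<^sup>2" using S.triangle S.nonneg by (intro power_mono) auto
      also have "\<dots> \<le> 2 * (N (u t))\<^sup>2 + 2 * (N (w t))\<^sup>2"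
        using sum_squares_bound[of "N (u t)" "N (w t)"] by (simp add: power2_sum)
      finally show "norm ((N (u t + w t))\<^sup>2) \<le> norm (2 * (N (u t))\<^sup>2 + 2 * (N (w t))\<^sup>2)" by simp
    qed
  qed
  then show ?thesis using sm by (simp add: L2t_def)
qed

lemma L2t_diff:
  assumes S: "seminormed S N" and u: "u \<in> L2t M S N" and w: "w \<in> L2t M S N"
  shows "(\<lambda>t. u t - w t) \<in> L2t M S N"
  using L2t_add[OF S u L2t_scale[OF S w, of "-1"]] by simp

end

section \<open>Dual spaces\<close>

lemma abs_triangle_ineq3: "\<bar>x + y + z :: real\<bar> \<le> \<bar>x\<bar> + \<bar>y\<bar> + \<bar>z\<bar>"
  by linarith

context seminormed
begin

lemma bounded_nonneg_const:
  assumes "\<And>u. u \<in> S \<Longrightarrow> \<bar>F u\<bar> \<le> C * N u" "u \<in> S"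
  shows "\<bar>F u\<bar> \<le> \<bar>C\<bar> * N u"
  using assms(1)[OF assms(2)] mult_right_mono[OF abs_ge_self[of C] nonneg[OF assms(2)]] by simp

end

locale fun_seminormed = seminormed S N for S :: "('x \<Rightarrow> real) set" and N
begin

abbreviation "D \<equiv> dual_space S N"
abbreviation "dn \<equiv> dual_norm S N"

lemma dualI:
  assumes "\<And>u v. u \<in> S \<Longrightarrow> v \<in> S \<Longrightarrow> F (u + v) = F u + F v"
    and "\<And>c u. u \<in> S \<Longrightarrow> F (c *\<^sub>R u) = c * F u"
    and "\<And>u. u \<in> S \<Longrightarrow> \<bar>F u\<bar> \<le> C * N u"
  shows "F \<in> D"
  using assms unfolding dual_space_def plus_fun_def scaleR_fun_def by (auto intro!: exI[of _ C])

lemma dual_add: "F \<in> D \<Longrightarrow> u \<in> S \<Longrightarrow> v \<in> S \<Longrightarrow> F (u + v) = F u + F v"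
  unfolding dual_space_def plus_fun_def by blast

lemma dual_scale: "F \<in> D \<Longrightarrow> u \<in> S \<Longrightarrow> F (c *\<^sub>R u) = c * F u"
  unfolding dual_space_def scaleR_fun_def by simp

lemma dual_diff: "F \<in> D \<Longrightarrow> u \<in> S \<Longrightarrow> v \<in> S \<Longrightarrow> F (u - v) = F u - F v"
  using dual_add[of F u "(-1) *\<^sub>R v"] dual_scale[of F v "-1"] by simp

lemma dual_zero [simp]: "F \<in> D \<Longrightarrow> F 0 = 0"
  using dual_scale[of F 0 0] by simp

lemma dual_bounded: 
  assumes "F \<in> D"
  obtains C where "0 \<le> C" "\<And>u. u \<in> S \<Longrightarrow> \<bar>F u\<bar> \<le> C * N u"
proof -
  obtain C where "\<And>u. u \<in> S \<Longrightarrow> \<bar>F u\<bar> \<le> C * N u" using assms unfolding dual_space_def by blast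
  then show thesis using bounded_nonneg_const[of F C] by (intro that[of "\<bar>C\<bar>"]) auto
qed

lemma dual_norm_upper: 
  assumes "F \<in> D" "u \<in> S" "N u \<le> 1"
  shows "\<bar>F u\<bar> \<le> dn F"
proof -
  obtain C where C: "0 \<le> C" "\<And>u. u \<in> S \<Longrightarrow> \<bar>F u\<bar> \<le> C * N u" using dual_bounded[OF assms(1)] by metis
  have "\<bar>F v\<bar> \<le> C" if "v \<in> S" "N v \<le> 1" for v
    using C(2)[OF that(1)] mult_left_mono[OF that(2) C(1)] by simp
  then have "bdd_above {\<bar>F u\<bar> | u. u \<in> S \<and> N u \<le> 1}" by (auto intro!: bdd_aboveI[of _ C])
  then show ?thesis unfolding dual_norm_def using assms by (intro cSup_upper) auto
qed

lemma dual_norm_least: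
  assumes "\<And>u. u \<in> S \<Longrightarrow> N u \<le> 1 \<Longrightarrow> \<bar>F u\<bar> \<le> C"
  shows "dn F \<le> C"
  unfolding dual_norm_def using assms by (intro cSup_least) (auto intro!: exI[of _ 0])

lemma dual_norm_le:
  assumes "\<And>u. u \<in> S \<Longrightarrow> \<bar>F u\<bar> \<le> C * N u" "0 \<le> C"
  shows "dn F \<le> C"
proof (rule dual_norm_least)
  fix u assume u: "u \<in> S" "N u \<le> 1"
  show "\<bar>F u\<bar> \<le> C" using assms(1)[OF u(1)] mult_left_mono[OF u(2) assms(2)] by simp
qed

lemma dual_norm_nonneg: "F \<in> D \<Longrightarrow> 0 \<le> dn F"
  using dual_norm_upper[of F 0] by simp

lemma dual_le: 
  assumes F: "F \<in> D" and u: "u \<in> S"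
  shows "\<bar>F u\<bar> \<le> dn F * N u"
proof (cases "N u = 0")
  \<comment> \<open>A seminorm may vanish off zero. No rescaling to the unit ball is possible there,
    but the defining bound of the functional forces \<open>F u = 0\<close>.\<close>
  case True
  obtain C where "\<And>u. u \<in> S \<Longrightarrow> \<bar>F u\<bar> \<le> C * N u" using dual_bounded[OF F] by metis
  from this[OF u] True show ?thesis by simp
next
  case False
  then have p: "N u > 0" using nonneg[OF u] by simp
  have "\<bar>F ((1 / N u) *\<^sub>R u)\<bar> \<le> dn F"
    using p u dual_norm_upper[OF F, of "(1 / N u) *\<^sub>R u"] by (simp only: mem scale) simp
  then show ?thesis using p by (simp add: dual_scale[OF F u] field_simps)
qed

lemma dual_norm_approx:
  assumes "F \<in> D" "e > 0"
  obtains u where "u \<in> S" "N u \<le> 1" "dn F < \<bar>F u\<bar> + e"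
proof (rule ccontr)
  assume "\<not> thesis"
  then have "\<And>u. u \<in> S \<Longrightarrow> N u \<le> 1 \<Longrightarrow> \<bar>F u\<bar> \<le> dn F - e" using that by force
  then have "dn F \<le> dn F - e" by (rule dual_norm_least)
  then show False using assms by simp
qed

lemma subspace_dual: "subspace D"
proof (rule subspaceI)
  show "0 \<in> D" by (rule dualI[where C=0]) auto
next
  fix F G assume FG: "F \<in> D" "G \<in> D"
  show "F + G \<in> D"
  proof (rule dualI[where C="dn F + dn G"])
    fix u assume "u \<in> S"
    then show "\<bar>(F + G) u\<bar> \<le> (dn F + dn G) * N u"
      using dual_le[OF FG(1), of u] dual_le[OF FG(2), of u] by (simp add: distrib_right)
  qed (simp_all add: FG dual_add dual_scale algebra_simps)
next
  fix c F assume F: "F \<in> D"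
  show "c *\<^sub>R F \<in> D"
  proof (rule dualI[where C="\<bar>c\<bar> * dn F"])
    fix u assume "u \<in> S"
    then show "\<bar>(c *\<^sub>R F) u\<bar> \<le> \<bar>c\<bar> * dn F * N u"
      using mult_left_mono[OF dual_le[OF F, of u], of "\<bar>c\<bar>"] by (simp add: abs_mult mult.assoc)
  qed (simp_all add: F dual_add dual_scale algebra_simps)
qed

lemma seminormed_dual: "seminormed D dn"
proof
  show "subspace D" by (rule subspace_dual)
  fix F assume F: "F \<in> D"
  { fix G assume G: "G \<in> D"
    show "dn (F + G) \<le> dn F + dn G"
    proof (rule dual_norm_le)
      fix u assume "u \<in> S"
      then show "\<bar>(F + G) u\<bar> \<le> (dn F + dn G) * N u"
        using dual_le[OF F, of u] dual_le[OF G, of u] by (simp add: distrib_right)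
    qed (simp add: dual_norm_nonneg F G) }
  have le: "dn (c *\<^sub>R G) \<le> \<bar>c\<bar> * dn G" if G: "G \<in> D" for c G
  proof (rule dual_norm_le)
    fix u assume "u \<in> S"
    then show "\<bar>(c *\<^sub>R G) u\<bar> \<le> \<bar>c\<bar> * dn G * N u"
      using mult_left_mono[OF dual_le[OF G, of u], of "\<bar>c\<bar>"] by (simp add: abs_mult mult.assoc)
  qed (simp add: dual_norm_nonneg G)
  fix c :: real
  show "dn (c *\<^sub>R F) = \<bar>c\<bar> * dn F"
  proof (cases "c = 0")
    case True
    have "dn 0 = 0" using le[OF F, of 0] dual_norm_nonneg[OF subspace_0[OF subspace_dual]] by simp
    then show ?thesis using True by simp
  next
    case False
    have "dn ((1/c) *\<^sub>R (c *\<^sub>R F)) \<le> \<bar>1/c\<bar> * dn (c *\<^sub>R F)"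
      by (rule le) (rule subspace_scale[OF subspace_dual F])
    then have "dn F \<le> \<bar>1/c\<bar> * dn (c *\<^sub>R F)" using False by simp
    then have "\<bar>c\<bar> * dn F \<le> dn (c *\<^sub>R F)" using False by (simp add: field_simps)
    then show ?thesis using le[OF F, of c] by simp
  qed
qed

sublocale dual: seminormed D dn by (rule seminormed_dual)

lemma dual_pairing_tendsto:
  assumes "F \<in> D" "u \<in> S" "\<And>k. G k \<in> D" "\<And>k. s k \<in> S" 
    and G: "(\<lambda>k. dn (G k - F)) \<longlonglongrightarrow> 0" and s: "(\<lambda>k. N (s k - u)) \<longlonglongrightarrow> 0"
  shows "(\<lambda>k. G k (s k)) \<longlonglongrightarrow> F u"
proof -
  have "\<bar>G k (s k) - F u\<bar> \<le> dn (G k - F) * N (s k - u) + dn (G k - F) * N u + dn F * N (s k - u)" for k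
  proof -
    have GF: "G k - F \<in> D" by (rule dual.mem(3)[OF assms(3) assms(1)])
    have su: "s k - u \<in> S" by (rule mem(3)[OF assms(4) assms(2)])
    have "\<bar>G k (s k) - F u\<bar> = \<bar>(G k - F) (s k - u) + (G k - F) u + F (s k - u)\<bar>"
      using assms(1-4) by (simp add: dual_diff)
    also have "\<dots> \<le> \<bar>(G k - F) (s k - u)\<bar> + \<bar>(G k - F) u\<bar> + \<bar>F (s k - u)\<bar>" by (rule abs_triangle_ineq3)
    also have "\<dots> \<le> dn (G k - F) * N (s k - u) + dn (G k - F) * N u + dn F * N (s k - u)"
      by (intro add_mono dual_le[OF GF su] dual_le[OF GF assms(2)] dual_le[OF assms(1) su])
    finally show ?thesis .
  qed
  note bound = this
  have "(\<lambda>k. dn (G k - F) * N (s k - u) + dn (G k - F) * N u + dn F * N (s k - u)) \<longlonglongrightarrow> 0"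
    using tendsto_add[OF tendsto_add[OF tendsto_mult[OF G s] tendsto_mult[OF G tendsto_const[of "N u"]]]
        tendsto_mult[OF tendsto_const[of "dn F"] s]] by simp
  from squeeze_zero[OF this bound] have "(\<lambda>k. G k (s k) - F u) \<longlonglongrightarrow> 0" .
  then show ?thesis by (simp add: LIM_zero_iff)
qed

lemma pairing_in_borel:
  assumes M: "complete_measure M" and F: "strongly_measurable M D dn F" and u: "strongly_measurable M S N u"
  shows "(\<lambda>t. F t (u t)) \<in> borel_measurable M"
proof -
  interpret complete_measure M by fact
  obtain s where s: "approx M S N s u" using u strongly_measurable_iff by metis
  obtain G where G: "approx M D dn G F" using F unfolding strongly_measurable_iff by blast
  show ?thesis by (rule pairing_measurable[OF G s, where B="\<lambda>F u. F u"]) (rule dual_pairing_tendsto)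
qed

lemma pairing_bound:
  assumes M: "complete_measure M" and F: "F \<in> L2t M D dn" and u: "u \<in> L2t M S N"
  shows "integrable M (\<lambda>t. F t (u t))"
    "\<bar>LINT t|M. F t (u t)\<bar> \<le> sqrt (LINT t|M. (dn (F t))\<^sup>2) * sqrt (LINT t|M. (N (u t))\<^sup>2)"
proof -
  interpret complete_measure M by fact
  interpret sq: semi_inner "sqint M" "\<lambda>f g. LINT x|M. f x * g x" by (rule semi_inner_sqint)
  have F': "(\<lambda>t. dn (F t)) \<in> sqint M" by (rule L2t_sqint[OF seminormed_dual F])
  have u': "(\<lambda>t. N (u t)) \<in> sqint M" by (rule L2t_sqint[OF seminormed_axioms u])
  have int: "integrable M (\<lambda>t. dn (F t) * N (u t))" by (rule sqint_integrable_mult[OF F' u'])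
  have ae: "AE t in M. \<bar>F t (u t)\<bar> \<le> dn (F t) * N (u t)"
    using L2t_AE[OF F] L2t_AE[OF u] by eventually_elim (rule dual_le)
  show i: "integrable M (\<lambda>t. F t (u t))"
  proof (rule Bochner_Integration.integrable_bound[OF int])
    show "(\<lambda>t. F t (u t)) \<in> borel_measurable M" using F u by (intro pairing_in_borel[OF M]) (auto simp: L2t_def)
    show "AE t in M. norm (F t (u t)) \<le> norm (dn (F t) * N (u t))" using ae by eventually_elim simp
  qed
  have "\<bar>LINT t|M. F t (u t)\<bar> \<le> (LINT t|M. \<bar>F t (u t)\<bar>)" by (rule integral_abs_bound)
  also have "\<dots> \<le> (LINT t|M. dn (F t) * N (u t))" using int i ae by (intro integral_mono_AE) auto
  also have "\<dots> \<le> \<bar>LINT t|M. dn (F t) * N (u t)\<bar>" by simp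
  also have "\<dots> \<le> sqrt (LINT t|M. (dn (F t))\<^sup>2) * sqrt (LINT t|M. (N (u t))\<^sup>2)"
    using sq.Cauchy_Schwarz[OF F' u'] by (simp add: power2_eq_square)
  finally show "\<bar>LINT t|M. F t (u t)\<bar> \<le> sqrt (LINT t|M. (dn (F t))\<^sup>2) * sqrt (LINT t|M. (N (u t))\<^sup>2)" .
qed

text \<open>In the next two lemmas the exceptional null set may depend on the vector; strong measurability
  confines everything to a separable subspace.\<close>

lemma AE_zero_along:
  assumes p: "strongly_measurable M S N p" and l: "AE t in M. l t \<in> D"
    and zero: "\<And>v. v \<in> S \<Longrightarrow> AE t in M. l t v = 0"
  shows "AE t in M. l t (p t) = 0"
proof -
  obtain s where s: "approx M S N s p" using p strongly_measurable_iff by metis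
  define C where "C = (\<Union>k. s k ` space M)"
  have "countable C" unfolding C_def using approxD(1)[OF s]
    by (intro countable_UN) (auto simp: simple_function_def countable_finite)
  moreover have "AE t in M. l t v = 0" if "v \<in> C" for v
    using that approxD(2)[OF s] unfolding C_def by (intro zero) auto
  ultimately have "AE t in M. \<forall>v\<in>C. l t v = 0" by (simp add: AE_ball_countable)
  then show ?thesis
    using l approxE[OF s]
  proof eventually_elim
    fix t assume z: "\<forall>v\<in>C. l t v = 0" and l: "l t \<in> D"
      and h: "t \<in> space M \<and> p t \<in> S \<and> (\<forall>k. s k t \<in> S) \<and> (\<lambda>k. N (s k t - p t)) \<longlonglongrightarrow> 0"
    have "(\<lambda>k. l t (s k t)) \<longlonglongrightarrow> l t (p t)"
      using h l dual_pairing_tendsto[of "l t" "p t" "\<lambda>_. l t" "\<lambda>k. s k t"] by (simp only: diff_self dual.zero) auto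
    moreover have "l t (s k t) = 0" for k using z h unfolding C_def by auto
    ultimately show "l t (p t) = 0" by (simp add: LIMSEQ_const_iff)
  qed
qed

lemma AE_zero_dual:
  assumes l: "strongly_measurable M D dn l"
    and zero: "\<And>v. v \<in> S \<Longrightarrow> AE t in M. l t v = 0"
  shows "AE t in M. \<forall>v\<in>S. l t v = 0"
proof -
  obtain s where s: "approx M D dn s l" using l unfolding strongly_measurable_iff by blast
  have ex: "\<exists>v. v \<in> S \<and> N v \<le> 1 \<and> dn L < \<bar>L v\<bar> + 1 / real (Suc n)" if "L \<in> D" for L and n :: nat
    using dual_norm_approx[OF that, of "1 / real (Suc n)"] by auto
  \<comment> \<open>Vectors that norm \<open>L\<close> up to \<open>1 / Suc n\<close>. Choosing them
    for the countably many values of the approximating functionals leaves countably many vectors on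
    which \<open>l t\<close> must vanish, so one null set suffices.\<close>
  define w where "w L n = (SOME v. v \<in> S \<and> N v \<le> 1 \<and> dn L < \<bar>L v\<bar> + 1 / real (Suc n))" for L and n :: nat
  have w: "w L n \<in> S \<and> N (w L n) \<le> 1 \<and> dn L < \<bar>L (w L n)\<bar> + 1 / real (Suc n)" if "L \<in> D" for L n
    unfolding w_def by (rule someI_ex[OF ex[OF that]])
  define C where "C = (\<Union>k. s k ` space M)"
  have C: "countable C" unfolding C_def using approxD(1)[OF s]
    by (intro countable_UN) (auto simp: simple_function_def countable_finite)
  have CD: "C \<subseteq> D" using approxD(2)[OF s] unfolding C_def by auto
  have "AE t in M. \<forall>L\<in>C. \<forall>n. l t (w L n) = 0"
    using C w CD zero by (auto simp: AE_ball_countable AE_all_countable)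
  then show ?thesis
    using approxE[OF s]
  proof eventually_elim
    fix t assume z: "\<forall>L\<in>C. \<forall>n. l t (w L n) = 0"
      and h: "t \<in> space M \<and> l t \<in> D \<and> (\<forall>k. s k t \<in> D) \<and> (\<lambda>k. dn (s k t - l t)) \<longlonglongrightarrow> 0"
    have le: "dn (s k t) \<le> dn (s k t - l t)" for k
    proof (rule field_le_epsilon)
      fix e :: real assume "e > 0"
      then obtain n :: nat where n: "1 / real (Suc n) < e" using nat_approx_posE by blast
      have L: "s k t \<in> D" using h by simp
      have "l t (w (s k t) n) = 0" using z h unfolding C_def by auto
      then have "\<bar>s k t (w (s k t) n)\<bar> = \<bar>(s k t - l t) (w (s k t) n)\<bar>" by simp
      also have "\<dots> \<le> dn (s k t - l t)" using w[OF L, of n] L h dual_norm_upper[OF dual.mem(3), of "s k t" "l t" "w (s k t) n"] by auto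
      finally show "dn (s k t) \<le> dn (s k t - l t) + e" using w[OF L, of n] n by simp
    qed
    have "dn (l t) \<le> 2 * dn (s k t - l t)" for k
      using dual.triangle_diff[of "s k t" "s k t - l t"] le[of k] h by simp
    moreover have "(\<lambda>k. 2 * dn (s k t - l t)) \<longlonglongrightarrow> 0" using h by (intro tendsto_mult_right_zero) auto
    ultimately have "dn (l t) \<le> 0" using LIMSEQ_le_const by blast
    then have "dn (l t) = 0" using h dual.nonneg[of "l t"] by simp
    then show "\<forall>v\<in>S. l t v = 0" using h dual_le[of "l t"] by fastforce
  qed
qed

end

section \<open>Integrals over a time interval\<close>

abbreviation time_measure :: "real \<Rightarrow> real measure" where
  "time_measure T \<equiv> lebesgue_on {0<..<T}"

lemma complete_measure_lebesgue_on:
  fixes A :: "'a::euclidean_space set"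
  assumes "A \<in> sets lebesgue"
  shows "complete_measure (lebesgue_on A)"
proof
  fix B N assume "B \<subseteq> N" "N \<in> null_sets (lebesgue_on A)"
  then have "B \<subseteq> A" "B \<in> null_sets lebesgue"
    using assms by (auto simp: null_sets_restrict_space intro: completion.complete2)
  then show "B \<in> sets (lebesgue_on A)"
    using assms by (auto simp: sets_restrict_space_iff)
qed

lemma complete_time: "complete_measure (time_measure T)"
  by (rule complete_measure_lebesgue_on) auto

lemma finite_time: "finite_measure (time_measure T)"
  by (intro finite_measure_lebesgue_on bounded_set_imp_lmeasurable) auto

lemma space_time [simp]: "space (time_measure T) = {0<..<T}"
  by simp

lemma ident_time_borel [measurable]: "(\<lambda>t. t) \<in> borel_measurable (time_measure T)"
  by (intro measurable_restrict_space1 measurable_completion) simp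

lemma borel_measurable_time:
  "f \<in> borel_measurable borel \<Longrightarrow> f \<in> borel_measurable (time_measure T)"
  by (rule measurable_compose[OF ident_time_borel])

lemma AE_time_neq: "AE t in time_measure T. t \<noteq> a"
proof -
  have "{a} \<in> null_sets lebesgue" by (simp add: null_sets_completionI)
  then have "AE t in lebesgue. t \<noteq> (a::real)" by (rule AE_I') auto
  then have "AE t in lebesgue. t \<in> {0<..<T} \<longrightarrow> t \<noteq> a" by eventually_elim simp
  then show ?thesis by (simp add: AE_restrict_space_iff)
qed

lemma integrable_time_bounded_mult:
  assumes "integrable (time_measure T) h" "f \<in> borel_measurable (time_measure T)" "\<And>t. \<lbrakk>0 < t; t < T\<rbrakk> \<Longrightarrow> \<bar>f t\<bar> \<le> C"
  shows "integrable (time_measure T) (\<lambda>t. f t * h t :: real)"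
proof (rule Bochner_Integration.integrable_bound)
  show "integrable (time_measure T) (\<lambda>t. C * h t)" using assms(1) by simp
  show "(\<lambda>t. f t * h t) \<in> borel_measurable (time_measure T)" using assms by (intro borel_measurable_times) auto
  show "AE t in time_measure T. norm (f t * h t) \<le> norm (C * h t)"
  proof (rule AE_I2)
    fix t assume "t \<in> space (time_measure T)"
    then have "\<bar>f t\<bar> \<le> \<bar>C\<bar>" using assms(3)[of t] by simp
    then show "norm (f t * h t) \<le> norm (C * h t)" by (simp add: abs_mult mult_right_mono)
  qed
qed

lemma integrable_time_continuous_mult:
  assumes "integrable (time_measure T) h" "continuous_on UNIV f"
  shows "integrable (time_measure T) (\<lambda>t. f t * h t :: real)"
proof -
  have "compact (f ` {0..T})" using assms(2) by (intro compact_continuous_image continuous_on_subset[OF assms(2)]) auto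
  then obtain C where "\<And>t. t \<in> {0..T} \<Longrightarrow> \<bar>f t\<bar> \<le> C"
    by (metis compact_imp_bounded bounded_iff image_eqI real_norm_def)
  then show ?thesis
    using assms by (intro integrable_time_bounded_mult[of _ _ _ C] borel_measurable_time borel_measurable_continuous_onI) auto
qed

section \<open>Primitives of scalar functions of time\<close>

definition running :: "real \<Rightarrow> (real \<Rightarrow> real) \<Rightarrow> real \<Rightarrow> real" where
  "running T h s = (LINT t|time_measure T. indicator {..<s} t * h t)"

lemma integrable_running:
  fixes h :: "real \<Rightarrow> real"
  assumes "integrable (time_measure T) h"
  shows "integrable (time_measure T) (\<lambda>t. indicator {..<s} t * h t)"
  by (rule integrable_time_bounded_mult[OF assms, of "indicator {..<s}" 1])
    (auto intro!: borel_measurable_time simp: indicator_def)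

lemma running_0: "running T h 0 = 0"
  unfolding running_def by (subst Bochner_Integration.integral_cong[OF refl, of _ _ "\<lambda>_. 0"]) auto

lemma running_T: "running T h T = (LINT t|time_measure T. h t)"
  unfolding running_def by (rule Bochner_Integration.integral_cong) auto

lemma running_linear:
  assumes "integrable (time_measure T) h" "integrable (time_measure T) k"
  shows "running T (\<lambda>t. a * h t + b * k t) s = a * running T h s + b * running T k s"
proof -
  have "running T (\<lambda>t. a * h t + b * k t) s =
      (LINT t|time_measure T. a * (indicator {..<s} t * h t) + b * (indicator {..<s} t * k t))"
    unfolding running_def by (simp add: algebra_simps)
  also have "\<dots> = a * running T h s + b * running T k s"
    unfolding running_def using integrable_running[OF assms(1)] integrable_running[OF assms(2)] by simp
  finally show ?thesis .
qed

lemma continuous_running: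
  fixes h :: "real \<Rightarrow> real"
  assumes h: "integrable (time_measure T) h"
  shows "isCont (running T h) s"
  unfolding continuous_at_sequentially
proof (intro allI impI)
  fix u :: "nat \<Rightarrow> real" assume u: "u \<longlonglongrightarrow> s"
  have "(\<lambda>n. LINT t|time_measure T. indicator {..<u n} t * h t) \<longlonglongrightarrow> (LINT t|time_measure T. indicator {..<s} t * h t)"
  proof (rule integral_dominated_convergence[where w="\<lambda>t. \<bar>h t\<bar>"])
    show "AE t in time_measure T. (\<lambda>n. indicator {..<u n} t * h t) \<longlonglongrightarrow> indicator {..<s} t * h t"
      using AE_time_neq[of s]
    proof eventually_elim
      fix t assume "t \<noteq> s"
      then have "\<forall>\<^sub>F n in sequentially. indicator {..<u n} t * h t = indicator {..<s} t * h t"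
      proof (cases "t < s")
        case True
        show ?thesis using order_tendstoD(1)[OF u True] by eventually_elim (use True in simp)
      next
        case False
        then have "s < t" using \<open>t \<noteq> s\<close> by simp
        show ?thesis using order_tendstoD(2)[OF u \<open>s < t\<close>] by eventually_elim (use \<open>s < t\<close> in simp)
      qed
      then show "(\<lambda>n. indicator {..<u n} t * h t) \<longlonglongrightarrow> indicator {..<s} t * h t" by (rule tendsto_eventually)
    qed
    show "integrable (time_measure T) (\<lambda>t. \<bar>h t\<bar>)" using h by simp
    show "AE t in time_measure T. norm (indicator {..<u n} t * h t) \<le> \<bar>h t\<bar>" for n
      by (auto simp: indicator_def)
    show "(\<lambda>t. indicator {..<s} t * h t) \<in> borel_measurable (time_measure T)" using integrable_running[OF h] by auto
    show "(\<lambda>t. indicator {..<u n} t * h t) \<in> borel_measurable (time_measure T)" for n using integrable_running[OF h] by auto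
  qed
  then show "(running T h \<circ> u) \<longlonglongrightarrow> running T h s" by (simp add: running_def o_def)
qed

lemma integral_time_FTC:
  fixes F f :: "real \<Rightarrow> real"
  assumes "0 \<le> s" "s \<le> T" and F: "\<And>x. (F has_real_derivative f x) (at x)" and f: "\<And>x. isCont f x"
  shows "(LINT t|time_measure T. f t * indicator {s<..} t) = F T - F s"
proof -
  have "(LINT t|time_measure T. f t * indicator {s<..} t) = (LINT t|lebesgue. indicator {0<..<T} t *\<^sub>R (f t * indicator {s<..} t))"
    by (rule integral_restrict_space) auto
  also have "\<dots> = (LINT t|lebesgue. f t * indicator {s..T} t)"
  proof (rule integral_cong_AE)
    have "{s, T} \<in> null_sets lebesgue" by (intro null_sets_completionI finite_imp_null_set_lborel) auto
    then have "AE t in lebesgue. t \<noteq> s \<and> t \<noteq> T" by (rule AE_I') auto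
    then show "AE t in lebesgue. indicator {0<..<T} t *\<^sub>R (f t * indicator {s<..} t) = f t * indicator {s..T} t"
      by eventually_elim (use assms(1,2) in \<open>auto simp: indicator_def\<close>)
    have "f \<in> borel_measurable borel" using f by (intro borel_measurable_continuous_onI) (simp add: continuous_on_eq_continuous_at)
    then have [measurable]: "f \<in> borel_measurable lborel" by simp
    show "(\<lambda>t. indicator {0<..<T} t *\<^sub>R (f t * indicator {s<..} t)) \<in> borel_measurable lebesgue"
      by (rule measurable_completion) measurable
    show "(\<lambda>t. f t * indicator {s..T} t) \<in> borel_measurable lebesgue"
      by (rule measurable_completion) measurable
  qed
  also have "\<dots> = (LINT t|lborel. f t * indicator {s..T} t)"
  proof (rule integral_completion)
    have "f \<in> borel_measurable borel" using f by (intro borel_measurable_continuous_onI) (simp add: continuous_on_eq_continuous_at)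
    then have [measurable]: "f \<in> borel_measurable lborel" by simp
    show "(\<lambda>t. f t * indicator {s..T} t) \<in> borel_measurable lborel" by measurable
  qed
  also have "\<dots> = F T - F s" using assms(2) F f by (intro integral_FTC_Icc_real) auto
  finally show ?thesis .
qed

text \<open>Fubini on the triangle \<open>s < t\<close>, where the inner integral of
  \<open>\<psi>'\<close> from \<open>s\<close> to \<open>T\<close> is
  \<open>\<psi> T - \<psi> s\<close>. Integration by parts thus holds although the primitive of
  \<open>h\<close> need not be differentiable everywhere.\<close>

lemma integral_running_by_parts:
  fixes \<psi> \<psi>' :: "real \<Rightarrow> real"
  assumes T: "0 < T" and h: "integrable (time_measure T) h"
    and \<psi>: "\<And>x. (\<psi> has_real_derivative \<psi>' x) (at x)" and \<psi>': "\<And>x. isCont \<psi>' x"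
  shows "(LINT t|time_measure T. \<psi>' t * running T h t) = (LINT s|time_measure T. (\<psi> T - \<psi> s) * h s)"
proof -
  interpret I: finite_measure "time_measure T" by (rule finite_time)
  interpret P: pair_sigma_finite "time_measure T" "time_measure T" ..
  have c: "continuous_on UNIV \<psi>'" using \<psi>' by (simp add: continuous_on_eq_continuous_at)
  then have "compact (\<psi>' ` {0..T})" by (intro compact_continuous_image continuous_on_subset[OF c]) auto
  then obtain C where C: "\<And>t. t \<in> {0..T} \<Longrightarrow> \<bar>\<psi>' t\<bar> \<le> C"
    by (metis compact_imp_bounded bounded_iff image_eqI real_norm_def)
  have [measurable]: "\<psi>' \<in> borel_measurable (time_measure T)" "h \<in> borel_measurable (time_measure T)"
    using c h by (auto intro!: borel_measurable_time borel_measurable_continuous_onI)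
  have m: "{z \<in> space (time_measure T \<Otimes>\<^sub>M time_measure T). snd z < fst z} \<in> sets (time_measure T \<Otimes>\<^sub>M time_measure T)"
    by measurable
  define k where "k z = \<psi>' (fst z) * ((if snd z < fst z then 1 else 0) * h (snd z))" for z :: "real \<times> real"
  have [measurable]: "k \<in> borel_measurable (time_measure T \<Otimes>\<^sub>M time_measure T)"
    unfolding k_def by measurable
  have int: "integrable (time_measure T \<Otimes>\<^sub>M time_measure T) k"
  proof (rule Bochner_Integration.integrable_bound)
    show "integrable (time_measure T \<Otimes>\<^sub>M time_measure T) (\<lambda>(t, s). C * h s)"
    proof (rule P.Fubini_integrable)
      show "AE t in time_measure T. integrable (time_measure T) (\<lambda>s. case (t, s) of (t, s) \<Rightarrow> C * h s)" using h by simp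
    qed (use h in \<open>auto\<close>)
    show "AE z in time_measure T \<Otimes>\<^sub>M time_measure T. norm (k z) \<le> norm (case z of (t, s) \<Rightarrow> C * h s)"
    proof (rule AE_I2)
      fix z assume z: "z \<in> space (time_measure T \<Otimes>\<^sub>M time_measure T)"
      then have "\<bar>\<psi>' (fst z)\<bar> \<le> \<bar>C\<bar>" using C[of "fst z"] by (auto simp: space_pair_measure)
      then show "norm (k z) \<le> norm (case z of (t, s) \<Rightarrow> C * h s)"
        by (auto simp: k_def abs_mult split: prod.splits intro!: mult_right_mono)
    qed
  qed simp
  have "(LINT t|time_measure T. \<psi>' t * running T h t) = (LINT t|time_measure T. LINT s|time_measure T. k (t, s))"
    unfolding running_def k_def
    by (intro Bochner_Integration.integral_cong refl) (simp add: indicator_def of_bool_def)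
  also have "\<dots> = (LINT s|time_measure T. LINT t|time_measure T. k (t, s))"
    using P.Fubini_integral[of "\<lambda>t s. k (t, s)"] int by simp
  also have "\<dots> = (LINT s|time_measure T. (\<psi> T - \<psi> s) * h s)"
  proof (rule Bochner_Integration.integral_cong[OF refl])
    fix s assume "s \<in> space (time_measure T)"
    then have s: "0 < s" "s < T" by auto
    have "(LINT t|time_measure T. k (t, s)) = (LINT t|time_measure T. (\<psi>' t * indicator {s<..} t) * h s)"
      by (rule Bochner_Integration.integral_cong) (auto simp: k_def indicator_def)
    also have "\<dots> = (\<psi> T - \<psi> s) * h s" using integral_time_FTC[of s T \<psi> \<psi>'] s \<psi> \<psi>' by simp
    finally show "(LINT t|time_measure T. k (t, s)) = (\<psi> T - \<psi> s) * h s" .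
  qed
  finally show ?thesis .
qed

text \<open>Pass to a Borel representative \<open>k\<close> on the line. The measures whose
  densities are the positive and the negative part of \<open>k\<close> agree on all half-lines,
  hence everywhere, and uniqueness of densities makes the two parts agree. The parts are not written
  out because \<open>ennreal\<close> truncates negative numbers to 0.\<close>

lemma AE_zero_of_running:
  assumes T: "0 < T" and h: "integrable (time_measure T) h" and z: "\<And>s. \<lbrakk>0 \<le> s; s \<le> T\<rbrakk> \<Longrightarrow> running T h s = 0"
  shows "AE t in time_measure T. h t = 0"
proof -
  define h0 where "h0 t = indicator {0<..<T} t * h t" for t
  have h0: "integrable lebesgue h0"
    using h unfolding h0_def by (subst (asm) integrable_restrict_space) auto
  obtain k where k[measurable]: "k \<in> borel_measurable lborel" and hk: "AE t in lborel. h0 t = k t"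
    using completion_ex_borel_measurable_real[of h0 lborel] h0 by auto
  have hk': "AE t in lebesgue. h0 t = k t" using hk by (rule AE_completion)
  have kl: "k \<in> borel_measurable lebesgue" using k by (rule measurable_completion)
  have "integrable lebesgue k" using h0 integrable_cong_AE[OF _ kl hk'] by auto
  then have ik: "integrable lborel k" using integrable_completion[of k lborel] by simp
  have zero: "(LINT t|lborel. indicator {x<..} t * k t) = 0" for x
  proof -
    have "(LINT t|lborel. indicator {x<..} t * k t) = (LINT t|lebesgue. indicator {x<..} t * k t)"
      by (rule integral_completion[symmetric]) measurable
    \<comment> \<open>The cut point is clamped to \<open>[0, T]\<close>, the range in which the
      primitive is known to vanish.\<close>
    also have "\<dots> = (LINT t|lebesgue. indicator {0<..<T} t *\<^sub>R (h t - indicator {..<max 0 (min x T)} t * h t))"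
    proof (rule integral_cong_AE)
      have "{x} \<in> null_sets lebesgue" by (simp add: null_sets_completionI)
      then have "AE t in lebesgue. t \<noteq> x" by (rule AE_I') auto
      with hk' show "AE t in lebesgue. indicator {x<..} t * k t = indicator {0<..<T} t *\<^sub>R (h t - indicator {..<max 0 (min x T)} t * h t)"
        by eventually_elim (auto simp: h0_def indicator_def max_def min_def)
      show "(\<lambda>t. indicator {x<..} t * k t) \<in> borel_measurable lebesgue" by (rule measurable_completion) measurable
      have "(\<lambda>t. h t - indicator {..<max 0 (min x T)} t * h t) \<in> borel_measurable (time_measure T)"
        using h integrable_running[OF h] by auto
      then show "(\<lambda>t. indicator {0<..<T} t *\<^sub>R (h t - indicator {..<max 0 (min x T)} t * h t)) \<in> borel_measurable lebesgue"
        by (subst (asm) borel_measurable_restrict_space_iff) auto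
    qed
    also have "\<dots> = (LINT t|time_measure T. h t - indicator {..<max 0 (min x T)} t * h t)"
      by (rule integral_restrict_space[symmetric]) auto
    also have "\<dots> = running T h T - running T h (max 0 (min x T))"
      using h integrable_running[OF h, of "max 0 (min x T)"] by (simp add: running_T) (simp add: running_def)
    also have "\<dots> = 0" using z[of T] z[of "max 0 (min x T)"] T by simp
    finally show ?thesis .
  qed
  have "density lborel (\<lambda>t. ennreal (k t)) = density lborel (\<lambda>t. ennreal (- k t))"
  proof (rule measure_eqI_lessThan)
    fix x :: real
    have ix: "integrable lborel (\<lambda>t. indicator {x<..} t * k t)"
      using integrable_mult_indicator[of "{x<..}" lborel k] ik by simp
    have e: "emeasure (density lborel (\<lambda>t. ennreal (c * k t))) {x<..} = (\<integral>\<^sup>+t. ennreal (c * (indicator {x<..} t * k t)) \<partial>lborel)" for c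
      by (subst emeasure_density) (auto intro!: nn_integral_cong simp: indicator_def)
    have fin: "(\<integral>\<^sup>+t. ennreal (c * (indicator {x<..} t * k t)) \<partial>lborel) < \<infinity>" if "\<bar>c\<bar> \<le> 1" for c
    proof (rule le_less_trans)
      show "(\<integral>\<^sup>+t. ennreal (c * (indicator {x<..} t * k t)) \<partial>lborel) \<le> (\<integral>\<^sup>+t. ennreal (norm (indicator {x<..} t * k t)) \<partial>lborel)"
      proof (intro nn_integral_mono ennreal_leI)
        fix t :: real
        have "c * (indicator {x<..} t * k t) \<le> \<bar>c\<bar> * \<bar>indicator {x<..} t * k t\<bar>" by (metis abs_ge_self abs_mult)
        also have "\<dots> \<le> 1 * \<bar>indicator {x<..} t * k t\<bar>" by (intro mult_right_mono that) auto
        finally show "c * (indicator {x<..} t * k t) \<le> norm (indicator {x<..} t * k t)" by simp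
      qed
      show "(\<integral>\<^sup>+t. ennreal (norm (indicator {x<..} t * k t)) \<partial>lborel) < \<infinity>"
        using ix by (simp add: integrable_iff_bounded)
    qed
    show "emeasure (density lborel (\<lambda>t. ennreal (k t))) {x<..} < \<infinity>" using e[of 1] fin[of 1] by simp
    define X where "X = (\<integral>\<^sup>+t. ennreal (1 * (indicator {x<..} t * k t)) \<partial>lborel)"
    define Y where "Y = (\<integral>\<^sup>+t. ennreal ((-1) * (indicator {x<..} t * k t)) \<partial>lborel)"
    have "enn2real X - enn2real Y = 0"
      unfolding X_def Y_def zero[of x, symmetric] real_lebesgue_integral_def[OF ix] by (simp only: mult_1 mult_minus1)
    moreover have "X = ennreal (enn2real X)" "Y = ennreal (enn2real Y)"
      using fin[of 1] fin[of "-1"] unfolding X_def Y_def by (auto simp: less_top)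
    ultimately have "X = Y" by simp
    then show "emeasure (density lborel (\<lambda>t. ennreal (k t))) {x<..} = emeasure (density lborel (\<lambda>t. ennreal (- k t))) {x<..}"
      using e[of 1] e[of "-1"] unfolding X_def Y_def by simp
  qed auto
  then have "AE t in lborel. ennreal (k t) = ennreal (- k t)"
    by (intro sigma_finite_measure.density_unique[OF sigma_finite_lborel]) auto
  then have "AE t in lborel. h0 t = 0" using hk
  proof eventually_elim
    fix t assume "ennreal (k t) = ennreal (- k t)" "h0 t = k t"
    then show "h0 t = 0" by (cases "k t \<ge> 0") (auto simp: ennreal_neg ennreal_eq_0_iff not_le dest: sym)
  qed
  then have "AE t in lebesgue. h0 t = 0" by (rule AE_completion)
  then show ?thesis by (simp add: AE_restrict_space_iff h0_def) (auto elim!: eventually_mono)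
qed

lemma AE_zero_of_continuous:
  fixes h :: "real \<Rightarrow> real"
  assumes T: "0 < T" and h: "integrable (time_measure T) h"
    and z: "\<And>f. continuous_on UNIV f \<Longrightarrow> (LINT t|time_measure T. f t * h t) = 0"
  shows "AE t in time_measure T. h t = 0"
proof (rule AE_zero_of_running[OF T h])
  fix s
  \<comment> \<open>Continuous ramps of slope \<open>n\<close> that come down to 0 at
    \<open>s\<close>; they tend to the indicator of \<open>{..<s}\<close> at every point.\<close>
  define f where "f n t = max 0 (min 1 (real n * (s - t)))" for n :: nat and t
  have c: "continuous_on UNIV (f n)" for n unfolding f_def by (intro continuous_intros)
  have "(\<lambda>n. LINT t|time_measure T. f n t * h t) \<longlonglongrightarrow> (LINT t|time_measure T. indicator {..<s} t * h t)"
  proof (rule integral_dominated_convergence[where w="\<lambda>t. \<bar>h t\<bar>"])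
    show "AE t in time_measure T. (\<lambda>n. f n t * h t) \<longlonglongrightarrow> indicator {..<s} t * h t"
    proof (rule AE_I2)
      fix t
      have "\<forall>\<^sub>F n in sequentially. f n t = indicator {..<s} t"
      proof (cases "t < s")
        case True
        have "\<forall>\<^sub>F n in sequentially. 1 / (s - t) \<le> real n"
          using eventually_ge_at_top[of "nat \<lceil>1 / (s - t)\<rceil>"] by eventually_elim linarith
        then show ?thesis
        proof eventually_elim
          fix n assume "1 / (s - t) \<le> real n"
          then have "1 \<le> real n * (s - t)" using True by (simp add: field_simps)
          then show "f n t = indicator {..<s} t" using True by (simp add: f_def)
        qed
      next
        case False
        have "f n t = 0" for n using False mult_nonneg_nonpos[of "real n" "s - t"] by (simp add: f_def)
        then show ?thesis using False by simp
      qed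
      then have "(\<lambda>n. f n t) \<longlonglongrightarrow> indicator {..<s} t" by (rule tendsto_eventually)
      then show "(\<lambda>n. f n t * h t) \<longlonglongrightarrow> indicator {..<s} t * h t" by (rule tendsto_mult_right)
    qed
    have "\<bar>f n t\<bar> \<le> 1" for n t unfolding f_def by auto
    then show "AE t in time_measure T. norm (f n t * h t) \<le> \<bar>h t\<bar>" for n
      by (intro AE_I2) (simp add: abs_mult mult_left_le_one_le)
    show "integrable (time_measure T) (\<lambda>t. \<bar>h t\<bar>)" using h by simp
    show "(\<lambda>t. indicator {..<s} t * h t) \<in> borel_measurable (time_measure T)" using integrable_running[OF h] by auto
    show "(\<lambda>t. f n t * h t) \<in> borel_measurable (time_measure T)" for n using integrable_time_continuous_mult[OF h c] by auto
  qed
  moreover have "(LINT t|time_measure T. f n t * h t) = 0" for n using z c by simp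
  ultimately show "running T h s = 0" unfolding running_def by (simp add: LIMSEQ_const_iff)
qed

section \<open>Smooth bump functions and the lemma of du Bois-Reymond\<close>

text \<open>The sequence of all derivatives is the witness. Closure properties act on the whole
  sequence, and iterated \<open>deriv\<close> is computed only once, in
  \<open>smooth_iterated_deriv\<close>, when passing to \<open>test_function\<close>.\<close>

definition smooth :: "(real \<Rightarrow> real) \<Rightarrow> bool" where
  "smooth f \<longleftrightarrow> (\<exists>F. F 0 = f \<and> (\<forall>k x. (F k has_real_derivative F (Suc k) x) (at x)))"

lemma smooth_iterated_deriv:
  assumes "smooth f"
  shows "(deriv ^^ k) f differentiable at t"
proof -
  obtain F where F: "F 0 = f" "\<And>k x. (F k has_real_derivative F (Suc k) x) (at x)"
    using assms unfolding smooth_def by blast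
  have "(deriv ^^ k) f = F k"
  proof (induction k)
    case (Suc k)
    have "deriv (F k) = F (Suc k)" by (rule ext) (rule DERIV_imp_deriv[OF F(2)])
    then show ?case using Suc by simp
  qed (simp add: F)
  then show ?thesis using F(2)[of k t] by (auto simp: real_differentiable_def)
qed

lemma smooth_antiderivative:
  assumes "smooth f" "\<And>x. (g has_real_derivative f x) (at x)"
  shows "smooth g"
proof -
  obtain F where F: "F 0 = f" "\<And>k x. (F k has_real_derivative F (Suc k) x) (at x)"
    using assms unfolding smooth_def by blast
  show ?thesis unfolding smooth_def
    by (rule exI[of _ "\<lambda>k. case k of 0 \<Rightarrow> g | Suc j \<Rightarrow> F j"]) (auto simp: F assms split: nat.splits)
qed

lemma smooth_linear_combination:
  assumes "smooth f" "smooth g"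
  shows "smooth (\<lambda>x. a * f x + b * g x)"
proof -
  obtain F where F: "F 0 = f" "\<And>k x. (F k has_real_derivative F (Suc k) x) (at x)"
    using assms(1) unfolding smooth_def by blast
  obtain G where G: "G 0 = g" "\<And>k x. (G k has_real_derivative G (Suc k) x) (at x)"
    using assms(2) unfolding smooth_def by blast
  show ?thesis unfolding smooth_def
    by (rule exI[of _ "\<lambda>k x. a * F k x + b * G k x"])
      (simp add: F(1) G(1) DERIV_add[OF DERIV_cmult[OF F(2)] DERIV_cmult[OF G(2)]])
qed

lemma smooth_isCont: "smooth f \<Longrightarrow> isCont f x"
  unfolding smooth_def using DERIV_isCont by blast

lemma DERIV_zero_of_quadratic_bound:
  fixes f :: "real \<Rightarrow> real"
  assumes "f a = 0" "\<And>x. \<bar>f x\<bar> \<le> K * (x - a)\<^sup>2"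
  shows "(f has_real_derivative 0) (at a)"
proof -
  have "((\<lambda>h. f (a + h) / h) \<longlongrightarrow> 0) (at 0)"
  proof (rule Lim_null_comparison)
    show "\<forall>\<^sub>F h in at 0. norm (f (a + h) / h) \<le> K * \<bar>h\<bar>"
    proof (rule eventuallyI)
      fix h :: real
      have "\<bar>f (a + h)\<bar> \<le> K * \<bar>h\<bar> * \<bar>h\<bar>" using assms(2)[of "a + h"] by (simp add: power2_eq_square mult.assoc)
      moreover have "0 \<le> K" using assms(2)[of "a + 1"] by simp
      ultimately show "norm (f (a + h) / h) \<le> K * \<bar>h\<bar>" by (cases "h = 0") (auto simp: field_simps)
    qed
    show "((\<lambda>h. K * \<bar>h\<bar>) \<longlongrightarrow> 0) (at 0)" by (rule tendsto_eq_intros refl | simp)+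
  qed
  then show ?thesis using assms(1) by (simp add: DERIV_def)
qed

text \<open>The family of functions \<open>P(x) w(x)\<^sup>-\<^sup>n exp (- 1 / w(x))\<close> on \<open>(a, b)\<close>, \<open>w(x) = (x - a)(b - x)\<close>,
  is closed under differentiation.\<close>

definition bump_term :: "real \<Rightarrow> real \<Rightarrow> real poly \<Rightarrow> nat \<Rightarrow> real \<Rightarrow> real" where
  "bump_term a b P n x = (if a < x \<and> x < b then
     poly P x * inverse ((x - a) * (b - x)) ^ n * exp (- inverse ((x - a) * (b - x))) else 0)"

lemma power_le_exp:
  fixes y :: real
  assumes "0 \<le> y"
  shows "y ^ n / fact n \<le> exp y"
proof -
  have "(\<Sum>k\<in>{n}. y ^ k /\<^sub>R fact k) \<le> (\<Sum>k. y ^ k /\<^sub>R fact k)"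
    using assms by (intro sum_le_suminf sums_summable[OF exp_converges]) auto
  also have "(\<Sum>k. y ^ k /\<^sub>R fact k) = exp y" by (rule sums_unique[symmetric, OF exp_converges])
  finally show ?thesis by (simp add: divide_inverse_commute)
qed

text \<open>For \<open>y = inverse w\<close> this follows from
  \<open>y ^ (n + 2) \<le> fact (n + 2) * exp y\<close>, one term of the exponential series. Two
  more powers than \<open>n\<close> are spent because a quadratic bound in \<open>w\<close> is what
  makes the derivative vanish at the ends of the support.\<close>

lemma exp_power_bound:
  fixes w :: real
  assumes w: "w > 0"
  shows "inverse w ^ n * exp (- inverse w) \<le> fact (n + 2) * w\<^sup>2"
proof -
  define y where "y = inverse w"
  have y: "y > 0" using w by (simp add: y_def)
  have "y * w = 1" using w by (simp add: y_def)
  then have "y ^ n = y ^ n * ((y * w) * (y * w))" by simp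
  also have "\<dots> = y ^ (n + 2) * w\<^sup>2" by (simp add: power2_eq_square mult_ac)
  finally have "y ^ n = y ^ (n + 2) * w\<^sup>2" .
  then have "y ^ n * exp (- y) = (y ^ (n + 2) * exp (- y)) * w\<^sup>2" by (simp only: mult_ac)
  also have "y ^ (n + 2) * exp (- y) \<le> fact (n + 2)"
  proof -
    have "y ^ (n + 2) \<le> exp y * fact (n + 2)"
      using power_le_exp[of y "n + 2"] y by (simp only: pos_divide_le_eq[OF fact_gt_zero] less_imp_le)
    then have "y ^ (n + 2) * exp (- y) \<le> exp y * fact (n + 2) * exp (- y)"
      by (rule mult_right_mono) simp
    also have "\<dots> = fact (n + 2) * (exp y * exp (- y))" by (simp only: mult_ac)
    also have "\<dots> = fact (n + 2)" by (simp only: exp_add[symmetric] add.right_inverse exp_zero mult_1_right)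
    finally show ?thesis .
  qed
  finally show ?thesis by (simp add: y_def mult_right_mono)
qed

lemma bump_term_bound:
  assumes ab: "a < b"
  obtains K where "\<And>x. \<bar>bump_term a b P n x\<bar> \<le> K * (x - a)\<^sup>2" "\<And>x. \<bar>bump_term a b P n x\<bar> \<le> K * (x - b)\<^sup>2"
proof -
  have "bounded (poly P ` {a..b})" by (intro compact_imp_bounded compact_continuous_image continuous_intros) auto
  then obtain C where "\<forall>y\<in>poly P ` {a..b}. norm y \<le> C" unfolding bounded_iff by blast
  then have C: "\<bar>poly P x\<bar> \<le> C" if "x \<in> {a..b}" for x using that by simp
  have C0: "0 \<le> C" using C[of a] ab by simp
  \<comment> \<open>Of the two factors of \<open>w\<close> one is kept, either \<open>x - a\<close>
    or \<open>b - x\<close>, and the other is at most \<open>b - a\<close>.\<close>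
  define K where "K = C * fact (n + 2) * (b - a)\<^sup>2"
  have K0: "0 \<le> K" using C0 by (simp add: K_def)
  have *: "\<bar>bump_term a b P n x\<bar> \<le> K * (x - a)\<^sup>2 \<and> \<bar>bump_term a b P n x\<bar> \<le> K * (x - b)\<^sup>2" for x
  proof (cases "a < x \<and> x < b")
    case False
    then have "bump_term a b P n x = 0" by (auto simp: bump_term_def)
    then show ?thesis using K0 by simp
  next
    case True
    define w where "w = (x - a) * (b - x)"
    have w: "w > 0" using True by (simp add: w_def)
    have "\<bar>bump_term a b P n x\<bar> = \<bar>poly P x\<bar> * (inverse w ^ n * exp (- inverse w))"
      using True w by (simp add: bump_term_def w_def[symmetric] abs_mult)
    also have "\<dots> \<le> C * (fact (n + 2) * w\<^sup>2)"
      by (rule mult_mono[OF _ exp_power_bound[OF w] C0]) (use True w C[of x] in auto)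
    finally have b: "\<bar>bump_term a b P n x\<bar> \<le> C * fact (n + 2) * w\<^sup>2" by (simp only: mult.assoc)
    have "w \<le> (x - a) * (b - a)" "w \<le> (b - x) * (b - a)"
      unfolding w_def using True mult_left_mono[of "b - x" "b - a" "x - a"] mult_left_mono[of "x - a" "b - a" "b - x"]
      by (auto simp: mult.commute)
    then have "w\<^sup>2 \<le> ((x - a) * (b - a))\<^sup>2" "w\<^sup>2 \<le> ((b - x) * (b - a))\<^sup>2"
      using w by (auto intro!: power_mono)
    then have "C * fact (n + 2) * w\<^sup>2 \<le> C * fact (n + 2) * ((x - a) * (b - a))\<^sup>2"
      "C * fact (n + 2) * w\<^sup>2 \<le> C * fact (n + 2) * ((b - x) * (b - a))\<^sup>2"
      using C0 by (intro mult_left_mono; simp)+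
    then show ?thesis using b
      by (auto simp: K_def power_mult_distrib power2_commute[of x b] mult_ac simp del: fact_Suc)
  qed
  then show thesis using that by blast
qed

text \<open>With \<open>w = (x - a) * (b - x)\<close> and \<open>v = 1 / w\<close> one has
  \<open>v' = - w' * v\<^sup>2\<close>, so the derivative of \<open>P * v ^ n * exp (- v)\<close> is
  \<open>(P' + P * w' * v\<^sup>2 - n * P * w' * v) * v ^ n * exp (- v)\<close>. Taking out
  \<open>v ^ (n + 2)\<close> leaves this polynomial; \<open>[:a + b, -2:]\<close> is
  \<open>w'\<close>.\<close>

definition bump_deriv_poly :: "real \<Rightarrow> real \<Rightarrow> real poly \<Rightarrow> nat \<Rightarrow> real poly" where
  "bump_deriv_poly a b P n = pderiv P * ([:-a, 1:] * [:b, -1:])\<^sup>2 + P * [:a + b, -2:]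
     - smult (real n) (P * [:a + b, -2:] * ([:-a, 1:] * [:b, -1:]))"

lemma bump_term_deriv:
  assumes ab: "a < b"
  shows "(bump_term a b P n has_real_derivative bump_term a b (bump_deriv_poly a b P n) (n + 2) x) (at x)"
proof -
  consider "a < x \<and> x < b" | "x = a \<or> x = b" | "x < a \<or> b < x" by linarith
  then show ?thesis
  proof cases
    case 1
    define w where "w = (x - a) * (b - x)"
    have w: "w > 0" using 1 by (simp add: w_def)
    have dw: "((\<lambda>x. (x - a) * (b - x)) has_real_derivative (a + b - 2 * x)) (at x)"
      by (auto intro!: derivative_eq_intros)
    define v where "v = inverse w"
    have v: "v * w = 1" using w by (simp add: v_def)
    have dv: "((\<lambda>x. inverse ((x - a) * (b - x))) has_real_derivative - ((a + b - 2 * x) * v\<^sup>2)) (at x)"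
      using DERIV_inverse_fun[OF dw] 1 by (simp add: v_def w_def power2_eq_square mult_ac)
    have "((\<lambda>x. poly P x * inverse ((x - a) * (b - x)) ^ n * exp (- inverse ((x - a) * (b - x)))) has_real_derivative
       bump_term a b (bump_deriv_poly a b P n) (n + 2) x) (at x)"
    proof (rule DERIV_cong[OF DERIV_mult[OF DERIV_mult[OF poly_DERIV DERIV_power[OF dv]] DERIV_fun_exp[OF DERIV_minus[OF dv]]]])
      define q where "q = poly P x"
      define q' where "q' = poly (pderiv P) x"
      define w' where "w' = a + b - 2 * x"
      define E where "E = exp (- v)"
      have p: "poly (bump_deriv_poly a b P n) x = q' * w\<^sup>2 + q * w' - real n * (q * w' * w)"
        by (simp add: bump_deriv_poly_def w_def w'_def q_def q'_def power2_eq_square algebra_simps)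
      have B: "bump_term a b (bump_deriv_poly a b P n) (n + 2) x = (q' * w\<^sup>2 + q * w' - real n * (q * w' * w)) * v ^ (n + 2) * E"
        using 1 unfolding bump_term_def p w_def[symmetric] v_def[symmetric] E_def by simp
      have "(q' * w\<^sup>2 + q * w' - real n * (q * w' * w)) * v ^ (n + 2) =
          q' * ((v * w) * (v * w) * v ^ n) + q * w' * v ^ (n + 2) - real n * (q * w' * ((v * w) * v ^ (n + 1)))"
        by (simp add: power2_eq_square algebra_simps)
      also have "\<dots> = q' * v ^ n + q * w' * v ^ (n + 2) - q * w' * (real n * v ^ (n + 1))" by (simp add: v)
      also have "real n * v ^ (n + 1) = real n * (v ^ (n - Suc 0) * v\<^sup>2)"
        by (cases n) (simp_all add: power2_eq_square)
      finally have B': "bump_term a b (bump_deriv_poly a b P n) (n + 2) x =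
          (q' * v ^ n + q * w' * v ^ (n + 2) - q * w' * (real n * (v ^ (n - Suc 0) * v\<^sup>2))) * E" unfolding B by simp
      show "(poly (pderiv P) x * inverse ((x - a) * (b - x)) ^ n +
          real n * (- ((a + b - 2 * x) * v\<^sup>2) * inverse ((x - a) * (b - x)) ^ (n - Suc 0)) * poly P x) * exp (- inverse ((x - a) * (b - x))) +
          exp (- inverse ((x - a) * (b - x))) * - (- ((a + b - 2 * x) * v\<^sup>2)) * (poly P x * inverse ((x - a) * (b - x)) ^ n)
        = bump_term a b (bump_deriv_poly a b P n) (n + 2) x"
        unfolding B' w_def[symmetric] v_def[symmetric] q_def[symmetric] q'_def[symmetric] w'_def[symmetric] E_def[symmetric]
        by (simp add: power2_eq_square algebra_simps)
    qed
    then show ?thesis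
    proof (rule has_field_derivative_transform_within_open[of _ _ _ "{a<..<b}"])
      show "poly P y * inverse ((y - a) * (b - y)) ^ n * exp (- inverse ((y - a) * (b - y))) = bump_term a b P n y" if "y \<in> {a<..<b}" for y
        using that by (simp add: bump_term_def)
    qed (use 1 in auto)
  next
    case 2
    \<comment> \<open>At an end point the function is 0 and quadratically small on both sides, so
      its derivative there is 0, which is also the value of the next member of the family.\<close>
    obtain K where K: "\<And>x. \<bar>bump_term a b P n x\<bar> \<le> K * (x - a)\<^sup>2" "\<And>x. \<bar>bump_term a b P n x\<bar> \<le> K * (x - b)\<^sup>2"
      using bump_term_bound[OF ab] by metis
    have "(bump_term a b P n has_real_derivative 0) (at x)"
      using 2 K by (auto intro!: DERIV_zero_of_quadratic_bound[where K=K] simp: bump_term_def)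
    then show ?thesis using 2 by (auto simp: bump_term_def)
  next
    case 3
    have "((\<lambda>_. 0) has_real_derivative 0) (at x)" by simp
    then have "(bump_term a b P n has_real_derivative 0) (at x)"
    proof (rule has_field_derivative_transform_within_open[of _ _ _ "- {a..b}"])
      show "0 = bump_term a b P n y" if "y \<in> - {a..b}" for y using that by (auto simp: bump_term_def)
    qed (use 3 in \<open>auto simp: open_Compl\<close>)
    then show ?thesis using 3 by (auto simp: bump_term_def)
  qed
qed

lemma smooth_bump_term:
  assumes "a < b"
  shows "smooth (bump_term a b P n)"
proof -
  define Q where "Q = rec_nat P (\<lambda>k R. bump_deriv_poly a b R (n + 2 * k))"
  have "(bump_term a b (Q k) (n + 2 * k) has_real_derivative bump_term a b (Q (Suc k)) (n + 2 * Suc k) x) (at x)" for k x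
    using bump_term_deriv[OF assms, of "Q k" "n + 2 * k" x] by (simp add: Q_def add.assoc)
  then show ?thesis unfolding smooth_def
    by (intro exI[of _ "\<lambda>k. bump_term a b (Q k) (n + 2 * k)"]) (simp add: Q_def)
qed

text \<open>A bump \<open>\<eta>\<close> with a primitive \<open>B\<close>, which is a smooth step.
  The difference of two translates of \<open>B\<close> has compact support, and its derivative is
  the difference of two bumps. \<open>B\<close> is not normalised: only its jump, the mass of the
  bump, matters.\<close>

lemma exists_smooth_step:
  assumes "\<epsilon> > 0"
  obtains \<eta> B :: "real \<Rightarrow> real" where "smooth \<eta>" "\<And>x. (B has_real_derivative \<eta> x) (at x)" "\<And>x. 0 \<le> \<eta> x"
    "\<And>x. \<epsilon> \<le> \<bar>x\<bar> \<Longrightarrow> \<eta> x = 0" "\<And>x. x \<le> - \<epsilon> \<Longrightarrow> B x = B (- \<epsilon>)" "\<And>x. \<epsilon> \<le> x \<Longrightarrow> B x = B \<epsilon>" "B (- \<epsilon>) < B \<epsilon>"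
proof -
  define \<eta> where "\<eta> = bump_term (- \<epsilon>) \<epsilon> 1 0"
  have s: "smooth \<eta>" unfolding \<eta>_def using assms by (intro smooth_bump_term) simp
  obtain B where B: "\<And>x. (B has_real_derivative \<eta> x) (at x)"
    using einterval_antiderivative[of "-\<infinity>" "\<infinity>" \<eta>] smooth_isCont[OF s]
    by (auto simp: has_real_derivative_iff_has_vector_derivative)
  have 0: "\<eta> x = 0" if "\<epsilon> \<le> \<bar>x\<bar>" for x using that by (auto simp: \<eta>_def bump_term_def)
  have const: "B x = B y" if z0: "\<And>z. x \<le> z \<Longrightarrow> z \<le> y \<Longrightarrow> \<eta> z = 0" and lt: "x < y" for x y
  proof -
    obtain z where "x < z" "z < y" "B y - B x = (y - x) * \<eta> z"
      using MVT2[OF lt, of B \<eta>] B by blast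
    then show ?thesis using z0[of z] by simp
  qed
  show thesis
  proof (rule that[of \<eta> B])
    show "B x = B (- \<epsilon>)" if "x \<le> - \<epsilon>" for x
    proof (cases "x = - \<epsilon>")
      case False
      then show ?thesis using that assms by (intro const 0) auto
    qed simp
    show "B x = B \<epsilon>" if "\<epsilon> \<le> x" for x
    proof (cases "x = \<epsilon>")
      case False
      then show ?thesis using that assms const[of \<epsilon> x] 0 by auto
    qed simp
    show "B (- \<epsilon>) < B \<epsilon>"
    proof (rule DERIV_pos_imp_increasing_open[of "- \<epsilon>" \<epsilon> B])
      show "\<exists>y. (B has_real_derivative y) (at x) \<and> 0 < y" if "- \<epsilon> < x" "x < \<epsilon>" for x
        using B[of x] that by (intro exI[of _ "\<eta> x"]) (simp add: \<eta>_def bump_term_def)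
      show "continuous_on {- \<epsilon>..\<epsilon>} B" using B DERIV_isCont by (intro continuous_at_imp_continuous_on) blast
    qed (use assms in simp)
  qed (use s B 0 in \<open>auto simp: \<eta>_def bump_term_def\<close>)
qed

lemma test_function_deriv:
  assumes "test_function T \<psi>"
  shows "(\<psi> has_real_derivative deriv \<psi> x) (at x)" "isCont (deriv \<psi>) x" "t \<notin> {0<..<T} \<Longrightarrow> \<psi> t = 0"
proof -
  have d: "(deriv ^^ k) \<psi> differentiable at t" for k t using assms by (simp add: test_function_def)
  show "(\<psi> has_real_derivative deriv \<psi> x) (at x)"
    using d[of 0 x] by (simp add: DERIV_deriv_iff_real_differentiable)
  show "isCont (deriv \<psi>) x"
  proof -
    have "deriv \<psi> differentiable at x" using d[of 1 x] by simp
    then show ?thesis using DERIV_isCont unfolding real_differentiable_def by blast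
  qed
  have "{t. \<psi> t \<noteq> 0} \<subseteq> {0<..<T}" 
    using assms subset_trans[OF closure_subset[of "{t. \<psi> t \<noteq> 0}"]] unfolding test_function_def by blast
  then show "t \<notin> {0<..<T} \<Longrightarrow> \<psi> t = 0" by auto
qed

lemma DERIV_shift_minus:
  assumes "\<And>x. (f has_real_derivative f' x) (at x)"
  shows "((\<lambda>t. f (t - a)) has_real_derivative f' (t - a)) (at t)"
  by (rule DERIV_cong[OF DERIV_chain2[OF assms DERIV_diff[OF DERIV_ident DERIV_const]]]) simp

text \<open>Testing with the difference of two translated steps compares weighted means of
  \<open>H\<close> near \<open>r\<close> and near \<open>s\<close>, both with total weight
  \<open>m\<close>, and finds them equal. This is impossible once \<open>H\<close> stays, near each
  point, within a third of the supposed difference \<open>\<bar>H r - H s\<bar>\<close>.\<close>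

lemma du_Bois_Reymond_interior:
  fixes H :: "real \<Rightarrow> real"
  assumes T: "0 < T" and H: "continuous_on {0..T} H"
    and z: "\<And>\<psi>. test_function T \<psi> \<Longrightarrow> (LINT t|time_measure T. deriv \<psi> t * H t) = 0"
    and r: "r \<in> {0<..<T}" and s: "s \<in> {0<..<T}"
  shows "H r = H s"
proof (rule ccontr)
  assume neq: "H r \<noteq> H s"
  define \<delta> where "\<delta> = \<bar>H r - H s\<bar> / 3"
  have \<delta>: "\<delta> > 0" using neq by (simp add: \<delta>_def)
  have "\<exists>e>0. \<forall>t. \<bar>t - x\<bar> < e \<longrightarrow> 0 < t \<and> t < T \<and> \<bar>H t - H x\<bar> \<le> \<delta>" if x: "x \<in> {0<..<T}" for x
  proof -
    obtain d where d: "d > 0" "\<And>t. t \<in> {0..T} \<Longrightarrow> dist t x < d \<Longrightarrow> dist (H t) (H x) < \<delta>"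
      using H \<delta> x unfolding continuous_on_iff by (metis atLeastAtMost_iff greaterThanLessThan_iff less_imp_le)
    have "0 < t \<and> t < T \<and> \<bar>H t - H x\<bar> \<le> \<delta>" if "\<bar>t - x\<bar> < min d (min x (T - x))" for t
    proof -
      have "0 < t" "t < T" "\<bar>t - x\<bar> < d" using that x by auto
      then show ?thesis using d(2)[of t] by (simp add: dist_real_def)
    qed
    moreover have "0 < min d (min x (T - x))" using d(1) x by simp
    ultimately show ?thesis by blast
  qed
  then obtain e1 e2 where e: "e1 > 0" "e2 > 0"
    "\<And>t. \<bar>t - r\<bar> < e1 \<Longrightarrow> 0 < t \<and> t < T \<and> \<bar>H t - H r\<bar> \<le> \<delta>"
    "\<And>t. \<bar>t - s\<bar> < e2 \<Longrightarrow> 0 < t \<and> t < T \<and> \<bar>H t - H s\<bar> \<le> \<delta>" using r s by meson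
  \<comment> \<open>Strictly smaller than both radii, so that the closed intervals of radius
    \<open>\<epsilon>\<close> around \<open>r\<close> and \<open>s\<close> lie inside
    \<open>(0, T)\<close> and the support condition of a test function holds.\<close>
  define \<epsilon> where "\<epsilon> = min e1 e2 / 2"
  have \<epsilon>: "\<epsilon> > 0" "\<epsilon> < e1" "\<epsilon> < e2" using e by (auto simp: \<epsilon>_def)
  obtain \<eta> B where \<eta>: "smooth \<eta>" and B: "\<And>x. (B has_real_derivative \<eta> x) (at x)" and nn: "\<And>x. 0 \<le> \<eta> x"
    and out: "\<And>x. \<epsilon> \<le> \<bar>x\<bar> \<Longrightarrow> \<eta> x = 0" and Bl: "\<And>x. x \<le> - \<epsilon> \<Longrightarrow> B x = B (- \<epsilon>)" and Br: "\<And>x. \<epsilon> \<le> x \<Longrightarrow> B x = B \<epsilon>"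
    and Bm: "B (- \<epsilon>) < B \<epsilon>"
    using exists_smooth_step[OF \<epsilon>(1)] by metis
  define m where "m = B \<epsilon> - B (- \<epsilon>)"
  have m: "m > 0" using Bm by (simp add: m_def)
  have sm: "smooth (\<lambda>t. \<eta> (t - x))" for x
  proof -
    obtain F where F: "F 0 = \<eta>" "\<And>k x. (F k has_real_derivative F (Suc k) x) (at x)"
      using \<eta> unfolding smooth_def by blast
    show ?thesis unfolding smooth_def
      by (rule exI[of _ "\<lambda>k t. F k (t - x)"]) (simp add: F(1) DERIV_shift_minus[OF F(2)])
  qed
  define \<psi> where "\<psi> t = B (t - r) - B (t - s)" for t
  have d: "(\<psi> has_real_derivative \<eta> (t - r) - \<eta> (t - s)) (at t)" for t
    unfolding \<psi>_def by (intro DERIV_diff DERIV_shift_minus B)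
  have "smooth \<psi>"
  proof (rule smooth_antiderivative)
    show "smooth (\<lambda>t. \<eta> (t - r) - \<eta> (t - s))"
      using smooth_linear_combination[OF sm[of r] sm[of s], of 1 "-1"] by simp
  qed (rule d)
  moreover have "closure {t. \<psi> t \<noteq> 0} \<subseteq> {0<..<T}"
  proof -
    have "closure {t. \<psi> t \<noteq> 0} \<subseteq> {min r s - \<epsilon>..max r s + \<epsilon>}"
    proof (rule closure_minimal)
      show "{t. \<psi> t \<noteq> 0} \<subseteq> {min r s - \<epsilon>..max r s + \<epsilon>}"
      proof (rule subsetI, rule ccontr)
        fix t assume t: "t \<in> {t. \<psi> t \<noteq> 0}" "t \<notin> {min r s - \<epsilon>..max r s + \<epsilon>}"
        then have "t - r \<le> - \<epsilon> \<and> t - s \<le> - \<epsilon> \<or> \<epsilon> \<le> t - r \<and> \<epsilon> \<le> t - s" by (auto simp: min_def max_def split: if_splits)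
        then have "\<psi> t = 0" unfolding \<psi>_def using Bl[of "t - r"] Bl[of "t - s"] Br[of "t - r"] Br[of "t - s"] by auto
        then show False using t by simp
      qed
    qed simp
    moreover have "0 < min r s - \<epsilon>" "max r s + \<epsilon> < T"
      using e(3)[of "r - \<epsilon>"] e(4)[of "s - \<epsilon>"] e(3)[of "r + \<epsilon>"] e(4)[of "s + \<epsilon>"] \<epsilon> by (auto simp: min_def max_def)
    ultimately show ?thesis by (auto simp: subset_eq)
  qed
  ultimately have test: "test_function T \<psi>" using smooth_iterated_deriv by (simp add: test_function_def)
  have Hm: "H \<in> borel_measurable (time_measure T)"
    by (intro continuous_imp_measurable_on_sets_lebesgue continuous_on_subset[OF H]) auto
  have "compact (H ` {0..T})" using H by (intro compact_continuous_image) auto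
  then obtain C where C: "\<And>t. t \<in> {0..T} \<Longrightarrow> \<bar>H t\<bar> \<le> C"
    by (metis compact_imp_bounded bounded_iff image_eqI real_norm_def)
  interpret I: finite_measure "time_measure T" by (rule finite_time)
  have iH: "integrable (time_measure T) H"
    using C Hm by (intro I.integrable_const_bound[of _ C]) (auto intro!: AE_I2)
  have c: "continuous_on UNIV (\<lambda>t. \<eta> (t - x))" for x
    using smooth_isCont[OF sm] by (simp add: continuous_on_eq_continuous_at)
  have i1: "integrable (time_measure T) (\<lambda>t. \<eta> (t - x) * H t)" for x
    by (rule integrable_time_continuous_mult[OF iH c])
  have i2: "integrable (time_measure T) (\<lambda>t. \<eta> (t - x))" for x
    using integrable_time_continuous_mult[OF I.integrable_const[of 1] c[of x]] by simp
  have mass: "(LINT t|time_measure T. \<eta> (t - x)) = m" if "\<epsilon> \<le> x" "x + \<epsilon> \<le> T" for x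
  proof -
    have "(LINT t|time_measure T. \<eta> (t - x)) = (LINT t|time_measure T. \<eta> (t - x) * indicator {0<..} t)"
      by (rule Bochner_Integration.integral_cong) auto
    also have "\<dots> = B (T - x) - B (0 - x)"
      using that \<epsilon>(1) smooth_isCont[OF sm] DERIV_shift_minus[OF B] T
      by (intro integral_time_FTC[of 0 T "\<lambda>t. B (t - x)"]) auto
    finally show ?thesis using Bl[of "0 - x"] Br[of "T - x"] that by (simp add: m_def)
  qed
  have est: "\<bar>(LINT t|time_measure T. \<eta> (t - x) * H t) - m * H x\<bar> \<le> m * \<delta>"
    if x: "\<epsilon> \<le> x" "x + \<epsilon> \<le> T" and osc: "\<And>t. \<bar>t - x\<bar> < \<epsilon> \<Longrightarrow> \<bar>H t - H x\<bar> \<le> \<delta>" for x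
  proof -
    have "(LINT t|time_measure T. \<eta> (t - x) * H t) - m * H x = (LINT t|time_measure T. \<eta> (t - x) * H t - \<eta> (t - x) * H x)"
      using i1[of x] i2[of x] mass[OF x] by (subst Bochner_Integration.integral_diff) auto
    also have "\<bar>\<dots>\<bar> \<le> (LINT t|time_measure T. \<bar>\<eta> (t - x) * H t - \<eta> (t - x) * H x\<bar>)" by (rule integral_abs_bound)
    also have "\<dots> \<le> (LINT t|time_measure T. \<eta> (t - x) * \<delta>)"
    proof (rule integral_mono)
      show "integrable (time_measure T) (\<lambda>t. \<bar>\<eta> (t - x) * H t - \<eta> (t - x) * H x\<bar>)" using i1 i2 by simp
      show "integrable (time_measure T) (\<lambda>t. \<eta> (t - x) * \<delta>)" using i2 by simp
      fix t
      show "\<bar>\<eta> (t - x) * H t - \<eta> (t - x) * H x\<bar> \<le> \<eta> (t - x) * \<delta>"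
      proof (cases "\<bar>t - x\<bar> < \<epsilon>")
        case True
        have "\<bar>\<eta> (t - x) * H t - \<eta> (t - x) * H x\<bar> = \<eta> (t - x) * \<bar>H t - H x\<bar>"
          using nn[of "t - x"] by (simp add: right_diff_distrib[symmetric] abs_mult)
        then show ?thesis using osc[OF True] nn[of "t - x"] by (simp add: mult_left_mono)
      next
        case False
        then show ?thesis using out[of "t - x"] by simp
      qed
    qed
    also have "\<dots> = m * \<delta>" using mass[OF x] by simp
    finally show ?thesis .
  qed
  have bounds: "\<epsilon> \<le> r" "r + \<epsilon> \<le> T" "\<epsilon> \<le> s" "s + \<epsilon> \<le> T"
    using e(3)[of "r - \<epsilon>"] e(4)[of "s - \<epsilon>"] e(3)[of "r + \<epsilon>"] e(4)[of "s + \<epsilon>"] \<epsilon> by auto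
  have "0 = (LINT t|time_measure T. \<eta> (t - r) * H t - \<eta> (t - s) * H t)"
    using z[OF test] DERIV_imp_deriv[OF d] by (simp add: left_diff_distrib)
  also have "\<dots> = (LINT t|time_measure T. \<eta> (t - r) * H t) - (LINT t|time_measure T. \<eta> (t - s) * H t)"
    using i1 by simp
  finally have "\<bar>m * H r - m * H s\<bar> \<le> 2 * (m * \<delta>)"
    using est[OF bounds(1,2)] est[OF bounds(3,4)] e(3,4) \<epsilon> by fastforce
  then have "m * \<bar>H r - H s\<bar> \<le> m * (2 * \<delta>)" using m by (simp add: right_diff_distrib[symmetric] abs_mult mult.left_commute)
  then have "\<bar>H r - H s\<bar> \<le> 2 * \<delta>" using m by simp
  then show False using \<delta> by (simp add: \<delta>_def)
qed

lemma du_Bois_Reymond: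
  fixes H :: "real \<Rightarrow> real"
  assumes T: "0 < T" and H: "continuous_on {0..T} H"
    and z: "\<And>\<psi>. test_function T \<psi> \<Longrightarrow> (LINT t|time_measure T. deriv \<psi> t * H t) = 0"
    and r: "r \<in> {0..T}"
  shows "H r = H 0"
proof -
  have *: "H x = H (T / 2)" if "x \<in> closure {0<..<T}" for x
  proof (rule continuous_constant_on_closure[of "{0<..<T}" H])
    show "continuous_on (closure {0<..<T}) H" using H T by simp
    show "H y = H (T / 2)" if "y \<in> {0<..<T}" for y
      using that T by (intro du_Bois_Reymond_interior[OF T H z]) auto
  qed (rule that)
  have "closure {0<..<T} = {0..T}" using T by simp
  then have "H r = H (T / 2)" "H 0 = H (T / 2)" using *[of r] *[of 0] T r by auto
  then show ?thesis by (rule trans[OF _ sym])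
qed

section \<open>An abstract parabolic equation\<close>

text \<open>Completeness is asked of the sum \<open>ip\<close> alone; \<open>b\<close> and
  \<open>a\<close> may each be degenerate. In the application \<open>b\<close> is the inner product
  of L2(\<Omega>), \<open>a\<close> the energy form and \<open>c\<close> the constant
  \<open>1 / (2 * \<bar>Gamma (- \<beta>)\<bar>)\<close>.\<close>

locale parabolic =
  b: semi_inner V b + a: semi_inner V a + H: semi_hilbert V ip
  for V :: "('x \<Rightarrow> real) set" and b a ip +
  fixes N :: "('x \<Rightarrow> real) \<Rightarrow> real" and c T :: real
  assumes ip_eq: "\<lbrakk>u \<in> V; v \<in> V\<rbrakk> \<Longrightarrow> ip u v = b u v + a u v"
    and N_eq: "N = (\<lambda>u. sqrt (ip u u))"
    and c: "c > 0" and T: "T > 0"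
begin

abbreviation "I \<equiv> time_measure T"
abbreviation "V' \<equiv> dual_space V N"
abbreviation "N' \<equiv> dual_norm V N"

sublocale F: fun_seminormed V N
  unfolding N_eq fun_seminormed_def by (rule H.seminormed_axioms)

sublocale I: complete_measure I by (rule complete_time)
sublocale I: finite_measure I by (rule finite_time)

lemma N_sq: "u \<in> V \<Longrightarrow> (N u)\<^sup>2 = ip u u"
  by (simp add: N_eq H.ip_nonneg)

text \<open>A common roof for \<open>b\<close>, \<open>a\<close> and \<open>ip\<close>:
  Cauchy-Schwarz bounds each by \<open>N u * N v\<close>, so each induces a nonexpansive map into
  the dual, and integrability along functions of time is proved once for all three.\<close>

definition bounded_form :: "(('x \<Rightarrow> real) \<Rightarrow> ('x \<Rightarrow> real) \<Rightarrow> real) \<Rightarrow> bool" where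
  "bounded_form \<beta> \<longleftrightarrow> semi_inner V \<beta> \<and> (\<forall>u\<in>V. \<beta> u u \<le> (N u)\<^sup>2)"

lemma bounded_forms: "bounded_form b" "bounded_form a" "bounded_form ip"
  unfolding bounded_form_def
  using b.semi_inner_axioms a.semi_inner_axioms H.semi_inner_axioms b.ip_nonneg a.ip_nonneg
  by (auto simp: N_sq ip_eq)

lemma bounded_form_le:
  assumes "bounded_form \<beta>" "u \<in> V" "v \<in> V"
  shows "\<bar>\<beta> u v\<bar> \<le> N u * N v"
proof -
  interpret \<beta>: semi_inner V \<beta> using assms(1) by (simp add: bounded_form_def)
  have "sqrt (\<beta> w w) \<le> N w" if "w \<in> V" for w
    using assms(1) that F.nonneg[OF that] by (intro real_le_lsqrt \<beta>.ip_nonneg) (auto simp: bounded_form_def)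
  then have "sqrt (\<beta> u u) * sqrt (\<beta> v v) \<le> N u * N v"
    using assms F.nonneg \<beta>.ip_nonneg by (intro mult_mono) auto
  then show ?thesis using \<beta>.Cauchy_Schwarz[OF assms(2,3)] by simp
qed

lemma bounded_form_dual:
  assumes "bounded_form \<beta>" "u \<in> V"
  shows "\<beta> u \<in> V'" "N' (\<beta> u) \<le> N u"
proof -
  interpret \<beta>: semi_inner V \<beta> using assms(1) by (simp add: bounded_form_def)
  show "\<beta> u \<in> V'" using bounded_form_le[OF assms] by (intro F.dualI[of _ "N u"]) (simp_all add: \<beta>.bilinear assms)
  show "N' (\<beta> u) \<le> N u" using bounded_form_le[OF assms] F.nonneg[OF assms(2)] by (rule F.dual_norm_le)
qed

lemma bounded_form_dual_diff:
  assumes "bounded_form \<beta>" "u \<in> V" "w \<in> V"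
  shows "N' (\<beta> u - \<beta> w) \<le> 1 * N (u - w)"
proof -
  interpret \<beta>: semi_inner V \<beta> using assms(1) by (simp add: bounded_form_def)
  have "N' (\<beta> u - \<beta> w) \<le> N (u - w)"
  proof (rule F.dual_norm_le)
    fix v assume v: "v \<in> V"
    have "(\<beta> u - \<beta> w) v = \<beta> (u - w) v" using v assms by (simp add: \<beta>.bilinear)
    then show "\<bar>(\<beta> u - \<beta> w) v\<bar> \<le> N (u - w) * N v" using bounded_form_le[OF assms(1) F.mem(3)[OF assms(2,3)] v] by simp
  qed (rule F.nonneg[OF F.mem(3)[OF assms(2,3)]])
  then show ?thesis by simp
qed

lemma bounded_form_L2t:
  assumes \<beta>: "bounded_form \<beta>" and u: "u \<in> L2t I V N"
  shows "(\<lambda>t. \<beta> (u t)) \<in> L2t I V' N'"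
proof -
  have le: "N' (\<beta> v) \<le> 1 * N v" if "v \<in> V" for v using bounded_form_dual(2)[OF \<beta> that] by simp
  show ?thesis
    by (rule I.L2t_image[OF F.seminormed_axioms u bounded_form_dual(1)[OF \<beta>] bounded_form_dual_diff[OF \<beta>] le F.seminormed_dual])
qed

definition nm :: "(real \<Rightarrow> 'x \<Rightarrow> real) \<Rightarrow> real" where
  "nm u = sqrt (LINT t|I. (N (u t))\<^sup>2)"

lemma nm_nonneg: "0 \<le> nm u"
  by (simp add: nm_def integral_nonneg_AE)

lemma bounded_form_integral:
  assumes \<beta>: "bounded_form \<beta>" and u: "u \<in> L2t I V N" and w: "w \<in> L2t I V N"
  shows "integrable I (\<lambda>t. \<beta> (u t) (w t))" "\<bar>LINT t|I. \<beta> (u t) (w t)\<bar> \<le> nm u * nm w"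
proof -
  note L = bounded_form_L2t[OF \<beta> u]
  show "integrable I (\<lambda>t. \<beta> (u t) (w t))"
    by (rule F.pairing_bound(1)[OF complete_time L w])
  have "(LINT t|I. (N' (\<beta> (u t)))\<^sup>2) \<le> (LINT t|I. (N (u t))\<^sup>2)"
  proof (rule integral_mono_AE)
    show "AE t in I. (N' (\<beta> (u t)))\<^sup>2 \<le> (N (u t))\<^sup>2"
      using L2t_AE[OF u]
    proof eventually_elim
      fix t assume "u t \<in> V"
      then show "(N' (\<beta> (u t)))\<^sup>2 \<le> (N (u t))\<^sup>2"
        using bounded_form_dual[OF \<beta>] F.dual_norm_nonneg by (intro power_mono) auto
    qed
  qed (use u L in \<open>auto simp: L2t_def\<close>)
  then have "sqrt (LINT t|I. (N' (\<beta> (u t)))\<^sup>2) * nm w \<le> nm u * nm w"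
    by (intro mult_right_mono nm_nonneg) (simp add: nm_def)
  then show "\<bar>LINT t|I. \<beta> (u t) (w t)\<bar> \<le> nm u * nm w"
    using F.pairing_bound(2)[OF complete_time L w] by (simp add: nm_def)
qed

text \<open>Stronger than membership in L2(0, T; V): the values lie in \<open>V\<close> at every
  time, so evaluation at 0 and \<open>T\<close> is harmless, and simple functions approximate
  uniformly in time. The condition passes through sums and Lipschitz maps and therefore holds for
  all test functions and for their images under \<open>K\<close>.\<close>

definition unif_approx :: "(real \<Rightarrow> 'x \<Rightarrow> real) \<Rightarrow> bool" where
  "unif_approx u \<longleftrightarrow> (\<forall>t. u t \<in> V) \<and>
     (\<forall>e>0. \<exists>s. simple_function I s \<and> (\<forall>t\<in>space I. s t \<in> V \<and> N (s t - u t) \<le> e))"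

lemma unif_approxE:
  assumes "unif_approx u" "e > 0"
  obtains s where "simple_function I s" "\<And>t. t \<in> space I \<Longrightarrow> s t \<in> V" "\<And>t. t \<in> space I \<Longrightarrow> N (s t - u t) \<le> e"
  using assms unfolding unif_approx_def by blast

lemma unif_approx_sequence:
  assumes "unif_approx u"
  obtains s where "\<And>k. simple_function I (s k)" "\<And>k t. t \<in> space I \<Longrightarrow> s k t \<in> V"
    "\<And>k t. t \<in> space I \<Longrightarrow> N (s k t - u t) \<le> (1/2) ^ k"
proof -
  have "\<exists>s. simple_function I s \<and> (\<forall>t\<in>space I. s t \<in> V \<and> N (s t - u t) \<le> (1/2) ^ k)" for k :: nat
    using assms unfolding unif_approx_def by simp
  then have "\<exists>s. \<forall>k. simple_function I (s k) \<and> (\<forall>t\<in>space I. s k t \<in> V \<and> N (s k t - u t) \<le> (1/2) ^ k)"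
    by (rule choice[OF allI])
  then show thesis using that by blast
qed

lemma unif_approx_L2t:
  assumes u: "unif_approx u"
  shows "u \<in> L2t I V N"
proof -
  have uV: "u t \<in> V" for t using u by (simp add: unif_approx_def)
  obtain s where s: "\<And>k. simple_function I (s k)" "\<And>k t. t \<in> space I \<Longrightarrow> s k t \<in> V"
    "\<And>k t. t \<in> space I \<Longrightarrow> N (s k t - u t) \<le> (1/2) ^ k" by (rule unif_approx_sequence[OF u]) blast
  have "approx I V N s u"
    unfolding approx_def
  proof (intro conjI allI ballI AE_I2)
    fix t assume t: "t \<in> space I"
    have "(\<lambda>k. (1/2::real) ^ k) \<longlonglongrightarrow> 0" by (intro LIMSEQ_power_zero) simp
    then show "(\<lambda>k. N (s k t - u t)) \<longlonglongrightarrow> 0"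
    proof (rule squeeze_zero)
      show "\<bar>N (s k t - u t)\<bar> \<le> (1/2) ^ k" for k
        using s(3)[OF t, of k] F.nonneg[OF F.mem(3)[OF s(2)[OF t] uV]] by simp
    qed
  qed (use s uV in auto)
  then have sm: "strongly_measurable I V N u" using strongly_measurable_iff by blast
  have "finite (N ` s 0 ` space I)" using s(1)[of 0] by (simp add: simple_function_def)
  then obtain C where C: "\<And>t. t \<in> space I \<Longrightarrow> N (s 0 t) \<le> C"
    by (metis bdd_above.unfold bdd_above_finite image_eqI)
  have bound: "N (u t) \<le> C + 1" if t: "t \<in> space I" for t
    using F.reverse_triangle[OF s(2)[OF t] uV, of 0 t] s(3)[OF t, of 0] C[OF t] by simp
  have "integrable I (\<lambda>t. (N (u t))\<^sup>2)"
  proof (rule I.integrable_const_bound[of _ "(C + 1)\<^sup>2"])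
    show "AE t in I. norm ((N (u t))\<^sup>2) \<le> (C + 1)\<^sup>2"
    proof (rule AE_I2)
      fix t assume "t \<in> space I"
      then show "norm ((N (u t))\<^sup>2) \<le> (C + 1)\<^sup>2" using bound F.nonneg[OF uV] by (simp add: power_mono)
    qed
    show "(\<lambda>t. (N (u t))\<^sup>2) \<in> borel_measurable I" using I.norm_measurable[OF F.seminormed_axioms sm] by simp
  qed
  then show ?thesis using sm by (simp add: L2t_def)
qed

lemma unif_approx_image:
  assumes u: "unif_approx u" and P: "\<And>v. v \<in> V \<Longrightarrow> P v \<in> V"
    and C: "\<And>v w. v \<in> V \<Longrightarrow> w \<in> V \<Longrightarrow> N (P v - P w) \<le> C * N (v - w)"
  shows "unif_approx (\<lambda>t. P (u t))"
  unfolding unif_approx_def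
proof (intro conjI allI impI)
  have uV: "u t \<in> V" for t using u by (simp add: unif_approx_def)
  then show "P (u t) \<in> V" for t by (rule P)
  fix e :: real assume e: "e > 0"
  define d where "d = e / (\<bar>C\<bar> + 1)"
  have d: "d > 0" using e by (simp add: d_def)
  obtain s where s: "simple_function I s" "\<And>t. t \<in> space I \<Longrightarrow> s t \<in> V" "\<And>t. t \<in> space I \<Longrightarrow> N (s t - u t) \<le> d"
    using unif_approxE[OF u d] by metis
  have "N (P (s t) - P (u t)) \<le> e" if t: "t \<in> space I" for t
  proof -
    have n: "0 \<le> N (s t - u t)" by (rule F.nonneg[OF F.mem(3)[OF s(2)[OF t] uV]])
    have "N (P (s t) - P (u t)) \<le> C * N (s t - u t)" by (rule C[OF s(2)[OF t] uV])
    also have "\<dots> \<le> (\<bar>C\<bar> + 1) * N (s t - u t)" using n by (intro mult_right_mono) auto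
    also have "\<dots> \<le> (\<bar>C\<bar> + 1) * d" using s(3)[OF t] by (intro mult_left_mono) auto
    also have "\<dots> = e" by (simp add: d_def add_nonneg_eq_0_iff)
    finally show ?thesis .
  qed
  then show "\<exists>r. simple_function I r \<and> (\<forall>t\<in>space I. r t \<in> V \<and> N (r t - P (u t)) \<le> e)"
    using simple_function_compose1[OF s(1), of P] s(2) P by (intro exI[of _ "\<lambda>t. P (s t)"]) auto
qed

lemma unif_approx_scale: "unif_approx u \<Longrightarrow> unif_approx (\<lambda>t. d *\<^sub>R u t)"
  by (rule unif_approx_image[where P="(*\<^sub>R) d" and C="\<bar>d\<bar>"]) (simp_all add: scaleR_diff_right[symmetric] F.scale)

lemma unif_approx_add:
  assumes u: "unif_approx u" and w: "unif_approx w"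
  shows "unif_approx (\<lambda>t. u t + w t)"
  unfolding unif_approx_def
proof (intro conjI allI impI)
  have uV: "u t \<in> V" "w t \<in> V" for t using u w by (auto simp: unif_approx_def)
  then show "u t + w t \<in> V" for t by simp
  fix e :: real assume e: "e > 0"
  obtain s where s: "simple_function I s" "\<And>t. t \<in> space I \<Longrightarrow> s t \<in> V" "\<And>t. t \<in> space I \<Longrightarrow> N (s t - u t) \<le> e / 2"
    using unif_approxE[OF u, of "e / 2"] e by (metis half_gt_zero)
  obtain r where r: "simple_function I r" "\<And>t. t \<in> space I \<Longrightarrow> r t \<in> V" "\<And>t. t \<in> space I \<Longrightarrow> N (r t - w t) \<le> e / 2"
    using unif_approxE[OF w, of "e / 2"] e by (metis half_gt_zero)
  have "N ((s t + r t) - (u t + w t)) \<le> e" if t: "t \<in> space I" for t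
  proof -
    have "(s t + r t) - (u t + w t) = (s t - u t) + (r t - w t)" by (rule add_diff_add)
    then have "N ((s t + r t) - (u t + w t)) \<le> N (s t - u t) + N (r t - w t)"
      using F.triangle[OF F.mem(3)[OF s(2)[OF t] uV(1)[of t]] F.mem(3)[OF r(2)[OF t] uV(2)[of t]]] by (simp only:)
    then show ?thesis using s(3)[OF t] r(3)[OF t] by simp
  qed
  then show "\<exists>q. simple_function I q \<and> (\<forall>t\<in>space I. q t \<in> V \<and> N (q t - (u t + w t)) \<le> e)"
    using simple_function_compose2[OF s(1) r(1), of "(+)"] s(2) r(2) by (intro exI[of _ "\<lambda>t. s t + r t"]) auto
qed

lemma unif_approx_scaled_vector:
  assumes f: "continuous_on UNIV f" and v: "v \<in> V"
  shows "unif_approx (\<lambda>t. f t *\<^sub>R v)"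
  unfolding unif_approx_def
proof (intro conjI allI impI)
  show "f t *\<^sub>R v \<in> V" for t by (rule F.mem(4)[OF v])
  fix e :: real assume e: "e > 0"
  define d where "d = e / (N v + 1)"
  have Nv: "0 \<le> N v" by (rule F.nonneg[OF v])
  have d: "d > 0" using e Nv by (simp add: d_def)
  \<comment> \<open>The coefficient is rounded down to the grid of mesh \<open>d\<close>;
    boundedness of \<open>f\<close> on \<open>[0, T]\<close> leaves finitely many values. The 1 in
    the denominator of \<open>d\<close> covers vectors of seminorm zero.\<close>
  define s where "s t = (d * real_of_int \<lfloor>f t / d\<rfloor>) *\<^sub>R v" for t
  have "compact (f ` {0..T})" using f by (intro compact_continuous_image continuous_on_subset[OF f]) auto
  then obtain C where C: "\<And>t. t \<in> {0..T} \<Longrightarrow> \<bar>f t\<bar> \<le> C"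
    by (metis compact_imp_bounded bounded_iff image_eqI real_norm_def)
  have "simple_function I (\<lambda>t. real_of_int \<lfloor>f t / d\<rfloor>)"
  proof (rule simple_function_borel_measurable)
    have "f \<in> borel_measurable I" using f by (intro borel_measurable_time borel_measurable_continuous_onI)
    then have "(\<lambda>t. f t / d) \<in> borel_measurable I" by simp
    then show "(\<lambda>t. real_of_int \<lfloor>f t / d\<rfloor>) \<in> borel_measurable I"
      by (rule measurable_compose[OF _ borel_measurable_real_floor])
    have "(\<lambda>t. real_of_int \<lfloor>f t / d\<rfloor>) ` space I \<subseteq> real_of_int ` {\<lfloor>- C / d\<rfloor>..\<lfloor>C / d\<rfloor>}"
    proof
      fix y assume "y \<in> (\<lambda>t. real_of_int \<lfloor>f t / d\<rfloor>) ` space I"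
      then obtain t where t: "0 < t" "t < T" and y: "y = real_of_int \<lfloor>f t / d\<rfloor>" by auto
      have "- C / d \<le> f t / d" "f t / d \<le> C / d"
        using divide_right_mono[of "- C" "f t" d] divide_right_mono[of "f t" C d] C[of t] t d by (auto simp: abs_le_iff)
      then show "y \<in> real_of_int ` {\<lfloor>- C / d\<rfloor>..\<lfloor>C / d\<rfloor>}" unfolding y by (auto intro!: imageI floor_mono)
    qed
    then show "finite ((\<lambda>t. real_of_int \<lfloor>f t / d\<rfloor>) ` space I)" by (rule finite_subset) simp
  qed
  then have "simple_function I s" unfolding s_def by (rule simple_function_compose1)
  moreover have "s t \<in> V" for t unfolding s_def by (rule F.mem(4)[OF v])
  moreover have "N (s t - f t *\<^sub>R v) \<le> e" for t
  proof -
    define r where "r = d * real_of_int \<lfloor>f t / d\<rfloor>"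
    have "s t - f t *\<^sub>R v = (r - f t) *\<^sub>R v" unfolding s_def r_def by (rule scaleR_diff_left[symmetric])
    then have "N (s t - f t *\<^sub>R v) = N ((r - f t) *\<^sub>R v)" by (rule arg_cong)
    then have 1: "N (s t - f t *\<^sub>R v) = \<bar>r - f t\<bar> * N v" unfolding F.scale[OF v] .
    have "\<bar>real_of_int \<lfloor>f t / d\<rfloor> - f t / d\<bar> \<le> 1" by linarith
    moreover have "r - f t = d * (real_of_int \<lfloor>f t / d\<rfloor> - f t / d)" using d by (simp add: r_def right_diff_distrib)
    ultimately have "\<bar>r - f t\<bar> \<le> d * 1"
      using d by (simp only: abs_mult abs_of_pos mult_left_mono less_imp_le)
    then have "\<bar>r - f t\<bar> * N v \<le> d * N v" using Nv by (simp add: mult_right_mono)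
    moreover have "d * N v \<le> e" using e Nv by (simp add: d_def field_simps)
    ultimately have "N (s t - f t *\<^sub>R v) \<le> e" unfolding 1 by (rule order_trans)
    then have ?thesis .
    then show ?thesis .
  qed
  ultimately show "\<exists>q. simple_function I q \<and> (\<forall>t\<in>space I. q t \<in> V \<and> N (q t - f t *\<^sub>R v) \<le> e)" by blast
qed

text \<open>The scalar partial sums \<open>g k t\<close> of the norms of increments converge in
  L2(0, T) and almost everywhere, so at almost every \<open>t\<close> the sequence
  \<open>u k t\<close> has summable increments and converges in \<open>V\<close>. The pointwise
  bound \<open>l t - g k t\<close> on the remaining distance carries the scalar convergence over to
  \<open>nm\<close>.\<close>

lemma L2t_limit:
  assumes u: "\<And>k. unif_approx (u k)" and s: "summable (\<lambda>k. nm (\<lambda>t. u (Suc k) t - u k t))"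
  obtains p where "p \<in> L2t I V N" "(\<lambda>k. nm (\<lambda>t. u k t - p t)) \<longlonglongrightarrow> 0"
proof -
  have uV: "u k t \<in> V" for k t using u by (simp add: unif_approx_def)
  have uL: "u k \<in> L2t I V N" for k using u by (rule unif_approx_L2t)
  define d where "d i t = N (u (Suc i) t - u i t)" for i t
  have dS: "d i \<in> sqint I" for i
    unfolding d_def by (rule I.L2t_sqint[OF F.seminormed_axioms I.L2t_diff[OF F.seminormed_axioms uL uL]])
  have d0: "0 \<le> d i t" for i t unfolding d_def by (rule F.nonneg[OF F.mem(3)[OF uV uV]])
  define g where "g k t = (\<Sum>i<k. d i t)" for k t
  have gdiff: "g (Suc k) t - g k t = d k t" for k t by (simp add: g_def)
  have gS: "g k \<in> sqint I" for k
  proof (induction k)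
    interpret S: semi_inner "sqint I" "\<lambda>f g. LINT x|I. f x * g x" by (rule semi_inner_sqint)
    case 0
    have "g 0 = 0" by (simp add: g_def fun_eq_iff)
    then show ?case using S.mem(1) by (simp only:)
  next
    interpret S: semi_inner "sqint I" "\<lambda>f g. LINT x|I. f x * g x" by (rule semi_inner_sqint)
    case (Suc k)
    have "g (Suc k) = g k + d k" by (simp add: g_def fun_eq_iff)
    then show ?case using S.mem(2)[OF Suc dS] by (simp only:)
  qed
  have gs: "summable (\<lambda>k. sqrt (LINT t|I. (g (Suc k) t - g k t)\<^sup>2))"
    using s unfolding gdiff d_def nm_def .
  note comp = sqint_complete[OF gS gs]
  define l where "l t = lim (\<lambda>k. g k t)" for t
  have lm: "l \<in> borel_measurable I"
    unfolding l_def using gS by (intro borel_measurable_lim_metric) (simp add: sqint_def)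
  have lim: "AE t in I. (\<lambda>k. g k t) \<longlonglongrightarrow> l t"
    using comp(1) by eventually_elim (simp add: l_def convergent_LIMSEQ_iff)
  have l: "l \<in> sqint I" "(\<lambda>k. sqrt (LINT t|I. (g k t - l t)\<^sup>2)) \<longlonglongrightarrow> 0"
    using comp(2)[OF lm lim] by auto
  have tri: "N (u j t - u k t) \<le> g j t - g k t" if "k \<le> j" for j k t
    using F.telescope_bound[of "\<lambda>k. u k t", OF uV that] unfolding g_def d_def .
  \<comment> \<open>Limits are unique only modulo seminorm zero, so one is chosen at each
    \<open>t\<close>; strong measurability of \<open>p\<close> therefore needs its own
    argument.\<close>
  define p where "p t = (SOME q. q \<in> V \<and> (\<lambda>k. N (u k t - q)) \<longlonglongrightarrow> 0)" for t
  have p: "p t \<in> V \<and> (\<lambda>k. N (u k t - p t)) \<longlonglongrightarrow> 0" if "(\<lambda>k. g k t) \<longlonglongrightarrow> l t" for t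
  proof -
    have "(\<lambda>i. d i t) sums l t" using that by (simp add: sums_def g_def)
    then have "summable (\<lambda>i. d i t)" by (rule sums_summable)
    then have sm: "summable (\<lambda>k. sqrt (ip (u (Suc k) t - u k t) (u (Suc k) t - u k t)))" unfolding d_def N_eq .
    have "\<exists>q\<in>V. (\<lambda>k. N (u k t - q)) \<longlonglongrightarrow> 0"
      using H.complete[of "\<lambda>k. u k t", OF uV sm] unfolding N_eq .
    then have "\<exists>q. q \<in> V \<and> (\<lambda>k. N (u k t - q)) \<longlonglongrightarrow> 0" unfolding Bex_def .
    then show ?thesis unfolding p_def by (rule someI_ex)
  qed
  have le: "N (u k t - p t) \<le> l t - g k t" if h: "(\<lambda>k. g k t) \<longlonglongrightarrow> l t" for k t
  proof -
    have "N (u k t - p t) \<le> N (u j t - p t) + (g j t - g k t)" if "k \<le> j" for j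
      using F.triangle3[OF uV uV, of "p t" k t j t] p[OF h] tri[OF that, of t] F.minus_commute[OF uV uV, of j t k t] by simp
    moreover have "(\<lambda>j. N (u j t - p t) + (g j t - g k t)) \<longlonglongrightarrow> 0 + (l t - g k t)"
      using p[OF h] h by (intro tendsto_add tendsto_diff tendsto_const) auto
    ultimately have "N (u k t - p t) \<le> 0 + (l t - g k t)"
      by (intro LIMSEQ_le_const[where X="\<lambda>j. N (u j t - p t) + (g j t - g k t)"]) auto
    then show ?thesis by simp
  qed
  \<comment> \<open>Diagonal choice: the \<open>k\<close>-th simple function is within
    \<open>(1/2) ^ k\<close> of \<open>u k\<close>, uniformly in time, so this sequence approximates
    \<open>p\<close> wherever \<open>u k t\<close> converges to it.\<close>
  have "\<exists>s. \<forall>k. simple_function I (s k) \<and> (\<forall>t\<in>space I. s k t \<in> V \<and> N (s k t - u k t) \<le> (1/2) ^ k)"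
  proof (rule choice[OF allI])
    fix k :: nat
    show "\<exists>s. simple_function I s \<and> (\<forall>t\<in>space I. s t \<in> V \<and> N (s t - u k t) \<le> (1/2) ^ k)"
      using u[of k] unfolding unif_approx_def by simp
  qed
  then obtain s where s: "\<And>k. simple_function I (s k)" "\<And>k t. t \<in> space I \<Longrightarrow> s k t \<in> V"
    "\<And>k t. t \<in> space I \<Longrightarrow> N (s k t - u k t) \<le> (1/2) ^ k" by blast
  have "approx I V N s p"
    unfolding approx_def
  proof (intro conjI allI ballI)
    show "AE t in I. p t \<in> V \<and> (\<lambda>k. N (s k t - p t)) \<longlonglongrightarrow> 0"
      using lim AE_space
    proof eventually_elim
      fix t assume h: "(\<lambda>k. g k t) \<longlonglongrightarrow> l t" and t: "t \<in> space I"
      have "(\<lambda>k. (1/2) ^ k + N (u k t - p t)) \<longlonglongrightarrow> 0 + 0"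
        using p[OF h] by (intro tendsto_add LIMSEQ_power_zero) auto
      then have "(\<lambda>k. (1/2) ^ k + N (u k t - p t)) \<longlonglongrightarrow> 0" by simp
      then have "(\<lambda>k. N (s k t - p t)) \<longlonglongrightarrow> 0"
      proof (rule squeeze_zero)
        fix k
        have "N (s k t - p t) \<le> N (s k t - u k t) + N (u k t - p t)"
          using p[OF h] by (intro F.triangle3 s(2)[OF t] uV) auto
        moreover have "0 \<le> N (s k t - p t)" using p[OF h] by (intro F.nonneg F.mem(3) s(2)[OF t]) auto
        ultimately show "\<bar>N (s k t - p t)\<bar> \<le> (1/2) ^ k + N (u k t - p t)" using s(3)[OF t, of k] by simp
      qed
      then show "p t \<in> V \<and> (\<lambda>k. N (s k t - p t)) \<longlonglongrightarrow> 0" using p[OF h] by blast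
    qed
  qed (use s in auto)
  then have sm: "strongly_measurable I V N p" using strongly_measurable_iff by blast
  have smd: "strongly_measurable I V N (\<lambda>t. u k t - p t)" for k
    using strongly_measurable_add[OF F.seminormed_axioms, of I "u k" "\<lambda>t. (-1) *\<^sub>R p t"]
      strongly_measurable_scale[OF F.seminormed_axioms sm, of "-1"] uL[of k] by (simp add: L2t_def)
  have i: "integrable I (\<lambda>t. (N (u k t - p t))\<^sup>2)" and n: "nm (\<lambda>t. u k t - p t) \<le> sqrt (LINT t|I. (g k t - l t)\<^sup>2)" for k
  proof -
    have sq: "integrable I (\<lambda>t. (g k t - l t)\<^sup>2)"
    proof -
      interpret S: semi_inner "sqint I" "\<lambda>f g. LINT x|I. f x * g x" by (rule semi_inner_sqint)
      show ?thesis using S.mem(3)[OF gS l(1), of k] by (simp add: sqint_def)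
    qed
    have ae: "AE t in I. (N (u k t - p t))\<^sup>2 \<le> (g k t - l t)\<^sup>2"
      using lim
    proof eventually_elim
      fix t assume h: "(\<lambda>k. g k t) \<longlonglongrightarrow> l t"
      have "(N (u k t - p t))\<^sup>2 \<le> (l t - g k t)\<^sup>2"
        using le[OF h, of k] p[OF h] by (intro power_mono F.nonneg F.mem(3) uV) auto
      then show "(N (u k t - p t))\<^sup>2 \<le> (g k t - l t)\<^sup>2" by (simp add: power2_commute)
    qed
    show i: "integrable I (\<lambda>t. (N (u k t - p t))\<^sup>2)"
      using sq I.norm_measurable[OF F.seminormed_axioms smd, of k] ae
      by (intro Bochner_Integration.integrable_bound[OF sq]) auto
    show "nm (\<lambda>t. u k t - p t) \<le> sqrt (LINT t|I. (g k t - l t)\<^sup>2)"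
      unfolding nm_def using i sq ae by (intro real_sqrt_le_mono integral_mono_AE) auto
  qed
  have "(\<lambda>t. u 0 t - p t) \<in> L2t I V N"
    unfolding L2t_def using i[of 0] smd[of 0] by blast
  then have "(\<lambda>t. u 0 t - (u 0 t - p t)) \<in> L2t I V N"
    by (rule I.L2t_diff[OF F.seminormed_axioms uL])
  then have "p \<in> L2t I V N" by simp
  moreover have "(\<lambda>k. nm (\<lambda>t. u k t - p t)) \<longlonglongrightarrow> 0"
    using n nm_nonneg by (intro squeeze_zero[OF l(2)]) simp
  ultimately show thesis by (rule that)
qed

end

section \<open>Test functions and the weak form\<close>

context parabolic
begin

text \<open>A test function \<open>\<phi>\<close> is stored as the pair of \<open>- \<phi>'\<close>
  and \<open>\<phi>\<close>, so that functions with values in \<open>V\<close> never have to be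
  differentiated: \<open>\<psi> t *\<^sub>R v\<close> takes its derivative from the scalar
  \<open>\<psi>\<close>. The condition at \<open>T\<close> removes the final value from the
  integration by parts and leaves the initial one.\<close>

definition generators :: "((real \<Rightarrow> 'x \<Rightarrow> real) \<times> (real \<Rightarrow> 'x \<Rightarrow> real)) set" where
  "generators = {((\<lambda>t. (- \<psi>' t) *\<^sub>R v), (\<lambda>t. \<psi> t *\<^sub>R v)) | \<psi> \<psi>' v. v \<in> V \<and>
     (\<forall>x. (\<psi> has_real_derivative \<psi>' x) (at x)) \<and> (\<forall>x. isCont \<psi>' x) \<and> \<psi> T = 0}"

definition test_space :: "((real \<Rightarrow> 'x \<Rightarrow> real) \<times> (real \<Rightarrow> 'x \<Rightarrow> real)) set" where
  "test_space = span generators"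

definition regular_pairs :: "((real \<Rightarrow> 'x \<Rightarrow> real) \<times> (real \<Rightarrow> 'x \<Rightarrow> real)) set" where
  "regular_pairs = {z. unif_approx (fst z) \<and> unif_approx (snd z) \<and> snd z T = 0}"

lemma subspace_regular_pairs: "subspace regular_pairs"
proof (rule subspaceI)
  have "unif_approx (\<lambda>t. 0)" using unif_approx_scaled_vector[OF continuous_on_const F.mem(1), of 0] by simp
  moreover have "(\<lambda>t::real. 0 :: 'x \<Rightarrow> real) = 0" by (simp add: fun_eq_iff)
  ultimately have "unif_approx 0" by (simp only:)
  then show "0 \<in> regular_pairs" by (simp add: regular_pairs_def)
next
  fix z w assume "z \<in> regular_pairs" "w \<in> regular_pairs"
  then show "z + w \<in> regular_pairs"
    using unif_approx_add[of "fst z" "fst w"] unif_approx_add[of "snd z" "snd w"]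
    by (simp add: regular_pairs_def plus_fun_def[of "fst z"] plus_fun_def[of "snd z"])
next
  fix d z assume "z \<in> regular_pairs"
  then show "d *\<^sub>R z \<in> regular_pairs"
    using unif_approx_scale[of "fst z" d] unif_approx_scale[of "snd z" d]
    by (simp add: regular_pairs_def scaleR_fun_def[of d "fst z"] scaleR_fun_def[of d "snd z"])
qed

lemma generators_regular: "generators \<subseteq> regular_pairs"
proof
  fix z assume "z \<in> generators"
  then obtain \<psi> \<psi>' v where z: "z = ((\<lambda>t. (- \<psi>' t) *\<^sub>R v), (\<lambda>t. \<psi> t *\<^sub>R v))" and v: "v \<in> V"
    and d: "\<And>x. (\<psi> has_real_derivative \<psi>' x) (at x)" and c: "\<And>x. isCont \<psi>' x" and \<psi>T: "\<psi> T = 0"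
    unfolding generators_def by blast
  have "continuous_on UNIV (\<lambda>t. - \<psi>' t)" using c by (simp add: continuous_on_eq_continuous_at)
  moreover have "continuous_on UNIV \<psi>" using d DERIV_isCont by (auto simp: continuous_on_eq_continuous_at)
  ultimately show "z \<in> regular_pairs"
    unfolding regular_pairs_def z using \<psi>T by (simp only: mem_Collect_eq fst_conv snd_conv unif_approx_scaled_vector v scaleR_zero_left)
qed

lemma test_space_regular: "test_space \<subseteq> regular_pairs"
  unfolding test_space_def by (rule span_minimal[OF generators_regular subspace_regular_pairs])

lemma test_space_mem:
  assumes "z \<in> test_space"
  shows "fst z t \<in> V" "snd z t \<in> V" "unif_approx (fst z)" "unif_approx (snd z)" "snd z T = 0"
    "fst z \<in> L2t I V N" "snd z \<in> L2t I V N"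
  using test_space_regular assms unif_approx_L2t by (auto simp: regular_pairs_def unif_approx_def)

lemma subspace_test_space: "subspace test_space"
  by (simp add: test_space_def)

text \<open>First components are minus derivatives, whence the sign. The continuity clauses are what
  the fundamental theorem asks of the derivative.\<close>

definition product_rule ::
    "(real \<Rightarrow> 'x \<Rightarrow> real) \<times> (real \<Rightarrow> 'x \<Rightarrow> real) \<Rightarrow> (real \<Rightarrow> 'x \<Rightarrow> real) \<times> (real \<Rightarrow> 'x \<Rightarrow> real) \<Rightarrow> bool" where
  "product_rule z w \<longleftrightarrow> (\<forall>t. ((\<lambda>t. b (snd z t) (snd w t)) has_real_derivative
      - (b (fst z t) (snd w t) + b (snd z t) (fst w t))) (at t)) \<and>
     (\<forall>t. isCont (\<lambda>t. b (fst z t) (snd w t)) t) \<and> (\<forall>t. isCont (\<lambda>t. b (snd z t) (fst w t)) t)"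

lemma regular_mem: "z \<in> regular_pairs \<Longrightarrow> fst z t \<in> V \<and> snd z t \<in> V"
  by (simp add: regular_pairs_def unif_approx_def)

lemma product_rule_commute:
  assumes "z \<in> regular_pairs" "w \<in> regular_pairs" "product_rule z w"
  shows "product_rule w z"
proof -
  have 1: "b (snd w t) (snd z t) = b (snd z t) (snd w t)" "b (fst w t) (snd z t) = b (snd z t) (fst w t)"
    "b (snd w t) (fst z t) = b (fst z t) (snd w t)" for t
    using b.commute regular_mem[OF assms(1), of t] regular_mem[OF assms(2), of t] by auto
  show ?thesis using assms(3) unfolding product_rule_def 1 by (simp add: add.commute)
qed

lemma subspace_product_rule:
  assumes w: "w \<in> regular_pairs"
  shows "subspace {z \<in> regular_pairs. product_rule z w}"
proof (rule subspaceI)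
  have "b ((0 :: 'x \<Rightarrow> real)) (snd w t) = 0" "b ((0 :: 'x \<Rightarrow> real)) (fst w t) = 0" for t
    using regular_mem[OF w] by auto
  then show "0 \<in> {z \<in> regular_pairs. product_rule z w}"
    using subspace_0[OF subspace_regular_pairs] by (simp add: product_rule_def)
next
  fix y z assume y: "y \<in> {z \<in> regular_pairs. product_rule z w}" and z: "z \<in> {z \<in> regular_pairs. product_rule z w}"
  have e: "b (fst (y + z) t) x = b (fst y t) x + b (fst z t) x" "b (snd (y + z) t) x = b (snd y t) x + b (snd z t) x" if "x \<in> V" for t x
    using that regular_mem[of y t] regular_mem[of z t] y z by (simp_all add: b.add_left)
  have e': "(\<lambda>t. b (fst (y + z) t) (snd w t)) = (\<lambda>t. b (fst y t) (snd w t) + b (fst z t) (snd w t))"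
    "(\<lambda>t. b (snd (y + z) t) (fst w t)) = (\<lambda>t. b (snd y t) (fst w t) + b (snd z t) (fst w t))"
    "(\<lambda>t. b (snd (y + z) t) (snd w t)) = (\<lambda>t. b (snd y t) (snd w t) + b (snd z t) (snd w t))"
    using e regular_mem[OF w] by auto
  have e2: "b (fst (y + z) t) (snd w t) = b (fst y t) (snd w t) + b (fst z t) (snd w t)"
    "b (snd (y + z) t) (fst w t) = b (snd y t) (fst w t) + b (snd z t) (fst w t)" for t
    using e regular_mem[OF w, of t] by auto
  have "((\<lambda>t. b (snd y t) (snd w t) + b (snd z t) (snd w t)) has_real_derivative
      - (b (fst y t) (snd w t) + b (snd y t) (fst w t)) + - (b (fst z t) (snd w t) + b (snd z t) (fst w t))) (at t)" for t
    using y z by (intro DERIV_add) (auto simp: product_rule_def)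
  then have "product_rule (y + z) w"
    using y z unfolding product_rule_def e' e2 by (simp add: algebra_simps)
  then show "y + z \<in> {z \<in> regular_pairs. product_rule z w}"
    using y z subspace_add[OF subspace_regular_pairs] by simp
next
  fix d z assume z: "z \<in> {z \<in> regular_pairs. product_rule z w}"
  have e: "b (fst (d *\<^sub>R z) t) x = d * b (fst z t) x" "b (snd (d *\<^sub>R z) t) x = d * b (snd z t) x" if "x \<in> V" for t x
    using that regular_mem[of z t] z by (simp_all add: b.scale_left)
  have e': "(\<lambda>t. b (fst (d *\<^sub>R z) t) (snd w t)) = (\<lambda>t. d * b (fst z t) (snd w t))"
    "(\<lambda>t. b (snd (d *\<^sub>R z) t) (fst w t)) = (\<lambda>t. d * b (snd z t) (fst w t))"
    "(\<lambda>t. b (snd (d *\<^sub>R z) t) (snd w t)) = (\<lambda>t. d * b (snd z t) (snd w t))"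
    using e regular_mem[OF w] by auto
  have e2: "b (fst (d *\<^sub>R z) t) (snd w t) = d * b (fst z t) (snd w t)"
    "b (snd (d *\<^sub>R z) t) (fst w t) = d * b (snd z t) (fst w t)" for t
    using e regular_mem[OF w, of t] by auto
  have "((\<lambda>t. d * b (snd z t) (snd w t)) has_real_derivative
      d * - (b (fst z t) (snd w t) + b (snd z t) (fst w t))) (at t)" for t
    using z by (intro DERIV_cmult) (auto simp: product_rule_def)
  then have "product_rule (d *\<^sub>R z) w"
    using z unfolding product_rule_def e' e2 by (simp add: algebra_simps)
  then show "d *\<^sub>R z \<in> {z \<in> regular_pairs. product_rule z w}"
    using z subspace_scale[OF subspace_regular_pairs] by simp
qed

lemma product_rule_generators:
  assumes "z \<in> generators" "w \<in> generators"
  shows "product_rule z w"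
proof -
  obtain \<psi> \<psi>' v where z: "z = ((\<lambda>t. (- \<psi>' t) *\<^sub>R v), (\<lambda>t. \<psi> t *\<^sub>R v))" and v: "v \<in> V"
    and d: "\<And>x. (\<psi> has_real_derivative \<psi>' x) (at x)" and c: "\<And>x. isCont \<psi>' x"
    using assms(1) unfolding generators_def by blast
  obtain \<phi> \<phi>' u where w: "w = ((\<lambda>t. (- \<phi>' t) *\<^sub>R u), (\<lambda>t. \<phi> t *\<^sub>R u))" and u: "u \<in> V"
    and d': "\<And>x. (\<phi> has_real_derivative \<phi>' x) (at x)" and c': "\<And>x. isCont \<phi>' x"
    using assms(2) unfolding generators_def by blast
  have e: "b (r *\<^sub>R v) (s *\<^sub>R u) = r * s * b v u" for r s
    using v u by (simp add: b.scale_left b.scale_right)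
  have "((\<lambda>t. \<psi> t * \<phi> t * b v u) has_real_derivative - ((- \<psi>' t) * \<phi> t * b v u + \<psi> t * (- \<phi>' t) * b v u)) (at t)" for t
    by (rule DERIV_cong[OF DERIV_cmult_right[OF DERIV_mult[OF d d']]]) (simp add: algebra_simps)
  then show ?thesis
    unfolding product_rule_def z w fst_conv snd_conv e
    using c c' DERIV_isCont[OF d] DERIV_isCont[OF d'] by (auto intro!: continuous_intros)
qed

text \<open>A bilinear statement on a span: with a generator on the right, the admissible left
  arguments form a subspace; symmetry then exchanges the two sides and the argument is
  repeated.\<close>

lemma product_rule_test_space:
  assumes z: "z \<in> test_space" and w: "w \<in> test_space"
  shows "product_rule z w"
proof -
  have 1: "product_rule y h" if "y \<in> test_space" "h \<in> generators" for y h
  proof -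
    have h: "h \<in> regular_pairs" using that(2) generators_regular by blast
    have "test_space \<subseteq> {z \<in> regular_pairs. product_rule z h}"
      unfolding test_space_def using product_rule_generators that(2) generators_regular
      by (intro span_minimal subspace_product_rule[OF h]) blast
    then show ?thesis using that(1) by blast
  qed
  have zr: "z \<in> regular_pairs" using z test_space_regular by blast
  have "test_space \<subseteq> {w \<in> regular_pairs. product_rule w z}"
    unfolding test_space_def
  proof (intro span_minimal subspace_product_rule[OF zr] subsetI)
    fix h assume h: "h \<in> generators"
    then have "h \<in> regular_pairs" using generators_regular by blast
    then show "h \<in> {w \<in> regular_pairs. product_rule w z}"
      using product_rule_commute[OF zr _ 1[OF z h]] by blast
  qed
  then have "product_rule w z" using w by blast
  then show ?thesis using product_rule_commute w z test_space_regular by blast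
qed

text \<open>The fundamental theorem for \<open>(1 + t) * b (\<phi> t) (\<phi> t)\<close>, which
  vanishes at \<open>T\<close>. Without the weight only the initial value would come out; the
  derivative of the weight adds the integral of \<open>b (\<phi> t) (\<phi> t)\<close>, the part of
  the norm that the energy form does not supply.\<close>

lemma time_weight_identity:
  assumes z: "z \<in> test_space"
  shows "2 * (LINT t|I. (1 + t) * b (fst z t) (snd z t)) = b (snd z 0) (snd z 0) + (LINT t|I. b (snd z t) (snd z t))"
proof -
  have pr: "product_rule z z" by (rule product_rule_test_space[OF z z])
  have sym: "b (snd z t) (fst z t) = b (fst z t) (snd z t)" for t
    by (rule b.commute[OF test_space_mem(2,1)[OF z]])
  define f where "f t = b (snd z t) (snd z t) - 2 * ((1 + t) * b (fst z t) (snd z t))" for t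
  have cont: "isCont (\<lambda>t. b (fst z t) (snd z t)) t" for t using pr by (simp add: product_rule_def)
  have d: "((\<lambda>t. b (snd z t) (snd z t)) has_real_derivative - (2 * b (fst z t) (snd z t))) (at t)" for t
    using pr unfolding product_rule_def sym by simp
  have D: "((\<lambda>t. (1 + t) * b (snd z t) (snd z t)) has_real_derivative f t) (at t)" for t
  proof (rule DERIV_cong[OF DERIV_mult[OF DERIV_add[OF DERIV_const DERIV_ident] d]])
  qed (simp add: f_def algebra_simps)
  have "(LINT t|I. f t * indicator {0<..} t) = (1 + T) * b (snd z T) (snd z T) - (1 + 0) * b (snd z 0) (snd z 0)"
    using T D cont DERIV_isCont[OF d] by (intro integral_time_FTC) (auto simp: f_def intro!: continuous_intros)
  also have "\<dots> = - b (snd z 0) (snd z 0)" using test_space_mem(5)[OF z] by simp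
  also have "(LINT t|I. f t * indicator {0<..} t) = (LINT t|I. f t)"
    by (rule Bochner_Integration.integral_cong) auto
  also have "\<dots> = (LINT t|I. b (snd z t) (snd z t)) - 2 * (LINT t|I. (1 + t) * b (fst z t) (snd z t))"
  proof -
    have "integrable I (\<lambda>t. b (snd z t) (snd z t))"
      by (rule bounded_form_integral(1)[OF bounded_forms(1) test_space_mem(7)[OF z] test_space_mem(7)[OF z]])
    moreover have "integrable I (\<lambda>t. (1 + t) * b (fst z t) (snd z t))"
      by (rule integrable_time_continuous_mult[OF bounded_form_integral(1)[OF bounded_forms(1) test_space_mem(6)[OF z] test_space_mem(7)[OF z]]])
        (intro continuous_intros)
    ultimately show ?thesis unfolding f_def by simp
  qed
  finally show ?thesis by simp
qed

text \<open>The representing vectors are chosen one by one and depend linearly on \<open>u\<close>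
  only modulo seminorm zero. The Lipschitz bound, obtained by testing \<open>P u - P w\<close> with
  itself, takes the place of linearity and continuity when \<open>P\<close> is applied to functions
  of time.\<close>

lemma bounded_form_representation:
  assumes \<beta>: "bounded_form \<beta>"
  obtains P where "\<And>u. u \<in> V \<Longrightarrow> P u \<in> V" "\<And>u v. u \<in> V \<Longrightarrow> v \<in> V \<Longrightarrow> ip (P u) v = \<beta> u v"
    "\<And>u w. u \<in> V \<Longrightarrow> w \<in> V \<Longrightarrow> N (P u - P w) \<le> 1 * N (u - w)"
proof -
  interpret \<beta>: semi_inner V \<beta> using \<beta> by (simp add: bounded_form_def)
  have "\<exists>w\<in>V. \<forall>v\<in>V. ip w v = \<beta> u v" if u: "u \<in> V" for u
  proof -
    obtain w where "w \<in> V" "\<And>v. v \<in> V \<Longrightarrow> ip w v = \<beta> u v"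
    proof (rule H.Riesz[of "\<beta> u" "N u"])
      show "\<bar>\<beta> u v\<bar> \<le> N u * sqrt (ip v v)" if "v \<in> V" for v
        using bounded_form_le[OF \<beta> u that] by (simp add: N_eq)
    qed (use u in \<open>simp_all add: \<beta>.bilinear\<close>)
    then show ?thesis by blast
  qed
  then obtain P where P: "\<And>u. u \<in> V \<Longrightarrow> P u \<in> V" "\<And>u v. u \<in> V \<Longrightarrow> v \<in> V \<Longrightarrow> ip (P u) v = \<beta> u v"
    by metis
  show thesis
  proof (rule that[of P, OF P])
    fix u w assume u: "u \<in> V" and w: "w \<in> V"
    define x where "x = P u - P w"
    have x: "x \<in> V" unfolding x_def by (rule F.mem(3)[OF P(1)[OF u] P(1)[OF w]])
    have "(N x)\<^sup>2 = ip (P u) x - ip (P w) x"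
      unfolding N_sq[OF x] by (subst x_def) (rule H.diff_left[OF P(1)[OF u] P(1)[OF w] x])
    also have "\<dots> = \<beta> (u - w) x" using u w x by (simp add: P(2) \<beta>.diff_left)
    also have "\<dots> \<le> N (u - w) * N x" using bounded_form_le[OF \<beta> F.mem(3)[OF u w] x] by simp
    finally have le: "N x * N x \<le> N (u - w) * N x" by (simp add: power2_eq_square)
    have "N x \<le> N (u - w)"
    proof (cases "N x = 0")
      case True
      then show ?thesis using F.nonneg[OF F.mem(3)[OF u w]] by simp
    next
      case False
      then have "0 < N x" using F.nonneg[OF x] by simp
      then show ?thesis using le by simp
    qed
    then show "N (P u - P w) \<le> 1 * N (u - w)" by (simp add: x_def)
  qed
qed

text \<open>Lions' method: the functional \<open>z \<mapsto> \<integral>\<langle>F, \<phi>\<rangle> + l0 (\<phi> 0)\<close>, \<open>z = (- \<phi>', \<phi>)\<close>, is bounded by the norm of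
  \<open>K z\<close>, where \<open>\<integral>ip(p, K z)\<close> is the weak form; coercivity comes from pairing \<open>K z\<close> with \<open>(1 + t) \<phi>\<close>.\<close>

lemma weak_form_solution:
  assumes F: "F \<in> L2t I V' N'"
    and l0_add: "\<And>u v. u \<in> V \<Longrightarrow> v \<in> V \<Longrightarrow> l0 (u + v) = l0 u + l0 v"
    and l0_scale: "\<And>d u. u \<in> V \<Longrightarrow> l0 (d *\<^sub>R u) = d * l0 u"
    and l0_bound: "\<And>u. u \<in> V \<Longrightarrow> \<bar>l0 u\<bar> \<le> C0 * sqrt (b u u)"
  obtains p where "p \<in> L2t I V N"
    "\<And>v \<psi> \<psi>'. \<lbrakk>v \<in> V; \<And>x. (\<psi> has_real_derivative \<psi>' x) (at x); \<And>x. isCont \<psi>' x; \<psi> T = 0\<rbrakk> \<Longrightarrow>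
      - (LINT t|I. \<psi>' t * b (p t) v) + c * (LINT t|I. \<psi> t * a (p t) v) = (LINT t|I. \<psi> t * F t v) + \<psi> 0 * l0 v"
proof -
  obtain B where B: "\<And>u. u \<in> V \<Longrightarrow> B u \<in> V" "\<And>u v. u \<in> V \<Longrightarrow> v \<in> V \<Longrightarrow> ip (B u) v = b u v"
    "\<And>u w. u \<in> V \<Longrightarrow> w \<in> V \<Longrightarrow> N (B u - B w) \<le> 1 * N (u - w)"
    using bounded_form_representation[OF bounded_forms(1)] by blast
  obtain A where A: "\<And>u. u \<in> V \<Longrightarrow> A u \<in> V" "\<And>u v. u \<in> V \<Longrightarrow> v \<in> V \<Longrightarrow> ip (A u) v = a u v"
    "\<And>u w. u \<in> V \<Longrightarrow> w \<in> V \<Longrightarrow> N (A u - A w) \<le> 1 * N (u - w)"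
    using bounded_form_representation[OF bounded_forms(2)] by blast
  \<comment> \<open>For \<open>z\<close> made of \<open>- \<phi>'\<close> and \<open>\<phi>\<close>,
    \<open>ip (p t) (K z t)\<close> is \<open>- b(p, \<phi>') + c a(p, \<phi>)\<close>, the
    integrand of the weak form with the time derivative moved to the test function.\<close>
  define K where "K z t = B (fst z t) + c *\<^sub>R A (snd z t)" for z :: "(real \<Rightarrow> 'x \<Rightarrow> real) \<times> (real \<Rightarrow> 'x \<Rightarrow> real)" and t
  note tm = test_space_mem
  have KU: "unif_approx (K z)" if z: "z \<in> test_space" for z
    unfolding K_def by (intro unif_approx_add unif_approx_scale unif_approx_image[OF tm(3)[OF z] B(1) B(3)]
      unif_approx_image[OF tm(4)[OF z] A(1) A(3)])
  then have KL: "K z \<in> L2t I V N" if "z \<in> test_space" for z using that unif_approx_L2t by blast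
  have KV: "K z t \<in> V" if "z \<in> test_space" for z t using KU[OF that] by (simp add: unif_approx_def)
  have ipK: "ip (K z t) x = b (fst z t) x + c * a (snd z t) x" if z: "z \<in> test_space" and x: "x \<in> V" for z t x
    unfolding K_def using x B(1,2)[OF tm(1)[OF z]] A(1,2)[OF tm(2)[OF z]] by (simp add: H.add_left H.scale_left)
  \<comment> \<open>Additivity is claimed only inside \<open>ip\<close>: \<open>A\<close> and
    \<open>B\<close> come from choices and are additive only up to seminorm zero.\<close>
  have Kadd: "ip (K (z + w) t) x = ip (K z t) x + ip (K w t) x" if z: "z \<in> test_space" and w: "w \<in> test_space" and x: "x \<in> V" for z w t x
    using ipK[OF subspace_add[OF subspace_test_space z w] x] ipK[OF z x] ipK[OF w x] tm(1,2)[OF z, of t] tm(1,2)[OF w, of t] x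
    by (simp add: b.add_left a.add_left algebra_simps)
  have Kscale: "ip (K (d *\<^sub>R z) t) x = d * ip (K z t) x" if z: "z \<in> test_space" and x: "x \<in> V" for z d t x
    using ipK[OF subspace_scale[OF subspace_test_space z] x] ipK[OF z x] tm(1,2)[OF z, of t] x
    by (simp add: b.scale_left a.scale_left algebra_simps)
  define J where "J z w = (LINT t|I. ip (K z t) (K w t))" for z w
  have Jint: "integrable I (\<lambda>t. ip (K z t) (K w t))" if "z \<in> test_space" "w \<in> test_space" for z w
    by (rule bounded_form_integral(1)[OF bounded_forms(3) KL[OF that(1)] KL[OF that(2)]])
  interpret J: semi_inner test_space J
  proof
    show "subspace test_space" by (rule subspace_test_space)
    fix z assume z: "z \<in> test_space"
    { fix w x assume w: "w \<in> test_space" and x: "x \<in> test_space"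
      show "J (z + w) x = J z x + J w x"
        unfolding J_def Kadd[OF z w KV[OF x]] by (rule Bochner_Integration.integral_add[OF Jint[OF z x] Jint[OF w x]]) }
    { fix w and d :: real assume w: "w \<in> test_space"
      show "J (d *\<^sub>R z) w = d * J z w"
        unfolding J_def Kscale[OF z KV[OF w]] by simp
      show "J z w = J w z" unfolding J_def H.commute[OF KV[OF z] KV[OF w]] by simp }
    show "0 \<le> J z z" unfolding J_def by (rule integral_nonneg_AE) (simp add: H.ip_nonneg KV[OF z])
  qed
  have Jnm: "sqrt (J z z) = nm (K z)" if "z \<in> test_space" for z
    unfolding J_def nm_def N_sq[OF KV[OF that]] by simp
  define L where "L z = (LINT t|I. F t (snd z t)) + l0 (snd z 0)" for z :: "(real \<Rightarrow> 'x \<Rightarrow> real) \<times> (real \<Rightarrow> 'x \<Rightarrow> real)"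
  have Fint: "integrable I (\<lambda>t. F t (snd z t))" if "z \<in> test_space" for z
    by (rule F.pairing_bound(1)[OF complete_time F tm(7)[OF that]])
  have Ladd: "L (z + w) = L z + L w" if z: "z \<in> test_space" and w: "w \<in> test_space" for z w
  proof -
    have "(LINT t|I. F t (snd (z + w) t)) = (LINT t|I. F t (snd z t) + F t (snd w t))"
    proof (rule integral_cong_AE)
      show "(\<lambda>t. F t (snd (z + w) t)) \<in> borel_measurable I"
        using Fint[OF subspace_add[OF subspace_test_space z w]] by (rule borel_measurable_integrable)
      show "(\<lambda>t. F t (snd z t) + F t (snd w t)) \<in> borel_measurable I"
        using Fint[OF z] Fint[OF w] by (intro borel_measurable_integrable Bochner_Integration.integrable_add)
      show "AE t in I. F t (snd (z + w) t) = F t (snd z t) + F t (snd w t)"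
        using L2t_AE[OF F] by eventually_elim (simp add: F.dual_add tm(2)[OF z] tm(2)[OF w])
    qed
    also have "\<dots> = (LINT t|I. F t (snd z t)) + (LINT t|I. F t (snd w t))"
      by (rule Bochner_Integration.integral_add[OF Fint[OF z] Fint[OF w]])
    finally show ?thesis using l0_add[OF tm(2)[OF z] tm(2)[OF w], of 0 0] by (simp add: L_def)
  qed
  have Lscale: "L (d *\<^sub>R z) = d * L z" if z: "z \<in> test_space" for d z
  proof -
    have "(LINT t|I. F t (snd (d *\<^sub>R z) t)) = (LINT t|I. d * F t (snd z t))"
    proof (rule integral_cong_AE)
      show "(\<lambda>t. F t (snd (d *\<^sub>R z) t)) \<in> borel_measurable I"
        using Fint[OF subspace_scale[OF subspace_test_space z]] by (rule borel_measurable_integrable)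
      show "(\<lambda>t. d * F t (snd z t)) \<in> borel_measurable I"
        using Fint[OF z] by (intro borel_measurable_times borel_measurable_const borel_measurable_integrable)
      show "AE t in I. F t (snd (d *\<^sub>R z) t) = d * F t (snd z t)"
        using L2t_AE[OF F] by eventually_elim (simp add: F.dual_scale tm(2)[OF z])
    qed
    then show ?thesis using l0_scale[OF tm(2)[OF z], of d 0] by (simp add: L_def algebra_simps)
  qed
  \<comment> \<open>The time weight identity yields the factor 1/2 on the terms in \<open>b\<close>,
    the equation the factor \<open>c\<close> on the energy term; \<open>\<alpha>\<close> is the
    smaller of the two.\<close>
  define \<alpha> where "\<alpha> = min (1/2) c"
  have \<alpha>: "\<alpha> > 0" using c by (simp add: \<alpha>_def)
  define nF where "nF = sqrt (LINT t|I. (N' (F t))\<^sup>2)"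
  have nF: "0 \<le> nF" by (simp add: nF_def integral_nonneg_AE)
  have Lbound: "\<bar>L z\<bar> \<le> ((nF + \<bar>C0\<bar>) * ((1 + T) / \<alpha>)) * sqrt (J z z)" if z: "z \<in> test_space" for z
  proof -
    define \<phi> where "\<phi> = snd z"
    have \<phi>V: "\<phi> t \<in> V" for t unfolding \<phi>_def by (rule tm(2)[OF z])
    have \<phi>L: "\<phi> \<in> L2t I V N" unfolding \<phi>_def by (rule tm(7)[OF z])
    have "0 \<le> (LINT t|I. ip (\<phi> t) (\<phi> t))" by (rule integral_nonneg_AE) (simp add: H.ip_nonneg \<phi>V)
    then have sqs: "(nm \<phi>)\<^sup>2 = (LINT t|I. ip (\<phi> t) (\<phi> t))"
      by (simp add: nm_def N_sq[OF \<phi>V])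
    \<comment> \<open>Measures \<open>\<phi>\<close> in L2(0, T; V) and its initial value in
      \<open>b\<close> together, as the two summands of \<open>L\<close> require. The estimate aimed
      at is \<open>\<alpha> * n\<^sup>2 \<le> (1 + T) * nm (K z) * n\<close>.\<close>
    define n where "n = sqrt ((nm \<phi>)\<^sup>2 + b (\<phi> 0) (\<phi> 0))"
    have b0: "0 \<le> b (\<phi> 0) (\<phi> 0)" by (rule b.ip_nonneg[OF \<phi>V])
    have n: "nm \<phi> \<le> n" "sqrt (b (\<phi> 0) (\<phi> 0)) \<le> n" "0 \<le> n"
      unfolding n_def using b0 nm_nonneg[of \<phi>] by (auto intro: real_le_rsqrt)
    have ib: "integrable I (\<lambda>t. b (\<phi> t) (\<phi> t))" and ia: "integrable I (\<lambda>t. a (\<phi> t) (\<phi> t))"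
      using bounded_form_integral(1)[OF bounded_forms(1) \<phi>L \<phi>L] bounded_form_integral(1)[OF bounded_forms(2) \<phi>L \<phi>L] by auto
    have ibx: "integrable I (\<lambda>t. (1 + t) * b (fst z t) (\<phi> t))"
      by (rule integrable_time_continuous_mult[OF bounded_form_integral(1)[OF bounded_forms(1) tm(6)[OF z] \<phi>L]])
        (intro continuous_intros)
    have iax: "integrable I (\<lambda>t. (1 + t) * a (\<phi> t) (\<phi> t))"
      by (rule integrable_time_continuous_mult[OF ia]) (intro continuous_intros)
    have "n\<^sup>2 = (nm \<phi>)\<^sup>2 + b (\<phi> 0) (\<phi> 0)"
      unfolding n_def using b0 by (intro real_sqrt_pow2 add_nonneg_nonneg) auto
    also have "\<dots> = b (\<phi> 0) (\<phi> 0) + (LINT t|I. b (\<phi> t) (\<phi> t)) + (LINT t|I. a (\<phi> t) (\<phi> t))"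
      using ia ib by (simp add: sqs ip_eq \<phi>V)
    finally have "\<alpha> * n\<^sup>2 = \<alpha> * b (\<phi> 0) (\<phi> 0) + \<alpha> * (LINT t|I. b (\<phi> t) (\<phi> t)) + \<alpha> * (LINT t|I. a (\<phi> t) (\<phi> t))"
      by (simp only: distrib_left)
    also have "\<dots> \<le> 1/2 * b (\<phi> 0) (\<phi> 0) + 1/2 * (LINT t|I. b (\<phi> t) (\<phi> t)) + c * (LINT t|I. (1 + t) * a (\<phi> t) (\<phi> t))"
    proof (intro add_mono mult_right_mono b0)
      show "0 \<le> (LINT t|I. b (\<phi> t) (\<phi> t))" by (rule integral_nonneg_AE) (simp add: b.ip_nonneg \<phi>V)
      have "(LINT t|I. a (\<phi> t) (\<phi> t)) \<le> (LINT t|I. (1 + t) * a (\<phi> t) (\<phi> t))"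
      proof (rule integral_mono_AE[OF ia iax])
        show "AE t in I. a (\<phi> t) (\<phi> t) \<le> (1 + t) * a (\<phi> t) (\<phi> t)"
          by (rule AE_I2) (simp add: distrib_right a.ip_nonneg \<phi>V)
      qed
      moreover have "0 \<le> (LINT t|I. a (\<phi> t) (\<phi> t))" by (rule integral_nonneg_AE) (simp add: a.ip_nonneg \<phi>V)
      ultimately show "\<alpha> * (LINT t|I. a (\<phi> t) (\<phi> t)) \<le> c * (LINT t|I. (1 + t) * a (\<phi> t) (\<phi> t))"
        using c by (intro mult_mono) (auto simp: \<alpha>_def)
    qed (auto simp: \<alpha>_def)
    also have "\<dots> = (LINT t|I. (1 + t) * b (fst z t) (\<phi> t)) + c * (LINT t|I. (1 + t) * a (\<phi> t) (\<phi> t))"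
      using time_weight_identity[OF z] by (simp add: \<phi>_def)
    also have "\<dots> = (LINT t|I. (1 + t) * ip (K z t) (\<phi> t))"
      using ibx iax ipK[OF z \<phi>V] by (simp add: \<phi>_def[symmetric] distrib_left mult.left_commute)
    also have "\<dots> \<le> (LINT t|I. (1 + T) * (N (K z t) * N (\<phi> t)))"
    proof (rule integral_mono_AE)
      show "integrable I (\<lambda>t. (1 + t) * ip (K z t) (\<phi> t))"
        by (rule integrable_time_continuous_mult[OF bounded_form_integral(1)[OF bounded_forms(3) KL[OF z] \<phi>L]])
          (intro continuous_intros)
      show "integrable I (\<lambda>t. (1 + T) * (N (K z t) * N (\<phi> t)))"
        using sqint_integrable_mult[OF I.L2t_sqint[OF F.seminormed_axioms KL[OF z]] I.L2t_sqint[OF F.seminormed_axioms \<phi>L]] by simp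
      show "AE t in I. (1 + t) * ip (K z t) (\<phi> t) \<le> (1 + T) * (N (K z t) * N (\<phi> t))"
      proof (rule AE_I2)
        fix t assume t: "t \<in> space I"
        have "(1 + t) * ip (K z t) (\<phi> t) \<le> (1 + t) * (N (K z t) * N (\<phi> t))"
          using bounded_form_le[OF bounded_forms(3) KV[OF z] \<phi>V, of t t] t by (intro mult_left_mono) auto
        also have "\<dots> \<le> (1 + T) * (N (K z t) * N (\<phi> t))"
          using t F.nonneg[OF KV[OF z]] F.nonneg[OF \<phi>V] by (intro mult_right_mono) auto
        finally show "(1 + t) * ip (K z t) (\<phi> t) \<le> (1 + T) * (N (K z t) * N (\<phi> t))" .
      qed
    qed
    also have "\<dots> = (1 + T) * (LINT t|I. N (K z t) * N (\<phi> t))" by simp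
    also have "\<dots> \<le> (1 + T) * (nm (K z) * nm \<phi>)"
    proof -
      interpret S: semi_inner "sqint I" "\<lambda>f g. LINT x|I. f x * g x" by (rule semi_inner_sqint)
      have "\<bar>LINT t|I. N (K z t) * N (\<phi> t)\<bar> \<le> nm (K z) * nm \<phi>"
        using S.Cauchy_Schwarz[OF I.L2t_sqint[OF F.seminormed_axioms KL[OF z]] I.L2t_sqint[OF F.seminormed_axioms \<phi>L]]
        by (simp add: nm_def power2_eq_square)
      then show ?thesis using T by (intro mult_left_mono) auto
    qed
    also have "\<dots> \<le> (1 + T) * (nm (K z) * n)"
      using T n(1) nm_nonneg[of "K z"] by (intro mult_left_mono) auto
    finally have "\<alpha> * n * n \<le> (1 + T) * nm (K z) * n" by (simp add: power2_eq_square mult.assoc)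
    then have "\<alpha> * n \<le> (1 + T) * nm (K z)"
      using n(3) T nm_nonneg[of "K z"] by (cases "n = 0") auto
    then have nK: "n \<le> (1 + T) / \<alpha> * nm (K z)" using \<alpha> by (simp add: field_simps)
    have "\<bar>L z\<bar> \<le> \<bar>LINT t|I. F t (\<phi> t)\<bar> + \<bar>l0 (\<phi> 0)\<bar>" unfolding L_def \<phi>_def by (rule abs_triangle_ineq)
    also have "\<dots> \<le> nF * nm \<phi> + C0 * sqrt (b (\<phi> 0) (\<phi> 0))"
      using F.pairing_bound(2)[OF complete_time F \<phi>L] l0_bound[OF \<phi>V] by (intro add_mono) (auto simp: nF_def nm_def)
    also have "\<dots> \<le> nF * n + \<bar>C0\<bar> * n"
      using n nF b0 nm_nonneg[of \<phi>] by (intro add_mono mult_mono) auto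
    also have "\<dots> = (nF + \<bar>C0\<bar>) * n" by (simp add: distrib_right)
    also have "\<dots> \<le> (nF + \<bar>C0\<bar>) * ((1 + T) / \<alpha> * nm (K z))" using nK nF by (intro mult_left_mono) auto
    finally show ?thesis by (simp only: Jnm[OF z] mult.assoc)
  qed
  obtain z where z: "\<And>k. z k \<in> test_space"
    "\<And>k. sqrt (J (z (Suc k) - z k) (z (Suc k) - z k)) \<le> (1/2) ^ k"
    "\<And>w. w \<in> test_space \<Longrightarrow> (\<lambda>k. J (z k) w) \<longlonglongrightarrow> L w"
    by (rule J.Riesz_sequence[OF Ladd Lscale Lbound]) auto
  \<comment> \<open>\<open>K (z (Suc k) - z k)\<close> and \<open>K (z (Suc k)) - K (z k)\<close>
    may be different functions, but they have the same \<open>ip\<close> with every vector and hence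
    the same seminorm.\<close>
  have nmdiff: "nm (\<lambda>t. K (z (Suc k)) t - K (z k) t) = sqrt (J (z (Suc k) - z k) (z (Suc k) - z k))" for k
  proof -
    define y where "y = z (Suc k) - z k"
    have y: "y \<in> test_space" unfolding y_def by (rule subspace_diff[OF subspace_test_space z(1) z(1)])
    have e: "ip (K y t) x = ip (K (z (Suc k)) t - K (z k) t) x" if x: "x \<in> V" for t x
      using Kadd[OF z(1) subspace_scale[OF subspace_test_space z(1)], of x "Suc k" "-1" k t] Kscale[OF z(1) x, of "-1" k t] x
      by (simp add: y_def H.diff_left KV[OF z(1)])
    have "ip (K y t) (K y t) = (N (K (z (Suc k)) t - K (z k) t))\<^sup>2" for t
    proof -
      define x where "x = K (z (Suc k)) t - K (z k) t"
      have x: "x \<in> V" unfolding x_def by (rule F.mem(3)[OF KV[OF z(1)] KV[OF z(1)]])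
      have "ip (K y t) (K y t) = ip x (K y t)" unfolding x_def by (rule e[OF KV[OF y]])
      also have "\<dots> = ip (K y t) x" by (rule H.commute[OF x KV[OF y]])
      also have "\<dots> = ip x x" unfolding x_def by (rule e[OF x[unfolded x_def]])
      finally show ?thesis unfolding N_sq[OF x, unfolded x_def] by (simp only: x_def)
    qed
    then show ?thesis unfolding nm_def J_def y_def[symmetric] by simp
  qed
  have "summable (\<lambda>k. nm (\<lambda>t. K (z (Suc k)) t - K (z k) t))"
  proof (rule summable_comparison_test)
    show "\<exists>n0. \<forall>n\<ge>n0. norm (nm (\<lambda>t. K (z (Suc n)) t - K (z n) t)) \<le> (1/2) ^ n"
    proof (intro exI[of _ 0] allI impI)
      fix n
      show "norm (nm (\<lambda>t. K (z (Suc n)) t - K (z n) t)) \<le> (1/2) ^ n"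
        using z(2)[of n] nm_nonneg[of "\<lambda>t. K (z (Suc n)) t - K (z n) t"] unfolding nmdiff[symmetric] by simp
    qed
    show "summable (\<lambda>n. (1/2 :: real) ^ n)" by (rule summable_geometric) simp
  qed
  then obtain p where p: "p \<in> L2t I V N" "(\<lambda>k. nm (\<lambda>t. K (z k) t - p t)) \<longlonglongrightarrow> 0"
    using L2t_limit[of "\<lambda>k. K (z k)"] KU[OF z(1)] by blast
  \<comment> \<open>\<open>J (z k) w\<close> has two known limits: \<open>L w\<close>, because the
    sequence is minimising, and the pairing with \<open>p\<close>, because \<open>K (z k)\<close>
    tends to \<open>p\<close>.\<close>
  have weak: "(LINT t|I. ip (p t) (K w t)) = L w" if w: "w \<in> test_space" for w
  proof (rule LIMSEQ_unique)
    have "\<bar>J (z k) w - (LINT t|I. ip (p t) (K w t))\<bar> \<le> nm (\<lambda>t. K (z k) t - p t) * nm (K w)" for k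
    proof -
      have dL: "(\<lambda>t. K (z k) t - p t) \<in> L2t I V N" by (rule I.L2t_diff[OF F.seminormed_axioms KL[OF z(1)] p(1)])
      have ip': "integrable I (\<lambda>t. ip (p t) (K w t))" by (rule bounded_form_integral(1)[OF bounded_forms(3) p(1) KL[OF w]])
      have "J (z k) w - (LINT t|I. ip (p t) (K w t)) = (LINT t|I. ip (K (z k) t) (K w t) - ip (p t) (K w t))"
        unfolding J_def by (rule Bochner_Integration.integral_diff[OF Jint[OF z(1) w] ip', symmetric])
      also have "\<dots> = (LINT t|I. ip (K (z k) t - p t) (K w t))"
      proof (rule integral_cong_AE)
        show "AE t in I. ip (K (z k) t) (K w t) - ip (p t) (K w t) = ip (K (z k) t - p t) (K w t)"
          using L2t_AE[OF p(1)] by eventually_elim (simp add: H.diff_left KV[OF z(1)] KV[OF w])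
        show "(\<lambda>t. ip (K (z k) t) (K w t) - ip (p t) (K w t)) \<in> borel_measurable I"
          using Jint[OF z(1) w] ip' by (intro borel_measurable_integrable Bochner_Integration.integrable_diff)
        show "(\<lambda>t. ip (K (z k) t - p t) (K w t)) \<in> borel_measurable I"
          by (rule borel_measurable_integrable[OF bounded_form_integral(1)[OF bounded_forms(3) dL KL[OF w]]])
      qed
      finally show ?thesis using bounded_form_integral(2)[OF bounded_forms(3) dL KL[OF w]] by simp
    qed
    from squeeze_zero[OF tendsto_mult_left_zero[OF p(2)] this]
    show "(\<lambda>k. J (z k) w) \<longlonglongrightarrow> (LINT t|I. ip (p t) (K w t))" by (simp add: LIM_zero_iff)
    show "(\<lambda>k. J (z k) w) \<longlonglongrightarrow> L w" by (rule z(3)[OF w])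
  qed
  show thesis
  proof (rule that[OF p(1)])
    fix v \<psi> \<psi>' assume v: "v \<in> V" and d: "\<And>x. (\<psi> has_real_derivative \<psi>' x) (at x)" and c': "\<And>x. isCont \<psi>' x" and \<psi>T: "\<psi> T = 0"
    define w where "w = ((\<lambda>t. (- \<psi>' t) *\<^sub>R v), (\<lambda>t. \<psi> t *\<^sub>R v))"
    have "w \<in> generators" unfolding generators_def w_def using v d c' \<psi>T by blast
    then have w: "w \<in> test_space" unfolding test_space_def by (rule span_base)
    have bi: "integrable I (\<lambda>t. b (p t) v)" and ai: "integrable I (\<lambda>t. a (p t) v)"
    proof -
      have "(\<lambda>t. 1 *\<^sub>R v) \<in> L2t I V N" by (intro unif_approx_L2t unif_approx_scaled_vector v continuous_on_const)
      then have cv: "(\<lambda>t. v) \<in> L2t I V N" by simp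
      show "integrable I (\<lambda>t. b (p t) v)" "integrable I (\<lambda>t. a (p t) v)"
        using bounded_form_integral(1)[OF bounded_forms(1) p(1) cv] bounded_form_integral(1)[OF bounded_forms(2) p(1) cv] by auto
    qed
    have cont: "continuous_on UNIV \<psi>'" "continuous_on UNIV \<psi>"
      using c' DERIV_isCont[OF d] by (auto simp: continuous_on_eq_continuous_at)
    have i1: "integrable I (\<lambda>t. \<psi>' t * b (p t) v)" "integrable I (\<lambda>t. \<psi> t * a (p t) v)"
      by (rule integrable_time_continuous_mult[OF bi cont(1)]) (rule integrable_time_continuous_mult[OF ai cont(2)])
    have "(LINT t|I. ip (p t) (K w t)) = (LINT t|I. - (\<psi>' t * b (p t) v) + c * (\<psi> t * a (p t) v))"
    proof (rule integral_cong_AE)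
      show "(\<lambda>t. ip (p t) (K w t)) \<in> borel_measurable I"
        by (rule borel_measurable_integrable[OF bounded_form_integral(1)[OF bounded_forms(3) p(1) KL[OF w]]])
      show "(\<lambda>t. - (\<psi>' t * b (p t) v) + c * (\<psi> t * a (p t) v)) \<in> borel_measurable I"
        using i1 by (intro borel_measurable_integrable) auto
      show "AE t in I. ip (p t) (K w t) = - (\<psi>' t * b (p t) v) + c * (\<psi> t * a (p t) v)"
        using L2t_AE[OF p(1)]
      proof eventually_elim
        fix t assume pt: "p t \<in> V"
        have "ip (p t) (K w t) = ip (K w t) (p t)" by (rule H.commute[OF pt KV[OF w]])
        also have "\<dots> = b ((- \<psi>' t) *\<^sub>R v) (p t) + c * a (\<psi> t *\<^sub>R v) (p t)"
          using ipK[OF w pt, of t] by (simp only: w_def fst_conv snd_conv)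
        also have "\<dots> = - (\<psi>' t * b (p t) v) + c * (\<psi> t * a (p t) v)"
          by (simp only: b.scale_left[OF v pt] a.scale_left[OF v pt] b.commute[OF v pt] a.commute[OF v pt])
        finally show "ip (p t) (K w t) = - (\<psi>' t * b (p t) v) + c * (\<psi> t * a (p t) v)" .
      qed
    qed
    also have "\<dots> = - (LINT t|I. \<psi>' t * b (p t) v) + c * (LINT t|I. \<psi> t * a (p t) v)"
      using i1 by simp
    finally have lhs: "L w = \<dots>" using weak[OF w] by simp
    have "(LINT t|I. F t (snd w t)) = (LINT t|I. \<psi> t * F t v)"
    proof (rule integral_cong_AE)
      show "(\<lambda>t. F t (snd w t)) \<in> borel_measurable I" by (rule borel_measurable_integrable[OF Fint[OF w]])
      show "AE t in I. F t (snd w t) = \<psi> t * F t v"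
        using L2t_AE[OF F] by eventually_elim (simp only: w_def snd_conv F.dual_scale v)
      then show "(\<lambda>t. \<psi> t * F t v) \<in> borel_measurable I"
        by (rule I.borel_measurable_AE_cong[OF borel_measurable_integrable[OF Fint[OF w]]])
    qed
    moreover have "l0 (snd w 0) = \<psi> 0 * l0 v" by (simp only: w_def snd_conv l0_scale v)
    ultimately have "L w = (LINT t|I. \<psi> t * F t v) + \<psi> 0 * l0 v" by (simp only: L_def)
    then show "- (LINT t|I. \<psi>' t * b (p t) v) + c * (LINT t|I. \<psi> t * a (p t) v) = (LINT t|I. \<psi> t * F t v) + \<psi> 0 * l0 v"
      using lhs by simp
  qed
qed

end

section \<open>From the weak form to a weak solution and its integrated equation\<close>

context parabolic
begin

lemma constant_L2t: "v \<in> V \<Longrightarrow> (\<lambda>t. v) \<in> L2t I V N"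
proof -
  assume v: "v \<in> V"
  have "(\<lambda>t. 1 *\<^sub>R v) \<in> L2t I V N" by (intro unif_approx_L2t unif_approx_scaled_vector v continuous_on_const)
  then show ?thesis by simp
qed

lemma dual_norm_integrable:
  assumes "D \<in> L2t I V' N'"
  shows "integrable I (\<lambda>t. N' (D t))"
proof -
  have "(\<lambda>t. N' (D t)) \<in> sqint I" by (rule I.L2t_sqint[OF F.seminormed_dual assms])
  moreover have "(\<lambda>t. 1) \<in> sqint I" by (simp add: sqint_def)
  ultimately show ?thesis using sqint_integrable_mult[of "\<lambda>t. N' (D t)" I "\<lambda>t. 1"] by simp
qed

lemma dual_eval_integrable:
  assumes "D \<in> L2t I V' N'" "v \<in> V"
  shows "integrable I (\<lambda>t. D t v)"
  by (rule F.pairing_bound(1)[OF complete_time assms(1) constant_L2t[OF assms(2)]])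

text \<open>Sampling \<open>G\<close> on a grid of mesh \<open>1 / Suc k\<close> gives finitely many
  values. Rounding down keeps the sample points in \<open>[0, T]\<close>, where \<open>G\<close> is
  known to be continuous.\<close>

lemma continuous_dual_strongly_measurable:
  assumes G: "\<And>t. t \<in> {0..T} \<Longrightarrow> G t \<in> V'"
    and cont: "\<And>t. t \<in> {0..T} \<Longrightarrow> ((\<lambda>s. N' (G s - G t)) \<longlongrightarrow> 0) (at t within {0..T})"
  shows "strongly_measurable I V' N' G"
proof -
  define r where "r k t = real_of_int \<lfloor>real (Suc k) * t\<rfloor> / real (Suc k)" for k :: nat and t
  have r: "0 \<le> r k t" "r k t \<le> t" "t - r k t \<le> 1 / real (Suc k)" if "0 < t" for k t
  proof -
    have f: "0 \<le> \<lfloor>real (Suc k) * t\<rfloor>" using that by simp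
    show "0 \<le> r k t" using f unfolding r_def by (intro divide_nonneg_pos) auto
    have "real_of_int \<lfloor>real (Suc k) * t\<rfloor> \<le> real (Suc k) * t" by linarith
    then show "r k t \<le> t" unfolding r_def by (simp add: divide_le_eq mult.commute)
    have "real (Suc k) * t - real_of_int \<lfloor>real (Suc k) * t\<rfloor> \<le> 1" by linarith
    then have "(real (Suc k) * t - real_of_int \<lfloor>real (Suc k) * t\<rfloor>) / real (Suc k) \<le> 1 / real (Suc k)"
      by (rule divide_right_mono) simp
    then show "t - r k t \<le> 1 / real (Suc k)" unfolding r_def by (simp add: diff_divide_distrib)
  qed
  have rs: "simple_function I (r k)" for k
  proof (rule simple_function_borel_measurable)
    have "(\<lambda>t. real (Suc k) * t) \<in> borel_measurable I" by measurable
    then have "(\<lambda>t. real_of_int \<lfloor>real (Suc k) * t\<rfloor>) \<in> borel_measurable I"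
      by (rule measurable_compose[OF _ borel_measurable_real_floor])
    then show "r k \<in> borel_measurable I" unfolding r_def by simp
    have "r k ` space I \<subseteq> (\<lambda>i. real_of_int i / real (Suc k)) ` {0..\<lfloor>real (Suc k) * T\<rfloor>}"
    proof
      fix y assume "y \<in> r k ` space I"
      then obtain t where t: "0 < t" "t < T" and y: "y = r k t" by auto
      have "real (Suc k) * t \<le> real (Suc k) * T" using t by (intro mult_left_mono) auto
      then have "\<lfloor>real (Suc k) * t\<rfloor> \<in> {0..\<lfloor>real (Suc k) * T\<rfloor>}" using t by (auto intro!: floor_mono)
      then show "y \<in> (\<lambda>i. real_of_int i / real (Suc k)) ` {0..\<lfloor>real (Suc k) * T\<rfloor>}" unfolding y r_def by (rule imageI)
    qed
    then show "finite (r k ` space I)" by (rule finite_subset) simp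
  qed
  have "approx I V' N' (\<lambda>k t. G (r k t)) G"
    unfolding approx_def
  proof (intro conjI allI ballI AE_I2)
    show "simple_function I (\<lambda>t. G (r k t))" for k by (rule simple_function_compose1[OF rs])
    fix t assume t: "t \<in> space I"
    then have t': "0 < t" "t \<in> {0..T}" by auto
    have rI: "r k t \<in> {0..T}" for k using r(1,2)[OF t'(1), of k] t' by auto
    show "G (r k t) \<in> V'" for k by (rule G[OF rI])
    show "G t \<in> V'" by (rule G[OF t'(2)])
    have "(\<lambda>k. 1 / real (Suc k)) \<longlonglongrightarrow> 0" by (rule LIMSEQ_Suc[OF lim_1_over_n])
    then have "(\<lambda>k. r k t - t) \<longlonglongrightarrow> 0"
    proof (rule squeeze_zero)
      show "\<bar>r k t - t\<bar> \<le> 1 / real (Suc k)" for k using r(2,3)[OF t'(1), of k] by simp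
    qed
    then have rt: "(\<lambda>k. r k t) \<longlonglongrightarrow> t" by (simp add: LIM_zero_iff)
    have z: "N' (G t - G t) = 0" unfolding diff_self by (rule F.dual.zero)
    have "continuous (at t within {0..T}) (\<lambda>s. N' (G s - G t))"
      unfolding continuous_within z by (rule cont[OF t'(2)])
    then have "(\<lambda>k. N' (G (r k t) - G t)) \<longlonglongrightarrow> N' (G t - G t)"
      by (rule continuous_within_tendsto_compose'[OF _ rI rt])
    then show "(\<lambda>k. N' (G (r k t) - G t)) \<longlonglongrightarrow> 0" unfolding z .
  qed
  then show ?thesis using strongly_measurable_iff by blast
qed

text \<open>The primitive is taken for each vector \<open>v\<close> separately. Its increments are
  at most those of the scalar primitive of \<open>N' (D t)\<close> times \<open>N v\<close>; this
  one estimate yields both the boundedness of the functional and the continuity in the dual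
  norm.\<close>

lemma primitive_dual:
  assumes D: "D \<in> L2t I V' N'" and l0: "l0 \<in> V'"
  defines "G \<equiv> \<lambda>t v. l0 v + running T (\<lambda>s. D s v) t"
  shows "G t \<in> V'" "((\<lambda>s. N' (G s - G t)) \<longlongrightarrow> 0) (at t within A)"
proof -
  note i = dual_eval_integrable[OF D]
  have ae: "AE t in I. D t \<in> V'" by (rule L2t_AE[OF D])
  define h where "h t = N' (D t)" for t
  have h: "integrable I h" unfolding h_def by (rule dual_norm_integrable[OF D])
  have hc: "isCont (running T h) t" for t by (rule continuous_running[OF h])
  have lin: "running T (\<lambda>s. D s (u + v)) t = running T (\<lambda>s. D s u) t + running T (\<lambda>s. D s v) t"
    if u: "u \<in> V" and v: "v \<in> V" for u v t
  proof -
    have "running T (\<lambda>s. D s (u + v)) t = running T (\<lambda>s. 1 * D s u + 1 * D s v) t"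
      unfolding running_def
    proof (rule integral_cong_AE)
      show "AE s in I. indicator {..<t} s * D s (u + v) = indicator {..<t} s * (1 * D s u + 1 * D s v)"
        using ae by eventually_elim (simp add: F.dual_add u v)
      show "(\<lambda>s. indicator {..<t} s * D s (u + v)) \<in> borel_measurable I"
        by (rule borel_measurable_integrable[OF integrable_running[OF i[OF F.mem(2)[OF u v]]]])
      have "integrable I (\<lambda>s. 1 * D s u + 1 * D s v)" using i[OF u] i[OF v] by simp
      then show "(\<lambda>s. indicator {..<t} s * (1 * D s u + 1 * D s v)) \<in> borel_measurable I"
        by (rule borel_measurable_integrable[OF integrable_running])
    qed
    then show ?thesis using running_linear[OF i[OF u] i[OF v], of 1 1 t] by simp
  qed
  have sc: "running T (\<lambda>s. D s (d *\<^sub>R u)) t = d * running T (\<lambda>s. D s u) t" if u: "u \<in> V" for u d t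
  proof -
    have "running T (\<lambda>s. D s (d *\<^sub>R u)) t = running T (\<lambda>s. d * D s u + 0 * D s u) t"
      unfolding running_def
    proof (rule integral_cong_AE)
      show "AE s in I. indicator {..<t} s * D s (d *\<^sub>R u) = indicator {..<t} s * (d * D s u + 0 * D s u)"
        using ae by eventually_elim (simp add: F.dual_scale u)
      show "(\<lambda>s. indicator {..<t} s * D s (d *\<^sub>R u)) \<in> borel_measurable I"
        by (rule borel_measurable_integrable[OF integrable_running[OF i[OF F.mem(4)[OF u]]]])
      have "integrable I (\<lambda>s. d * D s u + 0 * D s u)" using i[OF u] by simp
      then show "(\<lambda>s. indicator {..<t} s * (d * D s u + 0 * D s u)) \<in> borel_measurable I"
        by (rule borel_measurable_integrable[OF integrable_running])
    qed
    then show ?thesis using running_linear[OF i[OF u] i[OF u], of d 0 t] by simp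
  qed
  have diff: "\<bar>running T (\<lambda>s. D s u) r - running T (\<lambda>s. D s u) t\<bar> \<le> \<bar>running T h r - running T h t\<bar> * N u"
    if u: "u \<in> V" for u r t
  proof -
    have *: "\<bar>running T (\<lambda>s. D s u) r - running T (\<lambda>s. D s u) t\<bar> \<le> (running T h r - running T h t) * N u" if "t \<le> r" for r t
    proof -
      have "\<bar>running T (\<lambda>s. D s u) r - running T (\<lambda>s. D s u) t\<bar> = \<bar>LINT s|I. indicator {..<r} s * D s u - indicator {..<t} s * D s u\<bar>"
        unfolding running_def using integrable_running[OF i[OF u]] by simp
      also have "\<dots> \<le> (LINT s|I. \<bar>indicator {..<r} s * D s u - indicator {..<t} s * D s u\<bar>)" by (rule integral_abs_bound)
      also have "\<dots> \<le> (LINT s|I. (indicator {..<r} s * h s - indicator {..<t} s * h s) * N u)"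
      proof (rule integral_mono_AE)
        show "integrable I (\<lambda>s. \<bar>indicator {..<r} s * D s u - indicator {..<t} s * D s u\<bar>)"
          using integrable_running[OF i[OF u]] by simp
        show "integrable I (\<lambda>s. (indicator {..<r} s * h s - indicator {..<t} s * h s) * N u)"
          using integrable_running[OF h] by simp
        show "AE s in I. \<bar>indicator {..<r} s * D s u - indicator {..<t} s * D s u\<bar> \<le> (indicator {..<r} s * h s - indicator {..<t} s * h s) * N u"
          using ae
        proof eventually_elim
          fix s assume Ds: "D s \<in> V'"
          show "\<bar>indicator {..<r} s * D s u - indicator {..<t} s * D s u\<bar> \<le> (indicator {..<r} s * h s - indicator {..<t} s * h s) * N u"
            using F.dual_le[OF Ds u] \<open>t \<le> r\<close> by (auto simp: indicator_def h_def)
        qed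
      qed
      also have "\<dots> = (running T h r - running T h t) * N u"
        unfolding running_def using integrable_running[OF h] by simp
      finally show ?thesis .
    qed
    have Nu: "0 \<le> N u" by (rule F.nonneg[OF u])
    show ?thesis
    proof (cases "t \<le> r")
      case True
      have "(running T h r - running T h t) * N u \<le> \<bar>running T h r - running T h t\<bar> * N u" using Nu by (intro mult_right_mono) auto
      then show ?thesis using *[OF True] by linarith
    next
      case False
      then have "r \<le> t" by simp
      have "(running T h t - running T h r) * N u \<le> \<bar>running T h r - running T h t\<bar> * N u" using Nu by (intro mult_right_mono) auto
      then show ?thesis using *[OF \<open>r \<le> t\<close>] by (simp add: abs_minus_commute)
    qed
  qed
  have r0: "running T (\<lambda>s. D s u) 0 = 0" "running T h 0 = 0" for u by (rule running_0)+
  show "G t \<in> V'"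
  proof (rule F.dualI[where C="N' l0 + \<bar>running T h t\<bar>"])
    fix u assume u: "u \<in> V"
    show "\<bar>G t u\<bar> \<le> (N' l0 + \<bar>running T h t\<bar>) * N u"
      using F.dual_le[OF l0 u] diff[OF u, of t 0] unfolding r0 G_def by (simp add: distrib_right)
  qed (simp_all add: G_def lin sc F.dual_add[OF l0] F.dual_scale[OF l0] algebra_simps)
  have up: "N' (G s - G t) \<le> \<bar>running T h s - running T h t\<bar>" for s
  proof (rule F.dual_norm_le)
    fix u assume u: "u \<in> V"
    show "\<bar>(G s - G t) u\<bar> \<le> \<bar>running T h s - running T h t\<bar> * N u"
      using diff[OF u, of s t] by (simp add: G_def)
  qed simp
  show "((\<lambda>s. N' (G s - G t)) \<longlongrightarrow> 0) (at t within A)"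
  proof (rule Lim_null_comparison)
    have GV: "G s \<in> V'" for s
    proof (rule F.dualI[where C="N' l0 + \<bar>running T h s\<bar>"])
      fix u assume u: "u \<in> V"
      show "\<bar>G s u\<bar> \<le> (N' l0 + \<bar>running T h s\<bar>) * N u"
        using F.dual_le[OF l0 u] diff[OF u, of s 0] unfolding r0 G_def by (simp add: distrib_right)
    qed (simp_all add: G_def lin sc F.dual_add[OF l0] F.dual_scale[OF l0] algebra_simps)
    have "norm (N' (G s - G t)) \<le> \<bar>running T h s - running T h t\<bar>" for s
      using up[of s] F.dual_norm_nonneg[OF F.dual.mem(3)[OF GV GV], of s t] by simp
    then show "\<forall>\<^sub>F s in at t within A. norm (N' (G s - G t)) \<le> \<bar>running T h s - running T h t\<bar>"
      by (intro always_eventually allI)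
    have "(running T h \<longlongrightarrow> running T h t) (at t within A)"
      using hc[of t] unfolding continuous_at by (rule tendsto_within_subset) simp
    then have "((\<lambda>s. \<bar>running T h s - running T h t\<bar>) \<longlongrightarrow> \<bar>running T h t - running T h t\<bar>) (at t within A)"
      by (intro tendsto_intros)
    then show "((\<lambda>s. \<bar>running T h s - running T h t\<bar>) \<longlongrightarrow> 0) (at t within A)" by simp
  qed
qed

text \<open>Put \<open>D = F - c a(p)\<close> and let \<open>G\<close> be the primitive of
  \<open>D\<close> starting at \<open>l0\<close>. Integration by parts turns the weak form into the
  statement that, for each \<open>v\<close>, \<open>b (p t) v - G t v\<close> integrates to zero
  against every continuous function. So \<open>G\<close> is the continuous representative of
  \<open>b (p t)\<close>, which settles the initial value. The bound of \<open>l0\<close> by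
  \<open>b\<close> is what controls the initial term in \<open>weak_form_solution\<close>.\<close>

lemma weak_solution_exists:
  assumes F: "F \<in> L2t I V' N'" and l0: "l0 \<in> V'"
    and l0_bound: "\<And>u. u \<in> V \<Longrightarrow> \<bar>l0 u\<bar> \<le> C0 * sqrt (b u u)"
  obtains p where "p \<in> L2t I V N" "has_initial_value T V N (\<lambda>t. b (p t)) l0"
    "has_weak_time_deriv T V (\<lambda>t. b (p t)) (\<lambda>t v. F t v - c * a (p t) v)"
    "(\<lambda>t v. F t v - c * a (p t) v) \<in> L2t I V' N'"
proof -
  obtain p where p: "p \<in> L2t I V N" and
    weak: "\<And>v \<psi> \<psi>'. \<lbrakk>v \<in> V; \<And>x. (\<psi> has_real_derivative \<psi>' x) (at x); \<And>x. isCont \<psi>' x; \<psi> T = 0\<rbrakk> \<Longrightarrow>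
      - (LINT t|I. \<psi>' t * b (p t) v) + c * (LINT t|I. \<psi> t * a (p t) v) = (LINT t|I. \<psi> t * F t v) + \<psi> 0 * l0 v"
    using weak_form_solution[OF F F.dual_add[OF l0] F.dual_scale[OF l0] l0_bound] by blast
  define D where "D t v = F t v - c * a (p t) v" for t v
  have aL: "(\<lambda>t. a (p t)) \<in> L2t I V' N'" and bL: "(\<lambda>t. b (p t)) \<in> L2t I V' N'"
    using bounded_form_L2t[OF bounded_forms(2) p] bounded_form_L2t[OF bounded_forms(1) p] by auto
  have "(\<lambda>t. F t - c *\<^sub>R a (p t)) \<in> L2t I V' N'"
    by (rule I.L2t_diff[OF F.seminormed_dual F I.L2t_scale[OF F.seminormed_dual aL]])
  moreover have "(\<lambda>t. F t - c *\<^sub>R a (p t)) = D" by (simp add: fun_eq_iff D_def)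
  ultimately have D: "D \<in> L2t I V' N'" by simp
  have weakD: "(LINT t|I. \<psi>' t * b (p t) v) = - (LINT t|I. \<psi> t * D t v) - \<psi> 0 * l0 v"
    if v: "v \<in> V" and d: "\<And>x. (\<psi> has_real_derivative \<psi>' x) (at x)" "\<And>x. isCont \<psi>' x" "\<psi> T = 0" for v \<psi> \<psi>'
  proof -
    have c\<psi>: "continuous_on UNIV \<psi>" using DERIV_isCont[OF d(1)] by (auto simp: continuous_on_eq_continuous_at)
    have "(LINT t|I. \<psi> t * D t v) = (LINT t|I. \<psi> t * F t v - c * (\<psi> t * a (p t) v))"
      unfolding D_def by (simp add: algebra_simps)
    also have "\<dots> = (LINT t|I. \<psi> t * F t v) - c * (LINT t|I. \<psi> t * a (p t) v)"
      using integrable_time_continuous_mult[OF dual_eval_integrable[OF F v] c\<psi>]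
        integrable_time_continuous_mult[OF dual_eval_integrable[OF aL v] c\<psi>] by simp
    finally show ?thesis using weak[OF v d] by simp
  qed
  define G where "G t v = l0 v + running T (\<lambda>s. D s v) t" for t v
  have G: "G t \<in> V'" "((\<lambda>s. N' (G s - G t)) \<longlongrightarrow> 0) (at t within {0..T})" for t
    unfolding G_def using primitive_dual[OF D l0] by auto
  have eq: "AE t in I. b (p t) v - G t v = 0" if v: "v \<in> V" for v
  proof (rule AE_zero_of_continuous[OF T])
    note iD = dual_eval_integrable[OF D v]
    have cr: "continuous_on UNIV (running T (\<lambda>s. D s v))"
      using continuous_running[OF iD] by (simp add: continuous_on_eq_continuous_at)
    have ir: "integrable I (running T (\<lambda>s. D s v))"
      using integrable_time_continuous_mult[OF I.integrable_const[of 1] cr] by simp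
    have ib: "integrable I (\<lambda>t. b (p t) v)" by (rule dual_eval_integrable[OF bL v])
    show "integrable I (\<lambda>t. b (p t) v - G t v)" unfolding G_def using ib ir by simp
    fix f :: "real \<Rightarrow> real" assume f: "continuous_on UNIV f"
    then have fc: "isCont f x" for x by (simp add: continuous_on_eq_continuous_at)
    obtain P where P: "\<And>x. (P has_real_derivative f x) (at x)"
      using einterval_antiderivative[of "-\<infinity>" "\<infinity>" f] fc
      by (auto simp: has_real_derivative_iff_has_vector_derivative)
    \<comment> \<open>Every continuous \<open>f\<close> is the derivative of an admissible
      \<open>\<psi>\<close>, the primitive normalised to vanish at \<open>T\<close>; the integral of
      \<open>f\<close> is then \<open>- \<psi> 0\<close>, which matches the initial term.\<close>
    define \<psi> where "\<psi> x = P x - P T" for x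
    have d: "(\<psi> has_real_derivative f x) (at x)" for x
      unfolding \<psi>_def by (rule DERIV_cong[OF DERIV_diff[OF P DERIV_const]]) simp
    have \<psi>T: "\<psi> T = 0" by (simp add: \<psi>_def)
    have i1: "integrable I (\<lambda>t. f t * b (p t) v)" by (rule integrable_time_continuous_mult[OF ib f])
    have i2: "integrable I (\<lambda>t. f t * running T (\<lambda>s. D s v) t)" by (rule integrable_time_continuous_mult[OF ir f])
    have i3: "integrable I (\<lambda>t. f t * l0 v)" by (rule integrable_time_continuous_mult[OF I.integrable_const f])
    have "(LINT t|I. f t) = \<psi> T - \<psi> 0"
    proof -
      have "(LINT t|I. f t) = (LINT t|I. f t * indicator {0<..} t)" by (rule Bochner_Integration.integral_cong) auto
      also have "\<dots> = \<psi> T - \<psi> 0" using T by (intro integral_time_FTC d fc) auto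
      finally show ?thesis .
    qed
    then have l: "(LINT t|I. f t * l0 v) = - \<psi> 0 * l0 v" using \<psi>T by simp
    have r: "(LINT t|I. f t * running T (\<lambda>s. D s v) t) = - (LINT t|I. \<psi> t * D t v)"
      using integral_running_by_parts[OF T iD d fc] \<psi>T by simp
    have "(LINT t|I. f t * (b (p t) v - G t v)) = (LINT t|I. f t * b (p t) v - f t * l0 v - f t * running T (\<lambda>s. D s v) t)"
      by (simp add: G_def algebra_simps)
    also have "\<dots> = (LINT t|I. f t * b (p t) v) - (LINT t|I. f t * l0 v) - (LINT t|I. f t * running T (\<lambda>s. D s v) t)"
      using i1 i2 i3 by (simp only: Bochner_Integration.integral_diff Bochner_Integration.integrable_diff)
    also have "\<dots> = 0" unfolding l r weakD[OF v d fc \<psi>T] by simp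
    finally show "(LINT t|I. f t * (b (p t) v - G t v)) = 0" .
  qed
  \<comment> \<open>So far the exceptional null set depends on \<open>v\<close>. Strong
    measurability of \<open>G\<close> and \<open>b (p t)\<close> makes it common to all
    \<open>v\<close>.\<close>
  have smG: "strongly_measurable I V' N' G" by (rule continuous_dual_strongly_measurable[OF G])
  have "strongly_measurable I V' N' (\<lambda>t. b (p t) + (-1) *\<^sub>R G t)"
    using bL smG by (intro strongly_measurable_add strongly_measurable_scale F.seminormed_dual) (simp add: L2t_def)
  moreover have "AE t in I. (b (p t) + (-1) *\<^sub>R G t) v = 0" if "v \<in> V" for v
    using eq[OF that] by eventually_elim simp
  ultimately have "AE t in I. \<forall>v\<in>V. (b (p t) + (-1) *\<^sub>R G t) v = 0"
    by (rule F.AE_zero_dual)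
  then have GF: "AE t in I. \<forall>v\<in>V. G t v = b (p t) v" by eventually_elim simp
  show thesis
  proof (rule that[OF p])
    show "has_initial_value T V N (\<lambda>t. b (p t)) l0"
      unfolding has_initial_value_def
    proof (intro exI[of _ G] conjI ballI)
      show "((\<lambda>s. N' (\<lambda>v. G s v - G t v)) \<longlongrightarrow> 0) (at t within {0..T})" for t
        using G(2)[of t] unfolding fun_diff_def .
      show "G 0 v = l0 v" for v by (simp add: G_def running_0)
    qed (use G GF in auto)
    show "has_weak_time_deriv T V (\<lambda>t. b (p t)) (\<lambda>t v. F t v - c * a (p t) v)"
      unfolding has_weak_time_deriv_def D_def[symmetric]
    proof (intro allI impI ballI)
      fix \<psi> v assume \<psi>: "test_function T \<psi>" and v: "v \<in> V"
      have z: "\<psi> T = 0" "\<psi> 0 = 0" using test_function_deriv(3)[OF \<psi>] by auto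
      show "(LINT t|I. deriv \<psi> t * b (p t) v) = - (LINT t|I. \<psi> t * D t v)"
        using weakD[OF v test_function_deriv(1,2)[OF \<psi>] z(1)] z(2) by simp
    qed
    have "(\<lambda>t v. F t v - c * a (p t) v) = D" by (simp add: fun_eq_iff D_def)
    then show "(\<lambda>t v. F t v - c * a (p t) v) \<in> L2t I V' N'" using D by simp
  qed
qed

text \<open>The weak derivative determines \<open>b (p t) v\<close> up to a constant, by du
  Bois-Reymond for the continuous representative, and the initial value fixes the constant. Pairing
  the equation with \<open>v\<close> cut off at time \<open>t\<close> replaces the primitive of
  \<open>D\<close> by those of \<open>F\<close> and \<open>a (p t)\<close>.\<close>

lemma integrated_equation:
  assumes p: "p \<in> L2t I V N" and F: "F \<in> L2t I V' N'" and D: "D \<in> L2t I V' N'"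
    and init: "has_initial_value T V N (\<lambda>t. b (p t)) l0"
    and deriv: "has_weak_time_deriv T V (\<lambda>t. b (p t)) D"
    and eq: "\<And>q. q \<in> L2t I V N \<Longrightarrow> (LINT t|I. D t (q t)) + c * (LINT t|I. a (p t) (q t)) = (LINT t|I. F t (q t))"
    and v: "v \<in> V"
  shows "AE t in I. b (p t) v + c * running T (\<lambda>s. a (p s) v) t = l0 v + running T (\<lambda>s. F s v) t"
proof -
  obtain G where G: "\<And>t. t \<in> {0..T} \<Longrightarrow> G t \<in> V'"
    "\<And>t. t \<in> {0..T} \<Longrightarrow> ((\<lambda>s. N' (\<lambda>v. G s v - G t v)) \<longlongrightarrow> 0) (at t within {0..T})"
    "AE t in I. \<forall>v\<in>V. G t v = b (p t) v" "\<And>v. v \<in> V \<Longrightarrow> G 0 v = l0 v"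
    using init unfolding has_initial_value_def by blast
  have aL: "(\<lambda>t. a (p t)) \<in> L2t I V' N'" and bL: "(\<lambda>t. b (p t)) \<in> L2t I V' N'"
    using bounded_form_L2t[OF bounded_forms(2) p] bounded_form_L2t[OF bounded_forms(1) p] by auto
  note iD = dual_eval_integrable[OF D v]
  note ia = dual_eval_integrable[OF aL v]
  note iF = dual_eval_integrable[OF F v]
  note ib = dual_eval_integrable[OF bL v]
  have sub: "running T (\<lambda>s. D s v) t + c * running T (\<lambda>s. a (p s) v) t = running T (\<lambda>s. F s v) t" for t
  proof -
    \<comment> \<open>The vector \<open>v\<close> switched off at time \<open>t\<close>. It is a
      simple function of time, so it may be inserted for \<open>q\<close> and turns the space-time
      identity into one between primitives at \<open>t\<close>.\<close>
    define q where "q s = (indicator {..<t} s :: real) *\<^sub>R v" for s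
    have s: "simple_function I (\<lambda>s. indicator {..<t} s :: real)"
    proof (rule simple_function_borel_measurable)
      show "(\<lambda>s. indicator {..<t} s :: real) \<in> borel_measurable I" by (rule borel_measurable_time) simp
      have "(\<lambda>s. indicator {..<t} s :: real) ` space I \<subseteq> {0, 1}" by (auto simp: indicator_def)
      then show "finite ((\<lambda>s. indicator {..<t} s :: real) ` space I)" by (rule finite_subset) simp
    qed
    have sq: "simple_function I q" unfolding q_def by (rule simple_function_compose1[OF s])
    have qV: "q s \<in> V" for s unfolding q_def by (rule F.mem(4)[OF v])
    have z: "N (q s - q s) = 0" for s unfolding diff_self by (rule F.zero)
    have "unif_approx q"
      unfolding unif_approx_def
    proof (intro conjI allI impI exI[of _ q] ballI)
      show "N (q s - q s) \<le> e" if "0 < e" for e s using that unfolding z by simp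
    qed (use sq qV in auto)
    then have q: "q \<in> L2t I V N" by (rule unif_approx_L2t)
    have pair: "(LINT s|I. E s (q s)) = running T (\<lambda>s. E s v) t" if E: "E \<in> L2t I V' N'" for E
      unfolding running_def
    proof (rule integral_cong_AE)
      show "(\<lambda>s. E s (q s)) \<in> borel_measurable I"
        by (rule borel_measurable_integrable[OF F.pairing_bound(1)[OF complete_time E q]])
      show "(\<lambda>s. indicator {..<t} s * E s v) \<in> borel_measurable I"
        by (rule borel_measurable_integrable[OF integrable_running[OF dual_eval_integrable[OF E v]]])
      show "AE s in I. E s (q s) = indicator {..<t} s * E s v"
        using L2t_AE[OF E] by eventually_elim (simp only: q_def F.dual_scale v)
    qed
    show ?thesis using eq[OF q] unfolding pair[OF D] pair[OF aL] pair[OF F] .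
  qed
  define H where "H t = G t v - running T (\<lambda>s. D s v) t" for t
  have Gc: "continuous_on {0..T} (\<lambda>t. G t v)"
    unfolding continuous_on_def
  proof (intro ballI)
    fix t assume t: "t \<in> {0..T}"
    have e: "\<forall>\<^sub>F s in at t within {0..T}. norm (G s v - G t v) \<le> N' (\<lambda>v. G s v - G t v) * N v"
      unfolding eventually_at_filter
    proof (intro always_eventually allI impI)
      fix s assume "s \<in> {0..T}"
      then show "norm (G s v - G t v) \<le> N' (\<lambda>v. G s v - G t v) * N v"
        using F.dual_le[OF F.dual.mem(3)[OF G(1) G(1)] v, of s t] t by (simp add: fun_diff_def)
    qed
    have "((\<lambda>s. N' (\<lambda>v. G s v - G t v) * N v) \<longlongrightarrow> 0) (at t within {0..T})"
      by (rule tendsto_mult_left_zero[OF G(2)[OF t]])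
    from Lim_null_comparison[OF e this] show "((\<lambda>t. G t v) \<longlongrightarrow> G t v) (at t within {0..T})"
      by (simp add: LIM_zero_iff)
  qed
  have Dc: "continuous_on UNIV (running T (\<lambda>s. D s v))"
    using continuous_running[OF iD] by (simp add: continuous_on_eq_continuous_at)
  have Hc: "continuous_on {0..T} H"
    unfolding H_def by (intro continuous_on_diff Gc continuous_on_subset[OF Dc]) simp
  have GF: "AE t in I. b (p t) v = G t v" using G(3) v by (auto elim!: eventually_mono)
  have Hconst: "H r = H 0" if "r \<in> {0..T}" for r
  proof (rule du_Bois_Reymond[OF T Hc _ that])
    fix \<psi> assume \<psi>: "test_function T \<psi>"
    have z: "\<psi> T = 0" using test_function_deriv(3)[OF \<psi>] by auto
    have cd: "continuous_on UNIV (deriv \<psi>)"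
      using test_function_deriv(2)[OF \<psi>] by (simp add: continuous_on_eq_continuous_at)
    have ir: "integrable I (running T (\<lambda>s. D s v))"
      using integrable_time_continuous_mult[OF I.integrable_const[of 1] Dc] by simp
    have i1: "integrable I (\<lambda>t. deriv \<psi> t * b (p t) v)" by (rule integrable_time_continuous_mult[OF ib cd])
    have i2: "integrable I (\<lambda>t. deriv \<psi> t * running T (\<lambda>s. D s v) t)" by (rule integrable_time_continuous_mult[OF ir cd])
    have ae: "AE t in I. deriv \<psi> t * b (p t) v - deriv \<psi> t * running T (\<lambda>s. D s v) t = deriv \<psi> t * H t"
      using GF by eventually_elim (simp add: H_def right_diff_distrib)
    have m: "(\<lambda>t. deriv \<psi> t * b (p t) v - deriv \<psi> t * running T (\<lambda>s. D s v) t) \<in> borel_measurable I"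
      using i1 i2 by (intro borel_measurable_integrable Bochner_Integration.integrable_diff)
    have "(LINT t|I. deriv \<psi> t * H t) = (LINT t|I. deriv \<psi> t * b (p t) v - deriv \<psi> t * running T (\<lambda>s. D s v) t)"
      by (rule integral_cong_AE[symmetric, OF m I.borel_measurable_AE_cong[OF m ae] ae])
    also have "\<dots> = (LINT t|I. deriv \<psi> t * b (p t) v) - (LINT t|I. deriv \<psi> t * running T (\<lambda>s. D s v) t)"
      using i1 i2 by simp
    also have "(LINT t|I. deriv \<psi> t * b (p t) v) = - (LINT t|I. \<psi> t * D t v)"
      using deriv \<psi> v unfolding has_weak_time_deriv_def by blast
    also have "(LINT t|I. deriv \<psi> t * running T (\<lambda>s. D s v) t) = - (LINT t|I. \<psi> t * D t v)"
      using integral_running_by_parts[OF T iD test_function_deriv(1,2)[OF \<psi>]] z by simp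
    finally show "(LINT t|I. deriv \<psi> t * H t) = 0" by simp
  qed
  show ?thesis
    using GF AE_space[of I]
  proof eventually_elim
    fix t assume 1: "b (p t) v = G t v" and "t \<in> space I"
    then have "H t = H 0" by (intro Hconst) auto
    then have "G t v = l0 v + running T (\<lambda>s. D s v) t"
      using G(4)[OF v] running_0[of T "\<lambda>s. D s v"] unfolding H_def by linarith
    then show "b (p t) v + c * running T (\<lambda>s. a (p s) v) t = l0 v + running T (\<lambda>s. F s v) t"
      using 1 sub[of t] by linarith
  qed
qed

end

section \<open>Uniqueness\<close>

context parabolic
begin

text \<open>For the double integral in \<open>memory_term_nonneg\<close>, joint measurability on the
  square of the time interval is obtained as a limit of simple functions at every pair of times. An
  almost everywhere limit would not do, so function and approximants are set to 0 on a null
  set.\<close>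

lemma everywhere_representative:
  assumes p: "p \<in> L2t I V N"
  obtains r s where "r \<in> L2t I V N" "AE t in I. p t = r t" "\<And>t. t \<in> space I \<Longrightarrow> r t \<in> V"
    "\<And>k. simple_function I (s k)" "\<And>k t. t \<in> space I \<Longrightarrow> s k t \<in> V"
    "\<And>t. t \<in> space I \<Longrightarrow> (\<lambda>k. N (s k t - r t)) \<longlonglongrightarrow> 0"
proof -
  have "\<exists>s. approx I V N s p" using p by (simp add: L2t_def strongly_measurable_iff)
  then obtain s where s: "approx I V N s p" ..
  define good where "good t \<longleftrightarrow> p t \<in> V \<and> (\<lambda>k. N (s k t - p t)) \<longlonglongrightarrow> 0" for t
  have "AE t in I. good t" using approxE[OF s] by eventually_elim (simp add: good_def)
  then have "\<exists>B\<in>null_sets I. {t \<in> space I. \<not> good t} \<subseteq> B" unfolding eventually_ae_filter .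
  then obtain B where B: "B \<in> null_sets I" and "{t \<in> space I. \<not> good t} \<subseteq> B" by blast
  then have good: "p t \<in> V" "(\<lambda>k. N (s k t - p t)) \<longlonglongrightarrow> 0" if "t \<in> space I" "t \<notin> B" for t
    using that by (auto simp: good_def)
  define r where "r t = (if t \<in> B then 0 else p t)" for t
  define q where "q k t = (if t \<in> B then 0 else s k t)" for k t
  have ae: "AE t in I. p t = r t" by (rule AE_I'[OF B]) (auto simp: r_def)
  show thesis
  proof (rule that)
    show "r \<in> L2t I V N" by (rule L2t_cong_AE[OF p ae complete_time F.seminormed_axioms])
    show "AE t in I. p t = r t" by (rule ae)
    show "r t \<in> V" if "t \<in> space I" for t using good[OF that] by (simp add: r_def)
    show "simple_function I (q k)" for k
      unfolding q_def
    proof (rule simple_function_If)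
      show "simple_function I (\<lambda>t. 0 :: 'x \<Rightarrow> real)" by (rule simple_function_const)
      show "simple_function I (s k)" by (rule approxD(1)[OF s])
      have "{t \<in> space I. t \<in> B} = B" using sets.sets_into_space[OF null_setsD2[OF B]] by blast
      then show "{t \<in> space I. t \<in> B} \<in> sets I" using B by auto
    qed
    show "q k t \<in> V" if "t \<in> space I" for k t using approxD(2)[OF s that] by (simp add: q_def)
    show "(\<lambda>k. N (q k t - r t)) \<longlonglongrightarrow> 0" if t: "t \<in> space I" for t
    proof (cases "t \<in> B")
      case True
      have 0: "N (q k t - r t) = 0" for k unfolding q_def r_def if_P[OF True] diff_self by (rule F.zero)
      show ?thesis unfolding 0 by (rule tendsto_const)
    next
      case False
      then show ?thesis unfolding q_def r_def if_not_P[OF False] by (rule good(2)[OF t])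
    qed
  qed
qed

text \<open>\<open>P\<close> stands for the integral of \<open>p\<close> over \<open>(0, T)\<close>;
  the Riesz theorem produces it from its pairings with \<open>ip\<close>. The identity passes to
  \<open>a\<close> because \<open>a u v = ip u (A v)\<close> for the map \<open>A\<close> that
  represents \<open>a\<close>.\<close>

lemma weak_integral:
  assumes p: "p \<in> L2t I V N"
  obtains P where "P \<in> V" "\<And>v. v \<in> V \<Longrightarrow> a P v = (LINT t|I. a (p t) v)"
proof -
  have ipL: "(\<lambda>t. ip (p t)) \<in> L2t I V' N'" by (rule bounded_form_L2t[OF bounded_forms(3) p])
  note ii = dual_eval_integrable[OF ipL]
  have ae: "AE t in I. p t \<in> V" by (rule L2t_AE[OF p])
  obtain P where P: "P \<in> V" "\<And>v. v \<in> V \<Longrightarrow> ip P v = (LINT t|I. ip (p t) v)"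
  proof (rule H.Riesz[of "\<lambda>v. LINT t|I. ip (p t) v" "LINT t|I. N (p t)"])
    fix u assume u: "u \<in> V"
    { fix v assume v: "v \<in> V"
      have "(LINT t|I. ip (p t) (u + v)) = (LINT t|I. ip (p t) u + ip (p t) v)"
      proof (rule integral_cong_AE)
        show "AE t in I. ip (p t) (u + v) = ip (p t) u + ip (p t) v" using ae by eventually_elim (simp add: H.add_right u v)
        show "(\<lambda>t. ip (p t) (u + v)) \<in> borel_measurable I" by (rule borel_measurable_integrable[OF ii[OF F.mem(2)[OF u v]]])
        show "(\<lambda>t. ip (p t) u + ip (p t) v) \<in> borel_measurable I"
          by (rule borel_measurable_integrable[OF Bochner_Integration.integrable_add[OF ii[OF u] ii[OF v]]])
      qed
      then show "(LINT t|I. ip (p t) (u + v)) = (LINT t|I. ip (p t) u) + (LINT t|I. ip (p t) v)"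
        using ii[OF u] ii[OF v] by simp }
    show "(LINT t|I. ip (p t) (d *\<^sub>R u)) = d * (LINT t|I. ip (p t) u)" for d
    proof -
      have "(LINT t|I. ip (p t) (d *\<^sub>R u)) = (LINT t|I. d * ip (p t) u)"
      proof (rule integral_cong_AE)
        show "AE t in I. ip (p t) (d *\<^sub>R u) = d * ip (p t) u" using ae by eventually_elim (simp add: H.scale_right u)
        show "(\<lambda>t. ip (p t) (d *\<^sub>R u)) \<in> borel_measurable I" by (rule borel_measurable_integrable[OF ii[OF F.mem(4)[OF u]]])
        show "(\<lambda>t. d * ip (p t) u) \<in> borel_measurable I"
          using borel_measurable_integrable[OF ii[OF u]] by simp
      qed
      then show ?thesis by simp
    qed
    have "(\<lambda>t. N (p t)) \<in> sqint I" by (rule I.L2t_sqint[OF F.seminormed_axioms p])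
    moreover have "(\<lambda>t. 1) \<in> sqint I" by (simp add: sqint_def)
    ultimately have iN: "integrable I (\<lambda>t. N (p t))" using sqint_integrable_mult[of "\<lambda>t. N (p t)" I "\<lambda>t. 1"] by simp
    have "\<bar>LINT t|I. ip (p t) u\<bar> \<le> (LINT t|I. \<bar>ip (p t) u\<bar>)" by (rule integral_abs_bound)
    also have "\<dots> \<le> (LINT t|I. N (p t) * N u)"
    proof (rule integral_mono_AE)
      show "AE t in I. \<bar>ip (p t) u\<bar> \<le> N (p t) * N u" using ae by eventually_elim (rule bounded_form_le[OF bounded_forms(3) _ u])
    qed (use ii[OF u] iN in auto)
    finally show "\<bar>LINT t|I. ip (p t) u\<bar> \<le> (LINT t|I. N (p t)) * sqrt (ip u u)" by (simp add: N_eq)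
  qed blast
  obtain A where A: "\<And>u. u \<in> V \<Longrightarrow> A u \<in> V" "\<And>u v. u \<in> V \<Longrightarrow> v \<in> V \<Longrightarrow> ip (A u) v = a u v"
    using bounded_form_representation[OF bounded_forms(2)] by metis
  have A': "ip u (A v) = a u v" if "u \<in> V" "v \<in> V" for u v
    using A(2)[OF that(2,1)] H.commute[OF that(1) A(1)[OF that(2)]] a.commute[OF that] by simp
  show thesis
  proof (rule that[OF P(1)])
    fix v assume v: "v \<in> V"
    have "a P v = (LINT t|I. ip (p t) (A v))" using A'[OF P(1) v] P(2)[OF A(1)[OF v]] by simp
    also have "\<dots> = (LINT t|I. a (p t) v)"
    proof (rule integral_cong_AE)
      show "AE t in I. ip (p t) (A v) = a (p t) v" using ae by eventually_elim (rule A'[OF _ v])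
      show "(\<lambda>t. ip (p t) (A v)) \<in> borel_measurable I" by (rule borel_measurable_integrable[OF ii[OF A(1)[OF v]]])
      show "(\<lambda>t. a (p t) v) \<in> borel_measurable I"
        by (rule borel_measurable_integrable[OF dual_eval_integrable[OF bounded_form_L2t[OF bounded_forms(2) p] v]])
    qed
    finally show "a P v = (LINT t|I. a (p t) v)" .
  qed
qed

lemma memory_term_nonneg:
  assumes p: "p \<in> L2t I V N" and pV: "\<And>t. t \<in> space I \<Longrightarrow> p t \<in> V"
    and s: "\<And>k. simple_function I (s k)" "\<And>k t. t \<in> space I \<Longrightarrow> s k t \<in> V"
    and lim: "\<And>t. t \<in> space I \<Longrightarrow> (\<lambda>k. N (s k t - p t)) \<longlonglongrightarrow> 0"
  shows "integrable I (\<lambda>t. running T (\<lambda>r. a (p r) (p t)) t)"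
    "0 \<le> (LINT t|I. running T (\<lambda>r. a (p r) (p t)) t)"
proof -
  interpret P: pair_sigma_finite I I ..
  define h where "h z = a (p (fst z)) (p (snd z))" for z :: "real \<times> real"
  have hm: "h \<in> borel_measurable (I \<Otimes>\<^sub>M I)"
  proof (rule borel_measurable_LIMSEQ_metric)
    fix k
    have 1: "simple_function (I \<Otimes>\<^sub>M I) (\<lambda>z. s k (fst z))"
      using s(1)[of k] unfolding simple_function_def
    proof (elim conjE, intro conjI ballI)
      assume f: "finite (s k ` space I)" and m: "\<forall>x\<in>s k ` space I. s k -` {x} \<inter> space I \<in> sets I"
      show "finite ((\<lambda>z. s k (fst z)) ` space (I \<Otimes>\<^sub>M I))"
        by (rule finite_subset[OF _ f]) (auto simp: space_pair_measure)
      fix x assume "x \<in> (\<lambda>z. s k (fst z)) ` space (I \<Otimes>\<^sub>M I)"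
      then have "x \<in> s k ` space I" by (auto simp: space_pair_measure)
      then have "s k -` {x} \<inter> space I \<in> sets I" using m by blast
      from measurable_sets[OF measurable_fst this]
      have "fst -` (s k -` {x} \<inter> space I) \<inter> space (I \<Otimes>\<^sub>M I) \<in> sets (I \<Otimes>\<^sub>M I)" .
      moreover have "fst -` (s k -` {x} \<inter> space I) \<inter> space (I \<Otimes>\<^sub>M I) = (\<lambda>z. s k (fst z)) -` {x} \<inter> space (I \<Otimes>\<^sub>M I)"
        by (auto simp: space_pair_measure)
      ultimately show "(\<lambda>z. s k (fst z)) -` {x} \<inter> space (I \<Otimes>\<^sub>M I) \<in> sets (I \<Otimes>\<^sub>M I)" by simp
    qed
    have 2: "simple_function (I \<Otimes>\<^sub>M I) (\<lambda>z. s k (snd z))"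
      using s(1)[of k] unfolding simple_function_def
    proof (elim conjE, intro conjI ballI)
      assume f: "finite (s k ` space I)" and m: "\<forall>x\<in>s k ` space I. s k -` {x} \<inter> space I \<in> sets I"
      show "finite ((\<lambda>z. s k (snd z)) ` space (I \<Otimes>\<^sub>M I))"
        by (rule finite_subset[OF _ f]) (auto simp: space_pair_measure)
      fix x assume "x \<in> (\<lambda>z. s k (snd z)) ` space (I \<Otimes>\<^sub>M I)"
      then have "x \<in> s k ` space I" by (auto simp: space_pair_measure)
      then have "s k -` {x} \<inter> space I \<in> sets I" using m by blast
      from measurable_sets[OF measurable_snd this]
      have "snd -` (s k -` {x} \<inter> space I) \<inter> space (I \<Otimes>\<^sub>M I) \<in> sets (I \<Otimes>\<^sub>M I)" .
      moreover have "snd -` (s k -` {x} \<inter> space I) \<inter> space (I \<Otimes>\<^sub>M I) = (\<lambda>z. s k (snd z)) -` {x} \<inter> space (I \<Otimes>\<^sub>M I)"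
        by (auto simp: space_pair_measure)
      ultimately show "(\<lambda>z. s k (snd z)) -` {x} \<inter> space (I \<Otimes>\<^sub>M I) \<in> sets (I \<Otimes>\<^sub>M I)" by simp
    qed
    show "(\<lambda>z. a (s k (fst z)) (s k (snd z))) \<in> borel_measurable (I \<Otimes>\<^sub>M I)"
      by (rule borel_measurable_simple_function[OF simple_function_compose2[OF 1 2, of a]])
  next
    fix z assume "z \<in> space (I \<Otimes>\<^sub>M I)"
    then have z: "fst z \<in> space I" "snd z \<in> space I" by (auto simp: space_pair_measure)
    have "(\<lambda>k. N' (a (s k (fst z)) - a (p (fst z)))) \<longlonglongrightarrow> 0"
    proof (rule squeeze_zero[OF lim[OF z(1)]])
      fix k
      have "0 \<le> N' (a (s k (fst z)) - a (p (fst z)))"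
        by (rule F.dual.nonneg[OF F.dual.mem(3)[OF bounded_form_dual(1)[OF bounded_forms(2) s(2)[OF z(1)]] bounded_form_dual(1)[OF bounded_forms(2) pV[OF z(1)]]]])
      then show "\<bar>N' (a (s k (fst z)) - a (p (fst z)))\<bar> \<le> N (s k (fst z) - p (fst z))"
        using bounded_form_dual_diff[OF bounded_forms(2) s(2)[OF z(1), of k] pV[OF z(1)]] by simp
    qed
    from F.dual_pairing_tendsto[of "a (p (fst z))" "p (snd z)" "\<lambda>k. a (s k (fst z))" "\<lambda>k. s k (snd z)",
        OF bounded_form_dual(1)[OF bounded_forms(2) pV[OF z(1)]] pV[OF z(2)]
        bounded_form_dual(1)[OF bounded_forms(2) s(2)[OF z(1)]] s(2)[OF z(2)] this lim[OF z(2)]]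
    show "(\<lambda>k. a (s k (fst z)) (s k (snd z))) \<longlonglongrightarrow> h z" unfolding h_def .
  qed
  have Nm: "(\<lambda>t. N (p t)) \<in> borel_measurable I"
    using p by (intro I.norm_measurable[OF F.seminormed_axioms]) (simp add: L2t_def)
  have "(\<lambda>t. N (p t)) \<in> sqint I" by (rule I.L2t_sqint[OF F.seminormed_axioms p])
  moreover have "(\<lambda>t. 1) \<in> sqint I" by (simp add: sqint_def)
  ultimately have iN: "integrable I (\<lambda>t. N (p t))" using sqint_integrable_mult[of "\<lambda>t. N (p t)" I "\<lambda>t. 1"] by simp
  have N0: "0 \<le> N (p t)" if "t \<in> space I" for t by (rule F.nonneg[OF pV[OF that]])
  have bint: "integrable (I \<Otimes>\<^sub>M I) (\<lambda>z. N (p (fst z)) * N (p (snd z)))"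
  proof (rule P.Fubini_integrable)
    show "(\<lambda>z. N (p (fst z)) * N (p (snd z))) \<in> borel_measurable (I \<Otimes>\<^sub>M I)"
      by (intro borel_measurable_times measurable_compose[OF measurable_fst Nm] measurable_compose[OF measurable_snd Nm])
    show "integrable I (\<lambda>r. LINT t|I. norm (N (p (fst (r, t))) * N (p (snd (r, t)))))"
      using iN by (simp add: abs_mult)
    show "AE r in I. integrable I (\<lambda>t. N (p (fst (r, t))) * N (p (snd (r, t))))" using iN by simp
  qed
  have dom: "integrable (I \<Otimes>\<^sub>M I) f" if fm: "f \<in> borel_measurable (I \<Otimes>\<^sub>M I)" and le: "\<And>z. \<bar>f z\<bar> \<le> \<bar>h z\<bar>" for f
  proof (rule Bochner_Integration.integrable_bound[OF bint fm AE_I2])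
    fix z assume "z \<in> space (I \<Otimes>\<^sub>M I)"
    then have z: "fst z \<in> space I" "snd z \<in> space I" by (auto simp: space_pair_measure)
    have "\<bar>h z\<bar> \<le> N (p (fst z)) * N (p (snd z))" unfolding h_def by (rule bounded_form_le[OF bounded_forms(2) pV[OF z(1)] pV[OF z(2)]])
    then show "norm (f z) \<le> norm (N (p (fst z)) * N (p (snd z)))" using le[of z] by simp
  qed
  \<comment> \<open>The two open triangles of the square. Exchanging the variables maps one to the
    other by symmetry of \<open>a\<close>, and the diagonal is null, so each carries half of the
    integral over the square, which is \<open>a W W\<close> for the weak integral \<open>W\<close>
    of \<open>p\<close>.\<close>
  define f1 where "f1 z = (if fst z < snd z then 1 else 0) * h z" for z
  define f2 where "f2 z = (if snd z < fst z then 1 else 0) * h z" for z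
  have m1: "f1 \<in> borel_measurable (I \<Otimes>\<^sub>M I)" unfolding f1_def using hm by measurable
  have m2: "f2 \<in> borel_measurable (I \<Otimes>\<^sub>M I)" unfolding f2_def using hm by measurable
  have i1: "integrable (I \<Otimes>\<^sub>M I) f1" by (rule dom[OF m1]) (simp add: f1_def)
  have i2: "integrable (I \<Otimes>\<^sub>M I) f2" by (rule dom[OF m2]) (simp add: f2_def)
  have ih: "integrable (I \<Otimes>\<^sub>M I) h" by (rule dom[OF hm]) simp
  have run: "running T (\<lambda>r. a (p r) (p t)) t = (LINT r|I. f1 (r, t))" for t
    unfolding running_def f1_def h_def by (intro Bochner_Integration.integral_cong refl) (simp add: indicator_def)
  have snd1: "integrable I (\<lambda>t. LINT r|I. f1 (r, t))" "(LINT t|I. LINT r|I. f1 (r, t)) = integral\<^sup>L (I \<Otimes>\<^sub>M I) f1"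
    using P.integrable_snd[of "\<lambda>r t. f1 (r, t)"] P.integral_snd[of "\<lambda>r t. f1 (r, t)"] i1 by auto
  show "integrable I (\<lambda>t. running T (\<lambda>r. a (p r) (p t)) t)" unfolding run by (rule snd1(1))
  have swap: "integral\<^sup>L (I \<Otimes>\<^sub>M I) f2 = integral\<^sup>L (I \<Otimes>\<^sub>M I) f1"
  proof -
    have "integral\<^sup>L (I \<Otimes>\<^sub>M I) f2 = (LINT z|(I \<Otimes>\<^sub>M I). (case z of (x, y) \<Rightarrow> f2 (y, x)))"
      by (rule P.integral_product_swap[OF m2, symmetric])
    also have "\<dots> = integral\<^sup>L (I \<Otimes>\<^sub>M I) f1"
    proof (rule Bochner_Integration.integral_cong[OF refl])
      fix z assume "z \<in> space (I \<Otimes>\<^sub>M I)"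
      then have z: "fst z \<in> space I" "snd z \<in> space I" by (auto simp: space_pair_measure)
      show "(case z of (x, y) \<Rightarrow> f2 (y, x)) = f1 z"
        using a.commute[OF pV[OF z(1)] pV[OF z(2)]] by (simp add: f1_def f2_def h_def split_beta)
    qed
    finally show ?thesis .
  qed
  have "integral\<^sup>L (I \<Otimes>\<^sub>M I) f1 + integral\<^sup>L (I \<Otimes>\<^sub>M I) f2 = (LINT z|(I \<Otimes>\<^sub>M I). f1 z + f2 z)"
    using i1 i2 by simp
  also have "\<dots> = integral\<^sup>L (I \<Otimes>\<^sub>M I) h"
  proof (rule integral_cong_AE)
    have "AE r in I. AE t in I. t \<noteq> r" by (intro AE_I2 AE_time_neq)
    moreover have "{z \<in> space (I \<Otimes>\<^sub>M I). snd z \<noteq> fst z} \<in> sets (I \<Otimes>\<^sub>M I)" by measurable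
    ultimately have "AE z in I \<Otimes>\<^sub>M I. snd z \<noteq> fst z" by (intro P.AE_pair_measure) auto
    then show "AE z in I \<Otimes>\<^sub>M I. f1 z + f2 z = h z"
      by eventually_elim (auto simp: f1_def f2_def)
  qed (use hm m1 m2 in auto)
  finally have twice: "2 * integral\<^sup>L (I \<Otimes>\<^sub>M I) f1 = integral\<^sup>L (I \<Otimes>\<^sub>M I) h" using swap by simp
  obtain W where W: "W \<in> V" "\<And>v. v \<in> V \<Longrightarrow> a W v = (LINT t|I. a (p t) v)" using weak_integral[OF p] by metis
  have "integral\<^sup>L (I \<Otimes>\<^sub>M I) h = (LINT t|I. LINT r|I. h (r, t))"
    using P.integral_snd[of "\<lambda>r t. h (r, t)"] ih by simp
  also have "\<dots> = (LINT t|I. a (p t) W)"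
  proof (rule Bochner_Integration.integral_cong[OF refl])
    fix t assume t: "t \<in> space I"
    show "(LINT r|I. h (r, t)) = a (p t) W"
      using W(2)[OF pV[OF t]] a.commute[OF W(1) pV[OF t]] by (simp add: h_def)
  qed
  also have "\<dots> = a W W" by (rule W(2)[OF W(1), symmetric])
  finally show "0 \<le> (LINT t|I. running T (\<lambda>r. a (p r) (p t)) t)"
    unfolding run snd1(2) using twice a.ip_nonneg[OF W(1)] by simp
qed

text \<open>The times in \<open>(0, T)\<close> at which the continuous primitive is nonzero form an
  open null set, which is empty; continuity then reaches the end points.\<close>

lemma running_zero_everywhere:
  assumes h: "integrable I h" and z: "AE t in I. running T h t = 0" and t: "0 \<le> t" "t \<le> T"
  shows "running T h t = 0"
proof -
  have c: "continuous_on UNIV (running T h)" using continuous_running[OF h] by (simp add: continuous_on_eq_continuous_at)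
  define U where "U = {0<..<T} \<inter> running T h -` (- {0})"
  have "open U" unfolding U_def by (intro open_Int open_greaterThanLessThan open_vimage[OF _ c]) auto
  moreover have "negligible U"
  proof -
    have "AE t in lebesgue. t \<in> {0<..<T} \<longrightarrow> running T h t = 0"
      using z by (subst (asm) AE_restrict_space_iff) auto
    then have "AE t in lebesgue. t \<notin> U" by eventually_elim (auto simp: U_def)
    then show ?thesis using completion.null_sets_iff_AE[of U lborel] by (simp add: negligible_iff_null_sets)
  qed
  ultimately have "U = {}" using open_not_negligible by blast
  then have zero: "running T h x = 0" if "x \<in> {0<..<T}" for x using that by (auto simp: U_def)
  have cl: "closure {0<..<T} = {0..T}" using T by simp
  show ?thesis
    by (rule continuous_constant_on_closure[of "{0<..<T}" "running T h" 0])
      (use c zero cl t continuous_on_subset[OF c] in auto)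
qed

text \<open>Once \<open>b (p t) (p t) = 0\<close>, the difference may still live where
  \<open>b\<close> does not see it. By Cauchy-Schwarz the first term of the integrated equation
  drops out for every \<open>v\<close>, so the primitive of \<open>a (p t) v\<close> vanishes and
  \<open>a (p t) v = 0\<close> for almost every \<open>t\<close>. \<open>AE_zero_along\<close>
  allows \<open>v = p t\<close> here, as it does earlier in the energy identity.\<close>

lemma weak_solution_unique:
  assumes F: "F \<in> L2t I V' N'"
    and p1: "p1 \<in> L2t I V N" "D1 \<in> L2t I V' N'" "has_initial_value T V N (\<lambda>t. b (p1 t)) l0"
      "has_weak_time_deriv T V (\<lambda>t. b (p1 t)) D1"
      "\<And>q. q \<in> L2t I V N \<Longrightarrow> (LINT t|I. D1 t (q t)) + c * (LINT t|I. a (p1 t) (q t)) = (LINT t|I. F t (q t))"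
    and p2: "p2 \<in> L2t I V N" "D2 \<in> L2t I V' N'" "has_initial_value T V N (\<lambda>t. b (p2 t)) l0"
      "has_weak_time_deriv T V (\<lambda>t. b (p2 t)) D2"
      "\<And>q. q \<in> L2t I V N \<Longrightarrow> (LINT t|I. D2 t (q t)) + c * (LINT t|I. a (p2 t) (q t)) = (LINT t|I. F t (q t))"
  shows "AE t in I. p1 t - p2 t \<in> V \<and> ip (p1 t - p2 t) (p1 t - p2 t) = 0"
proof -
  have d: "(\<lambda>t. p1 t - p2 t) \<in> L2t I V N" by (rule I.L2t_diff[OF F.seminormed_axioms p1(1) p2(1)])
  obtain p s where p: "p \<in> L2t I V N" and pd: "AE t in I. p1 t - p2 t = p t" and pV: "\<And>t. t \<in> space I \<Longrightarrow> p t \<in> V"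
    and s: "\<And>k. simple_function I (s k)" "\<And>k t. t \<in> space I \<Longrightarrow> s k t \<in> V"
    "\<And>t. t \<in> space I \<Longrightarrow> (\<lambda>k. N (s k t - p t)) \<longlonglongrightarrow> 0"
    by (rule everywhere_representative[OF d]) blast
  have V1: "AE t in I. p1 t \<in> V" "AE t in I. p2 t \<in> V" using L2t_AE p1(1) p2(1) by auto
  have aL: "(\<lambda>t. a (p t)) \<in> L2t I V' N'" by (rule bounded_form_L2t[OF bounded_forms(2) p])
  have aL1: "(\<lambda>t. a (p1 t)) \<in> L2t I V' N'" by (rule bounded_form_L2t[OF bounded_forms(2) p1(1)])
  have aL2: "(\<lambda>t. a (p2 t)) \<in> L2t I V' N'" by (rule bounded_form_L2t[OF bounded_forms(2) p2(1)])
  have run: "running T (\<lambda>s. a (p s) v) t = running T (\<lambda>s. a (p1 s) v) t - running T (\<lambda>s. a (p2 s) v) t" if v: "v \<in> V" for v t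
  proof -
    note i1 = dual_eval_integrable[OF aL1 v] and i2 = dual_eval_integrable[OF aL2 v]
    have "running T (\<lambda>s. a (p s) v) t = running T (\<lambda>s. 1 * a (p1 s) v + (-1) * a (p2 s) v) t"
      unfolding running_def
    proof (rule integral_cong_AE)
      show "(\<lambda>s. indicator {..<t} s * a (p s) v) \<in> borel_measurable I"
        by (rule borel_measurable_integrable[OF integrable_running[OF dual_eval_integrable[OF aL v]]])
      have "integrable I (\<lambda>s. 1 * a (p1 s) v + (-1) * a (p2 s) v)" using i1 i2 by simp
      then show "(\<lambda>s. indicator {..<t} s * (1 * a (p1 s) v + (-1) * a (p2 s) v)) \<in> borel_measurable I"
        by (rule borel_measurable_integrable[OF integrable_running])
      show "AE s in I. indicator {..<t} s * a (p s) v = indicator {..<t} s * (1 * a (p1 s) v + (-1) * a (p2 s) v)"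
        using V1 pd
      proof eventually_elim
        fix s assume "p1 s \<in> V" "p2 s \<in> V" and e: "p1 s - p2 s = p s"
        then have "a (p s) v = a (p1 s) v - a (p2 s) v" unfolding e[symmetric] by (intro a.diff_left v)
        then show "indicator {..<t} s * a (p s) v = indicator {..<t} s * (1 * a (p1 s) v + (-1) * a (p2 s) v)" by simp
      qed
    qed
    then show ?thesis using running_linear[OF i1 i2, of 1 "-1" t] by simp
  qed
  have eq: "AE t in I. b (p t) v + c * running T (\<lambda>s. a (p s) v) t = 0" if v: "v \<in> V" for v
  proof -
    have e1: "AE t in I. b (p1 t) v + c * running T (\<lambda>s. a (p1 s) v) t = l0 v + running T (\<lambda>s. F s v) t"
      by (rule integrated_equation[OF p1(1) F p1(2-4) _ v]) (rule p1(5))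
    have e2: "AE t in I. b (p2 t) v + c * running T (\<lambda>s. a (p2 s) v) t = l0 v + running T (\<lambda>s. F s v) t"
      by (rule integrated_equation[OF p2(1) F p2(2-4) _ v]) (rule p2(5))
    show ?thesis using e1 e2 V1 pd
  proof eventually_elim
    fix t assume 1: "b (p1 t) v + c * running T (\<lambda>s. a (p1 s) v) t = l0 v + running T (\<lambda>s. F s v) t"
      "b (p2 t) v + c * running T (\<lambda>s. a (p2 s) v) t = l0 v + running T (\<lambda>s. F s v) t"
      and 2: "p1 t \<in> V" "p2 t \<in> V" and e: "p1 t - p2 t = p t"
    have "b (p t) v = b (p1 t) v - b (p2 t) v" unfolding e[symmetric] using 2 by (intro b.diff_left v)
    then show "b (p t) v + c * running T (\<lambda>s. a (p s) v) t = 0"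
      using 1 by (simp add: run[OF v] right_diff_distrib)
  qed
  qed
  \<comment> \<open>The integrated equation as a functional of \<open>v\<close>, to be evaluated at
    \<open>v = p t\<close>. The zero functional \<open>0 v\<close> is written out to match the form
    of the primitive in \<open>primitive_dual\<close>.\<close>
  define l where "l t v = b (p t) v + c * (0 v + running T (\<lambda>s. a (p s) v) t)" for t and v :: "'x \<Rightarrow> real"
  have lV: "AE t in I. l t \<in> V'"
  proof (rule AE_I2)
    fix t assume t: "t \<in> space I"
    have "(\<lambda>v. 0 v + running T (\<lambda>s. a (p s) v) t) \<in> V'" by (rule primitive_dual(1)[OF aL F.dual.mem(1)])
    then have "b (p t) + c *\<^sub>R (\<lambda>v. 0 v + running T (\<lambda>s. a (p s) v) t) \<in> V'"
      by (intro F.dual.mem(2) F.dual.mem(4) bounded_form_dual(1)[OF bounded_forms(1) pV[OF t]])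
    moreover have "b (p t) + c *\<^sub>R (\<lambda>v. 0 v + running T (\<lambda>s. a (p s) v) t) = l t" by (simp add: fun_eq_iff l_def)
    ultimately show "l t \<in> V'" by (simp only:)
  qed
  have "AE t in I. l t (p t) = 0"
  proof (rule F.AE_zero_along[OF _ lV])
    show "strongly_measurable I V N p" using p by (simp add: L2t_def)
    show "AE t in I. l t v = 0" if "v \<in> V" for v using eq[OF that] by eventually_elim (simp add: l_def)
  qed
  then have energy: "AE t in I. b (p t) (p t) + c * running T (\<lambda>r. a (p r) (p t)) t = 0"
    by eventually_elim (simp add: l_def)
  note mem = memory_term_nonneg[OF p pV s]
  have ib: "integrable I (\<lambda>t. b (p t) (p t))" by (rule bounded_form_integral(1)[OF bounded_forms(1) p p])
  have "(LINT t|I. b (p t) (p t)) + c * (LINT t|I. running T (\<lambda>r. a (p r) (p t)) t) =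
      (LINT t|I. b (p t) (p t) + c * running T (\<lambda>r. a (p r) (p t)) t)"
    using ib mem(1) by simp
  also have "\<dots> = 0" by (rule integral_eq_zero_AE[OF energy])
  finally have "(LINT t|I. b (p t) (p t)) \<le> 0"
    using mult_nonneg_nonneg[OF less_imp_le[OF c] mem(2)] by simp
  moreover have bn: "AE t in I. 0 \<le> b (p t) (p t)" by (rule AE_I2) (rule b.ip_nonneg[OF pV])
  ultimately have "(LINT t|I. b (p t) (p t)) = 0" using integral_nonneg_AE[OF bn] by simp
  then have b0: "AE t in I. b (p t) (p t) = 0" using integral_nonneg_eq_0_iff_AE[OF ib bn] by simp
  have a0: "AE t in I. a (p t) v = 0" if v: "v \<in> V" for v
  proof (rule AE_zero_of_running[OF T dual_eval_integrable[OF aL v]])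
    have "AE t in I. running T (\<lambda>s. a (p s) v) t = 0"
      using eq[OF v] b0 AE_space[of I]
    proof eventually_elim
      fix t assume 1: "b (p t) v + c * running T (\<lambda>s. a (p s) v) t = 0" and 2: "b (p t) (p t) = 0" and t: "t \<in> space I"
      have "(b (p t) v)\<^sup>2 \<le> 0" using b.Cauchy_Schwarz_sq[OF pV[OF t] v] 2 by simp
      then have "b (p t) v = 0" by simp
      then show "running T (\<lambda>s. a (p s) v) t = 0" using 1 c by simp
    qed
    then show "running T (\<lambda>s. a (p s) v) t = 0" if "0 \<le> t" "t \<le> T" for t
      using running_zero_everywhere[OF dual_eval_integrable[OF aL v]] that by blast
  qed
  have "AE t in I. a (p t) (p t) = 0"
  proof (rule F.AE_zero_along[OF _ _ a0])
    show "strongly_measurable I V N p" using p by (simp add: L2t_def)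
    show "AE t in I. a (p t) \<in> V'" by (rule L2t_AE[OF aL])
  qed
  then show ?thesis using b0 pd AE_space[of I]
  proof eventually_elim
    fix t assume 1: "a (p t) (p t) = 0" "b (p t) (p t) = 0" and e: "p1 t - p2 t = p t" and t: "t \<in> space I"
    show "p1 t - p2 t \<in> V \<and> ip (p1 t - p2 t) (p1 t - p2 t) = 0"
      unfolding e using pV[OF t] 1 by (simp add: ip_eq)
  qed
qed

end

section \<open>Lebesgue measurability on products\<close>

text \<open>Lebesgue sets are Borel sets up to null sets, so beyond Borel measurability of
  \<open>f\<close> one has to check that null sets pull back to null sets.\<close>

lemma lebesgue_measurable_compose:
  fixes f :: "'a::euclidean_space \<Rightarrow> 'b::euclidean_space" and g :: "'b \<Rightarrow> real"
  assumes f: "f \<in> borel_measurable borel" and null: "\<And>B. B \<in> null_sets lborel \<Longrightarrow> f -` B \<in> null_sets lborel"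
    and g: "g \<in> borel_measurable lebesgue"
  shows "(\<lambda>x. g (f x)) \<in> borel_measurable lebesgue"
proof -
  have f': "f \<in> lebesgue \<rightarrow>\<^sub>M lborel" by (rule measurable_completion) (use f in simp)
  have "f \<in> lebesgue \<rightarrow>\<^sub>M lebesgue"
  proof (rule completion.measurable_completion2[OF f'])
    show "null_sets lborel \<subseteq> null_sets (distr lebesgue lborel f)"
    proof
      fix B assume B: "B \<in> null_sets (lborel :: 'b measure)"
      have "f -` B \<in> null_sets lebesgue" using null[OF B] by (rule null_sets_completionI)
      then show "B \<in> null_sets (distr lebesgue lborel f)"
        using B f' by (auto simp: null_sets_def emeasure_distr)
    qed
  qed
  from measurable_compose[OF this g] show ?thesis .
qed

lemma null_sets_product_slices:
  fixes A :: "('a::euclidean_space \<times> 'b::euclidean_space) set"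
  assumes A: "A \<in> sets borel" and s: "\<And>y. {x. (x, y) \<in> A} \<in> null_sets lborel"
  shows "A \<in> null_sets lborel"
proof -
  have A': "A \<in> sets (lborel \<Otimes>\<^sub>M lborel)" using A by (subst lborel_prod) simp
  have "emeasure (lborel \<Otimes>\<^sub>M lborel) A = (\<integral>\<^sup>+y. emeasure lborel ((\<lambda>x. (x, y)) -` A) \<partial>lborel)"
    by (rule lborel_pair.emeasure_pair_measure_alt2[OF A'])
  also have "\<dots> = (\<integral>\<^sup>+(y::'b). 0 \<partial>lborel)"
  proof (rule nn_integral_cong)
    fix y :: 'b
    have "(\<lambda>x. (x, y)) -` A = {x. (x, y) \<in> A}" by auto
    then show "emeasure lborel ((\<lambda>x. (x, y)) -` A) = 0" using s[of y] by (simp add: null_sets_def)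
  qed
  finally have "emeasure (lborel \<Otimes>\<^sub>M lborel) A = 0" by simp
  then have "emeasure lborel A = 0" by (subst (asm) lborel_prod)
  then show ?thesis using A by (simp add: null_sets_def)
qed

lemma null_sets_Times:
  assumes "B \<in> null_sets lborel"
  shows "B \<times> UNIV \<in> null_sets (lborel \<Otimes>\<^sub>M lborel :: ('a::euclidean_space \<times> 'b::euclidean_space) measure)"
    "UNIV \<times> B \<in> null_sets (lborel \<Otimes>\<^sub>M lborel :: ('b \<times> 'a) measure)"
proof -
  have B: "B \<in> sets lborel" "emeasure lborel B = 0" using assms by (auto simp: null_sets_def)
  have "emeasure (lborel \<Otimes>\<^sub>M lborel :: ('a \<times> 'b) measure) (B \<times> UNIV) = 0"
    by (subst lborel.emeasure_pair_measure_Times) (use B in auto)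
  then show "B \<times> UNIV \<in> null_sets (lborel \<Otimes>\<^sub>M lborel :: ('a \<times> 'b) measure)"
    using B(1) by (intro null_setsI pair_measureI) auto
  have "emeasure (lborel \<Otimes>\<^sub>M lborel :: ('b \<times> 'a) measure) (UNIV \<times> B) = 0"
    by (subst lborel.emeasure_pair_measure_Times) (use B in auto)
  then show "UNIV \<times> B \<in> null_sets (lborel \<Otimes>\<^sub>M lborel :: ('b \<times> 'a) measure)"
    using B(1) by (intro null_setsI pair_measureI) auto
qed

lemma lebesgue_measurable_fst:
  fixes p :: "'a::euclidean_space \<Rightarrow> real"
  assumes "p \<in> borel_measurable lebesgue"
  shows "(\<lambda>z::'a \<times> 'a. p (fst z)) \<in> borel_measurable lebesgue"
proof (rule lebesgue_measurable_compose[OF _ _ assms])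
  show "fst \<in> borel_measurable (borel :: ('a \<times> 'a) measure)" by (intro borel_measurable_continuous_onI continuous_intros)
  fix B assume B: "B \<in> null_sets (lborel :: 'a measure)"
  have "fst -` B = B \<times> (UNIV :: 'a set)" by auto
  then show "(fst -` B :: ('a \<times> 'a) set) \<in> null_sets lborel"
    using null_sets_Times(1)[OF B, where 'b='a] by (simp only: lborel_prod)
qed

text \<open>Each slice of the preimage of a null set is a translate of it. This makes the kernel,
  which is only Lebesgue measurable, measurable on the product.\<close>

lemma lebesgue_measurable_diff_pair:
  fixes k :: "'a::euclidean_space \<Rightarrow> real"
  assumes "k \<in> borel_measurable lebesgue"
  shows "(\<lambda>z::'a \<times> 'a. k (fst z - snd z)) \<in> borel_measurable lebesgue"
proof (rule lebesgue_measurable_compose[OF _ _ assms])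
  show "(\<lambda>z. fst z - snd z) \<in> borel_measurable (borel :: ('a \<times> 'a) measure)" by (intro borel_measurable_continuous_onI continuous_intros)
  fix B assume B: "B \<in> null_sets (lborel :: 'a measure)"
  have "(\<lambda>z. fst z - snd z) -` B \<inter> space (borel :: ('a \<times> 'a) measure) \<in> sets borel"
    by (rule measurable_sets[OF borel_measurable_continuous_onI]) (use B in \<open>auto intro!: continuous_intros\<close>)
  then show "((\<lambda>z. fst z - snd z) -` B :: ('a \<times> 'a) set) \<in> null_sets lborel"
    using null_sets_translation[OF B] by (intro null_sets_product_slices) auto
qed

lemma lebesgue_measurable_snd:
  fixes p :: "'a::euclidean_space \<Rightarrow> real"
  assumes "p \<in> borel_measurable lebesgue"
  shows "(\<lambda>z::'a \<times> 'a. p (snd z)) \<in> borel_measurable lebesgue"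
proof (rule lebesgue_measurable_compose[OF _ _ assms])
  show "snd \<in> borel_measurable (borel :: ('a \<times> 'a) measure)" by (intro borel_measurable_continuous_onI continuous_intros)
  fix B assume B: "B \<in> null_sets (lborel :: 'a measure)"
  have "snd -` B = (UNIV :: 'a set) \<times> B" by auto
  then show "(snd -` B :: ('a \<times> 'a) set) \<in> null_sets lborel"
    using null_sets_Times(2)[OF B, where 'b='a] by (simp only: lborel_prod)
qed

section \<open>Sets invariant along a cone of translations\<close>

text \<open>Take a compact \<open>K\<close> of positive measure in a bounded part of
  \<open>C\<close> and an open \<open>U\<close> around it such that \<open>U - K\<close> has smaller
  measure than \<open>K\<close>. A small translate of \<open>K\<close> stays in \<open>U\<close>; if
  it missed \<open>K\<close>, it would fit into \<open>U - K\<close>, against translation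
  invariance.\<close>

lemma Steinhaus:
  fixes C :: "'a::euclidean_space set"
  assumes C: "C \<in> sets lebesgue" "C \<notin> null_sets lebesgue"
  obtains d where "d > 0" "\<And>z. norm z < d \<Longrightarrow> \<exists>x. x \<in> C \<and> x - z \<in> C"
proof -
  have "\<exists>n::nat. C \<inter> cball 0 (real n) \<notin> null_sets lebesgue"
  proof (rule ccontr)
    assume "\<not> ?thesis"
    then have "(\<Union>n::nat. C \<inter> cball 0 (real n)) \<in> null_sets lebesgue" by (intro null_sets_UN) auto
    moreover have "(\<Union>n::nat. C \<inter> cball 0 (real n)) = C" by (auto simp: real_arch_simple)
    ultimately show False using C by simp
  qed
  then obtain n :: nat where n: "C \<inter> cball 0 (real n) \<notin> null_sets lebesgue" by blast
  define E where "E = C \<inter> cball 0 (real n)"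
  have E: "E \<in> lmeasurable" unfolding E_def using C(1) by (intro bounded_set_imp_lmeasurable) (auto simp: bounded_Int)
  have pos: "measure lebesgue E > 0"
  proof (rule ccontr)
    assume "\<not> ?thesis"
    then have "measure lebesgue E = 0" using measure_nonneg[of lebesgue E] by linarith
    then have "emeasure lebesgue E = 0" using emeasure_eq_measure2[OF E] by simp
    then show False using n E by (auto simp: E_def[symmetric] null_sets_def)
  qed
  obtain K where K: "closed K" "K \<subseteq> E" "E - K \<in> lmeasurable" "emeasure lebesgue (E - K) < ennreal (measure lebesgue E)"
    using sets_lebesgue_inner_closed[OF fmeasurableD[OF E] pos] by metis
  have Kb: "compact K" using K(1,2) by (auto simp: compact_eq_bounded_closed E_def intro: bounded_subset[of "cball 0 (real n)"])
  have KL: "K \<in> lmeasurable" using Kb by (rule lmeasurable_compact)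
  have "measure lebesgue (E - K) < measure lebesgue E"
    using K(4) unfolding emeasure_eq_measure2[OF K(3)] by (simp only: ennreal_less_iff[OF measure_nonneg])
  then have mK: "measure lebesgue K > 0"
    using measurable_measure_Diff[OF E fmeasurableD[OF KL] K(2)] by linarith
  obtain U where U: "open U" "K \<subseteq> U" "U - K \<in> lmeasurable" "emeasure lebesgue (U - K) < ennreal (measure lebesgue K)"
    using sets_lebesgue_outer_open[OF fmeasurableD[OF KL] mK] by metis
  have mU: "measure lebesgue (U - K) < measure lebesgue K"
    using U(4) unfolding emeasure_eq_measure2[OF U(3)] by (simp only: ennreal_less_iff[OF measure_nonneg])
  obtain d where d: "d > 0" "\<And>x z. x \<in> K \<Longrightarrow> norm z < d \<Longrightarrow> x + z \<in> U"
  proof (cases "K = {}")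
    case True
    then show ?thesis using that[of 1] by simp
  next
    case False
    obtain e where e: "e > 0" "(\<Union>x\<in>K. ball x e) \<subseteq> U"
      using compact_subset_open_imp_ball_epsilon_subset[OF Kb U(1,2)] by metis
    show ?thesis
    proof (rule that[OF e(1)])
      fix x z :: 'a assume "x \<in> K" "norm z < e"
      then have "x + z \<in> ball x e" by (simp add: dist_norm)
      then show "x + z \<in> U" using e(2) \<open>x \<in> K\<close> by blast
    qed
  qed
  show thesis
  proof (rule that[OF d(1)])
    fix z :: 'a assume z: "norm z < d"
    show "\<exists>x. x \<in> C \<and> x - z \<in> C"
    proof (rule ccontr)
      assume no: "\<not> ?thesis"
      have sub: "(+) z ` K \<subseteq> U - K"
      proof
        fix x assume "x \<in> (+) z ` K"
        then obtain y where y: "y \<in> K" "x = y + z" by (auto simp: add.commute)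
        have "x \<in> U" using d(2)[OF y(1) z] y(2) by simp
        moreover have "x \<notin> K"
        proof
          assume "x \<in> K"
          then have "x \<in> C \<and> x - z \<in> C" using K(2) y by (auto simp: E_def)
          then show False using no by blast
        qed
        ultimately show "x \<in> U - K" by simp
      qed
      have "measure lebesgue K = measure lebesgue ((+) z ` K)" by (rule measure_translation[symmetric])
      also have "\<dots> \<le> measure lebesgue (U - K)"
        by (rule measure_mono_fmeasurable[OF sub fmeasurableD[OF measurable_translation[OF KL]] U(3)])
      finally show False using mU by simp
    qed
  qed
qed

lemma AE_lborel_shift:
  fixes P :: "'a::euclidean_space \<Rightarrow> bool"
  assumes "AE x in lborel. P x"
  shows "AE x in lborel. P (x - z)"
proof -
  obtain B where B: "{x \<in> space lborel. \<not> P x} \<subseteq> B" "B \<in> null_sets (lborel :: 'a measure)"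
    using AE_E[OF assms] by (metis null_setsI)
  show ?thesis
    by (rule AE_I'[OF null_sets_translation[OF B(2), of z]]) (use B(1) in auto)
qed

lemma AE_lborel_reflect:
  fixes P :: "'a::euclidean_space \<Rightarrow> bool"
  assumes "AE x in lborel. P x"
  shows "AE x in lborel. P (y - x)"
proof -
  obtain B where B: "{x \<in> space lborel. \<not> P x} \<subseteq> B" "B \<in> null_sets (lborel :: 'a measure)"
    using AE_E[OF assms] by (metis null_setsI)
  have "{x. y - x \<in> B} \<in> null_sets lborel"
  proof -
    have "(\<lambda>x. y - x) -` B \<inter> space borel \<in> sets borel"
      by (rule measurable_sets[OF borel_measurable_continuous_onI]) (use B in \<open>auto intro!: continuous_intros\<close>)
    then have S: "{x. y - x \<in> B} \<in> sets borel" by (simp add: vimage_def)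
    have img: "(\<lambda>x. (-1) *\<^sub>R x + y) ` B = {x. y - x \<in> B}"
      by (force simp: image_iff)
    have "emeasure lebesgue {x. y - x \<in> B} = 0"
      using emeasure_lebesgue_affine[of "-1" y B] B(2) unfolding img[symmetric] by (auto simp: null_sets_def add.commute)
    then show ?thesis using S by (simp add: null_sets_def)
  qed
  then show ?thesis by (rule AE_I') (use B(1) in auto)
qed

text \<open>The hypothesis concerns pairs of points, the group argument single translations. Fubini
  turns the former into invariance of \<open>E\<close>, modulo null sets, under almost every
  translation in \<open>C\<close>; after Steinhaus it is used in the other direction to compare
  almost every point with one fixed point.\<close>

lemma AE_constant_of_translation_invariant:
  fixes E C :: "'a::euclidean_space set"
  assumes E: "E \<in> sets lebesgue" and C: "C \<in> sets lebesgue" "C \<notin> null_sets lebesgue"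
    and inv: "AE z in (lebesgue :: ('a \<times> 'a) measure). fst z - snd z \<in> C \<longrightarrow> (fst z \<in> E \<longleftrightarrow> snd z \<in> E)"
  shows "(AE x in lebesgue. x \<in> E) \<or> (AE x in lebesgue. x \<notin> E)"
proof -
  \<comment> \<open>\<open>E\<close> and, below, \<open>C\<close> are replaced by Borel sets because
    the two quantifiers are exchanged in the uncompleted product.\<close>
  obtain E' where E': "E' \<in> sets borel" and EE': "AE x in lborel. x \<in> E \<longleftrightarrow> x \<in> E'"
  proof -
    have "(indicator E :: 'a \<Rightarrow> real) \<in> borel_measurable lebesgue" using E by simp
    then obtain g :: "'a \<Rightarrow> real" where g: "g \<in> borel_measurable lborel" "AE x in lborel. indicator E x = g x"
      using completion_ex_borel_measurable_real by blast
    show thesis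
    proof (rule that[of "g -` {1}"])
      show "g -` {1} \<in> sets borel" using measurable_sets[OF g(1), of "{1}"] by simp
      show "AE x in lborel. x \<in> E \<longleftrightarrow> x \<in> g -` {1}" using g(2) by eventually_elim (auto simp: indicator_def split: if_splits)
    qed
  qed
  obtain C' where C': "C' \<in> sets borel" "C' \<subseteq> C" "C' \<notin> null_sets lborel"
  proof (rule that[of "main_part lborel C"])
    have S: "C \<in> sets (completion lborel)" using C(1) .
    show "main_part lborel C \<in> sets borel" using main_part_sets[OF S] by simp
    show "main_part lborel C \<subseteq> C" using main_part_null_part_Un[OF S] by blast
    show "main_part lborel C \<notin> null_sets lborel"
      using C(2) S emeasure_completion[OF S] by (auto simp: null_sets_def)
  qed
  define R where "R x z \<longleftrightarrow> z \<in> C' \<longrightarrow> (x \<in> E' \<longleftrightarrow> x - z \<in> E')" for x z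
  have pm: "{w \<in> space (lborel \<Otimes>\<^sub>M lborel). R (fst w) (snd w)} \<in> sets (lborel \<Otimes>\<^sub>M lborel :: ('a \<times> 'a) measure)"
  proof -
    have [measurable]: "E' \<in> sets lborel" "C' \<in> sets lborel" using E' C' by auto
    show ?thesis unfolding R_def by measurable
  qed
  have "AE x in (lborel :: 'a measure). AE y in (lborel :: 'a measure). x - y \<in> C \<longrightarrow> (x \<in> E \<longleftrightarrow> y \<in> E)"
  proof -
    have "AE z in (lborel \<Otimes>\<^sub>M lborel :: ('a \<times> 'a) measure). fst z - snd z \<in> C \<longrightarrow> (fst z \<in> E \<longleftrightarrow> snd z \<in> E)"
    proof (subst lborel_prod)
      show "AE z in (lborel :: ('a \<times> 'a) measure). fst z - snd z \<in> C \<longrightarrow> (fst z \<in> E \<longleftrightarrow> snd z \<in> E)"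
        using inv by (simp only: AE_completion_iff)
    qed
    from lborel_pair.AE_pair[OF this] show ?thesis by simp
  qed
  then have "AE x in (lborel :: 'a measure). AE z in (lborel :: 'a measure). R x z"
    using EE'
  proof eventually_elim
    fix x assume 1: "AE y in lborel. x - y \<in> C \<longrightarrow> (x \<in> E \<longleftrightarrow> y \<in> E)" and 2: "x \<in> E \<longleftrightarrow> x \<in> E'"
    have "AE y in lborel. x - y \<in> C \<longrightarrow> (x \<in> E' \<longleftrightarrow> y \<in> E')"
      using 1 EE' by eventually_elim (simp add: 2)
    from AE_lborel_reflect[OF this, of x] show "AE z in lborel. R x z"
      by eventually_elim (use C'(2) in \<open>auto simp: R_def\<close>)
  qed
  then have "AE z in (lborel :: 'a measure). AE x in (lborel :: 'a measure). R x z"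
    using lborel_pair.AE_commute[of R] pm by (simp add: split_beta')
  define D where "D = {z. AE x in lborel. x \<in> E' \<longleftrightarrow> x - z \<in> E'}"
  have D_add: "y + z \<in> D" if "y \<in> D" "z \<in> D" for y z
  proof -
    have "AE x in lborel. x \<in> E' \<longleftrightarrow> x - y \<in> E'" using that(1) by (simp add: D_def)
    moreover have "AE x in lborel. x - y \<in> E' \<longleftrightarrow> x - y - z \<in> E'"
      using AE_lborel_shift[of "\<lambda>x. x \<in> E' \<longleftrightarrow> x - z \<in> E'" y] that(2) by (simp add: D_def)
    ultimately have "AE x in lborel. x \<in> E' \<longleftrightarrow> x - (y + z) \<in> E'" by eventually_elim (simp add: diff_diff_eq)
    then show ?thesis by (simp add: D_def)
  qed
  have D_minus: "- z \<in> D" if "z \<in> D" for z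
  proof -
    have "AE x in lborel. x - (- z) \<in> E' \<longleftrightarrow> x - (- z) - z \<in> E'"
      using that by (intro AE_lborel_shift) (simp add: D_def)
    then have "AE x in lborel. x \<in> E' \<longleftrightarrow> x - (- z) \<in> E'" by eventually_elim simp
    then show ?thesis by (simp add: D_def)
  qed
  have AED: "AE z in lborel. z \<in> C' \<longrightarrow> z \<in> D"
    using \<open>AE z in lborel. AE x in lborel. R x z\<close> by eventually_elim (auto simp: R_def D_def)
  obtain B where B: "{z \<in> space lborel. \<not> (z \<in> C' \<longrightarrow> z \<in> D)} \<subseteq> B" "B \<in> null_sets (lborel :: 'a measure)"
    using AE_E[OF AED] by (metis null_setsI)
  \<comment> \<open>Only almost every point of \<open>C'\<close> is known to lie in
    \<open>D\<close>; removing a null set leaves a set of positive measure inside \<open>D\<close>,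
    to which Steinhaus applies.\<close>
  define C'' where "C'' = C' - B"
  have C''D: "C'' \<subseteq> D" using B(1) by (auto simp: C''_def)
  have "C'' \<notin> null_sets lborel"
  proof
    assume "C'' \<in> null_sets lborel"
    then have "C'' \<union> B \<in> null_sets lborel" using B(2) by blast
    then have "C' \<in> null_sets lborel" using C'(1) by (elim null_sets_subset) (auto simp: C''_def)
    then show False using C' by simp
  qed
  moreover have "C'' \<in> sets lborel" using C'(1) B(2) by (auto simp: C''_def)
  ultimately have "C'' \<in> sets lebesgue" "C'' \<notin> null_sets lebesgue"
    by (auto simp: null_sets_completion_iff)
  then obtain d where d: "d > 0" "\<And>z. norm z < d \<Longrightarrow> \<exists>x. x \<in> C'' \<and> x - z \<in> C''" by (rule Steinhaus) blast
  have small: "z \<in> D" if nz: "norm z < d" for z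
  proof -
    obtain x where "x \<in> C''" "x - z \<in> C''" using d(2)[OF nz] by blast
    then have "x + - (x - z) \<in> D" using C''D by (intro D_add D_minus) auto
    then show ?thesis by simp
  qed
  have multiple: "real n *\<^sub>R z \<in> D" if "z \<in> D" for n :: nat and z
  proof (induction n)
    case 0
    show ?case using small[of 0] d(1) by simp
  next
    case (Suc n)
    have "real (Suc n) *\<^sub>R z = real n *\<^sub>R z + z" by (simp add: algebra_simps)
    then show ?case using D_add[OF Suc that] by simp
  qed
  \<comment> \<open>Every vector is an integer multiple of a short one, so a group that contains a
    ball is everything.\<close>
  have all: "z \<in> D" for z
  proof -
    obtain n :: nat where n: "norm z / d < real n" using reals_Archimedean2 by blast
    then have n0: "real n > 0" using d(1) by (metis divide_nonneg_pos le_less_trans norm_ge_zero)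
    have "norm ((1 / real n) *\<^sub>R z) < d" using n n0 d(1) by (simp add: field_simps)
    from multiple[OF small[OF this], of n] show ?thesis using n0 by simp
  qed
  define Q where "Q x y \<longleftrightarrow> (x \<in> E' \<longleftrightarrow> x - y \<in> E')" for x y
  have qm: "{w \<in> space (lborel \<Otimes>\<^sub>M lborel). Q (fst w) (snd w)} \<in> sets (lborel \<Otimes>\<^sub>M lborel :: ('a \<times> 'a) measure)"
  proof -
    have [measurable]: "E' \<in> sets lborel" using E' by auto
    show ?thesis unfolding Q_def by measurable
  qed
  have "AE y in (lborel :: 'a measure). AE x in (lborel :: 'a measure). Q x y" using all by (simp add: D_def Q_def)
  then have "AE x in (lborel :: 'a measure). AE y in (lborel :: 'a measure). Q x y"
    using lborel_pair.AE_commute[of Q] qm by (simp add: split_beta')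
  \<comment> \<open>One base point decides: almost every point lies in \<open>E'\<close> if
    \<open>x\<close> does, and almost none if it does not.\<close>
  then obtain x where x: "AE y in lborel. Q x y"
    using eventually_happens'[of "ae_filter lborel"] by (auto simp: ae_filter_eq_bot_iff)
  from AE_lborel_reflect[OF x, of x] have "AE y in lborel. x \<in> E' \<longleftrightarrow> y \<in> E'" by eventually_elim (simp add: Q_def)
  then have "AE y in lborel. x \<in> E' \<longleftrightarrow> y \<in> E" using EE' by eventually_elim simp
  then have "AE y in lebesgue. x \<in> E' \<longleftrightarrow> y \<in> E" by (rule AE_completion)
  then show ?thesis by (cases "x \<in> E'") auto
qed

section \<open>The energy space\<close>

lemma AE_scale_measure_iff:
  assumes "r \<noteq> 0"
  shows "(AE x in scale_measure r M. P x) \<longleftrightarrow> (AE x in M. P x)"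
proof -
  have "null_sets (scale_measure r M) = null_sets M"
    using assms by (auto simp: null_sets_def)
  moreover have "space (scale_measure r M) = space M" by (rule sets_eq_imp_space_eq) simp
  ultimately show ?thesis by (simp add: eventually_ae_filter)
qed

lemma sphere_map_measurable:
  "sgn \<in> restrict_space lborel (ball 0 1 - {0}) \<rightarrow>\<^sub>M restrict_space borel (sphere 0 1 :: 'a::euclidean_space set)"
proof (rule measurable_restrict_space2)
  show "sgn \<in> space (restrict_space lborel (ball 0 1 - {0 :: 'a})) \<rightarrow> sphere 0 1"
    by (auto simp: space_restrict_space norm_sgn)
  have "(sgn :: 'a \<Rightarrow> 'a) = (\<lambda>x. inverse (norm x) *\<^sub>R x)" by (simp add: fun_eq_iff sgn_div_norm)
  then have "(sgn :: 'a \<Rightarrow> 'a) \<in> borel_measurable lborel" by simp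
  then show "(sgn :: 'a \<Rightarrow> 'a) \<in> borel_measurable (restrict_space lborel (ball 0 1 - {0}))"
    by (rule measurable_restrict_space1)
qed

lemma sgn_borel: "(sgn :: 'a::euclidean_space \<Rightarrow> 'a) \<in> borel_measurable borel"
proof -
  have "(sgn :: 'a \<Rightarrow> 'a) = (\<lambda>x. inverse (norm x) *\<^sub>R x)" by (simp add: fun_eq_iff sgn_div_norm)
  then show ?thesis by simp
qed

text \<open>The exceptional cone is a countable union of dilations
  of its intersection with the unit ball.\<close>

lemma AE_sgn:
  fixes P :: "'a::euclidean_space \<Rightarrow> bool"
  assumes "AE \<phi> in distr (restrict_space lborel (ball 0 1 - {0})) (restrict_space borel (sphere 0 1)) sgn. P \<phi>"
  shows "AE z in lborel. z \<noteq> 0 \<longrightarrow> P (sgn z)"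
proof -
  have "AE z in restrict_space lborel (ball 0 1 - {0 :: 'a}). P (sgn z)"
    by (rule AE_distrD[OF sphere_map_measurable assms])
  then have "AE z in lborel. z \<in> ball 0 1 - {0} \<longrightarrow> P (sgn z)"
    by (subst (asm) AE_restrict_space_iff) auto
  then obtain B where B: "{z \<in> space lborel. \<not> (z \<in> ball 0 1 - {0} \<longrightarrow> P (sgn z))} \<subseteq> B" "B \<in> null_sets (lborel :: 'a measure)"
    using AE_E by (metis null_setsI)
  have "(\<Union>n. (\<lambda>x. real (Suc n) *\<^sub>R x + 0) ` B) \<in> null_sets lebesgue"
  proof (rule null_sets_UN)
    fix n
    have "(\<lambda>x. real (Suc n) *\<^sub>R x + 0) ` B = (\<lambda>x. (1 / real (Suc n)) *\<^sub>R x) -` B \<inter> space borel"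
      by (force simp: image_iff)
    also have "\<dots> \<in> sets borel"
      by (rule measurable_sets[OF borel_measurable_continuous_onI]) (use B in \<open>auto intro!: continuous_intros\<close>)
    finally have "(\<lambda>x. real (Suc n) *\<^sub>R x + 0) ` B \<in> sets lebesgue" by simp
    moreover have "emeasure lebesgue ((\<lambda>x. real (Suc n) *\<^sub>R x + 0) ` B) = 0"
      using emeasure_lebesgue_affine[of "real (Suc n)" 0 B] B(2) by (auto simp: null_sets_def)
    ultimately show "(\<lambda>x. real (Suc n) *\<^sub>R x + 0) ` B \<in> null_sets lebesgue" by (rule null_setsI[rotated])
  qed
  moreover have "{z \<in> space lebesgue. \<not> (z \<noteq> 0 \<longrightarrow> P (sgn z))} \<subseteq> (\<Union>n. (\<lambda>x. real (Suc n) *\<^sub>R x + 0) ` B)"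
  proof
    fix z :: 'a assume "z \<in> {z \<in> space lebesgue. \<not> (z \<noteq> 0 \<longrightarrow> P (sgn z))}"
    then have z: "z \<noteq> 0" "\<not> P (sgn z)" by auto
    obtain n :: nat where n: "norm z < real n" using reals_Archimedean2 by blast
    define w where "w = (1 / real (Suc n)) *\<^sub>R z"
    have "norm w < 1" using n by (simp add: w_def field_simps)
    moreover have "sgn w = sgn z" unfolding w_def by (simp add: sgn_scaleR)
    moreover have "w \<noteq> 0" using z by (simp add: w_def)
    ultimately have "w \<in> B" using B(1) z by auto
    moreover have "z = real (Suc n) *\<^sub>R w + 0" by (simp add: w_def)
    ultimately show "z \<in> (\<Union>n. (\<lambda>x. real (Suc n) *\<^sub>R x + 0) ` B)" by blast
  qed
  ultimately have "AE z in lebesgue. z \<noteq> 0 \<longrightarrow> P (sgn z)" by (rule AE_I')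
  then show ?thesis by (simp add: AE_completion_iff)
qed

text \<open>\<open>m\<close> is measurable only for the completed surface measure. It is replaced by
  a function \<open>g\<close> that is Borel on the sphere, and \<open>AE_sgn\<close> carries their
  equality from almost all directions to almost all points of the space.\<close>

lemma kernel_measurable:
  fixes m :: "'a::euclidean_space \<Rightarrow> real"
  assumes m: "sphere_density m"
  shows "kernel m \<kappa> \<beta> \<in> borel_measurable lebesgue"
proof -
  define \<mu> where "\<mu> = distr (restrict_space lborel (ball 0 1 - {0})) (restrict_space borel (sphere 0 1 :: 'a set)) sgn"
  have "m \<in> borel_measurable (completion (scale_measure (of_nat DIM('a)) \<mu>))"
    using m unfolding sphere_density_def sphere_measure_def \<mu>_def has_bochner_integral_iff by (auto intro: borel_measurable_integrable)
  then obtain g where g: "g \<in> borel_measurable (scale_measure (of_nat DIM('a)) \<mu>)" and ae: "AE x in scale_measure (of_nat DIM('a)) \<mu>. m x = g x"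
    using completion_ex_borel_measurable_real by blast
  have g': "g \<in> borel_measurable (restrict_space borel (sphere 0 1 :: 'a set))"
    using g unfolding \<mu>_def by (simp cong: measurable_cong_sets)
  have "AE x in \<mu>. m x = g x"
    using ae by (subst (asm) AE_scale_measure_iff) auto
  from AE_sgn[OF this[unfolded \<mu>_def]] have eq: "AE z in lborel. z \<noteq> 0 \<longrightarrow> m (sgn z) = g (sgn z)" .
  \<comment> \<open>The origin is set apart because \<open>sgn 0 = 0\<close> is not on the sphere,
    and \<open>g\<close> is measurable only there.\<close>
  define h where "h z = (if z = 0 then 0 else g (sgn z)) / (exp (\<kappa> * norm z) * norm z powr (real DIM('a) + \<beta>))" for z :: 'a
  have hs: "(\<lambda>z. if z = 0 then 0 else g (sgn z)) \<in> borel_measurable (borel :: 'a measure)"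
  proof -
    have "sgn \<in> restrict_space borel (- {0}) \<rightarrow>\<^sub>M restrict_space borel (sphere 0 1 :: 'a set)"
      by (intro measurable_restrict_space2 measurable_restrict_space1 sgn_borel) (auto simp: space_restrict_space norm_sgn)
    from measurable_compose[OF this g'] have "(\<lambda>z. g (sgn z)) \<in> borel_measurable (restrict_space borel (- {0}))" .
    then have "(\<lambda>z. indicator (- {0}) z *\<^sub>R g (sgn z)) \<in> borel_measurable borel"
      by (subst (asm) borel_measurable_restrict_space_iff) auto
    moreover have "(\<lambda>z. indicator (- {0}) z *\<^sub>R g (sgn z)) = (\<lambda>z. if z = 0 then 0 else g (sgn z))"
      by (auto simp: fun_eq_iff indicator_def)
    ultimately show ?thesis by simp
  qed
  have "h \<in> borel_measurable lborel" unfolding h_def using hs by simp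
  then have hl: "h \<in> borel_measurable lebesgue" by (rule measurable_completion)
  have "AE z in lebesgue. h z = kernel m \<kappa> \<beta> z"
    using AE_completion[OF eq] by eventually_elim (auto simp: h_def kernel_def)
  then show ?thesis by (rule completion.borel_measurable_AE_cong[OF hl])
qed

lemma kernel_nonneg:
  fixes m :: "'a::euclidean_space \<Rightarrow> real"
  assumes "sphere_density m"
  shows "0 \<le> kernel m \<kappa> \<beta> z"
proof (cases "z = 0")
  case False
  then have "sgn z \<in> sphere 0 1" by (simp add: norm_sgn)
  then show ?thesis using assms by (auto simp: kernel_def sphere_density_def)
qed (simp add: kernel_def)

text \<open>Otherwise \<open>m\<close> would vanish almost everywhere for the surface measure,
  against its integral being 1. The detour through a Borel \<open>g\<close> is made because
  transferring an almost everywhere statement to the image measure under \<open>sgn\<close> asks for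
  a measurable set.\<close>

lemma kernel_support_not_null:
  fixes m :: "'a::euclidean_space \<Rightarrow> real"
  assumes m: "sphere_density m"
  shows "{z. kernel m \<kappa> \<beta> z \<noteq> 0} \<notin> null_sets lebesgue"
proof
  assume "{z. kernel m \<kappa> \<beta> z \<noteq> 0} \<in> null_sets lebesgue"
  then have "AE z in lebesgue. kernel m \<kappa> \<beta> z = 0" by (rule AE_I') auto
  then have "AE z in (lborel :: 'a measure). z \<noteq> 0 \<longrightarrow> m (sgn z) = 0"
    unfolding AE_completion_iff by eventually_elim (auto simp: kernel_def)
  then have "AE z in restrict_space lborel (ball 0 1 - {0 :: 'a}). m (sgn z) = 0"
    by (subst AE_restrict_space_iff) (auto elim!: eventually_mono)
  moreover define \<mu> where "\<mu> = distr (restrict_space lborel (ball 0 1 - {0})) (restrict_space borel (sphere 0 1 :: 'a set)) sgn"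
  have mm: "m \<in> borel_measurable (completion (scale_measure (of_nat DIM('a)) \<mu>))"
    and int: "has_bochner_integral (completion (scale_measure (of_nat DIM('a)) \<mu>)) m 1"
    using m unfolding sphere_density_def sphere_measure_def \<mu>_def has_bochner_integral_iff by (auto intro: borel_measurable_integrable)
  then obtain g where g: "g \<in> borel_measurable (scale_measure (of_nat DIM('a)) \<mu>)" and ae: "AE x in scale_measure (of_nat DIM('a)) \<mu>. m x = g x"
    using completion_ex_borel_measurable_real by blast
  have g': "g \<in> borel_measurable (restrict_space borel (sphere 0 1 :: 'a set))"
    using g unfolding \<mu>_def by (simp cong: measurable_cong_sets)
  have ae': "AE x in \<mu>. m x = g x" using ae by (subst (asm) AE_scale_measure_iff) auto
  have "AE z in restrict_space lborel (ball 0 1 - {0 :: 'a}). m (sgn z) = g (sgn z)"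
    using ae' unfolding \<mu>_def by (rule AE_distrD[OF sphere_map_measurable])
  ultimately have "AE z in restrict_space lborel (ball 0 1 - {0 :: 'a}). g (sgn z) = 0"
    by eventually_elim simp
  then have "AE x in \<mu>. g x = 0"
    unfolding \<mu>_def by (subst AE_distr_iff[OF sphere_map_measurable]) (use g' in measurable)
  then have "AE x in scale_measure (of_nat DIM('a)) \<mu>. g x = 0"
    by (subst AE_scale_measure_iff) auto
  with ae have "AE x in scale_measure (of_nat DIM('a)) \<mu>. m x = 0" by eventually_elim simp
  then have "AE x in completion (scale_measure (of_nat DIM('a)) \<mu>). m x = 0" by (rule AE_completion)
  then have "integral\<^sup>L (completion (scale_measure (of_nat DIM('a)) \<mu>)) m = 0"
    by (rule integral_eq_zero_AE)
  then show False using int by (simp add: has_bochner_integral_iff)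
qed

lemma AE_product_fst:
  assumes "AE x in (lborel :: 'a::euclidean_space measure). P x"
  shows "AE w in (lborel \<Otimes>\<^sub>M lborel :: ('a \<times> 'b::euclidean_space) measure). P (fst w)"
proof -
  obtain B where B: "{x \<in> space lborel. \<not> P x} \<subseteq> B" "B \<in> null_sets (lborel :: 'a measure)"
    using AE_E[OF assms] by (metis null_setsI)
  have "B \<times> UNIV \<in> null_sets (lborel \<Otimes>\<^sub>M lborel :: ('a \<times> 'b) measure)"
    by (rule null_sets_Times(1)[OF B(2), where 'b='b])
  then show ?thesis by (rule AE_I') (use B(1) in auto)
qed

lemma AE_product_snd:
  assumes "AE x in (lborel :: 'b::euclidean_space measure). P x"
  shows "AE w in (lborel \<Otimes>\<^sub>M lborel :: ('a::euclidean_space \<times> 'b) measure). P (snd w)"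
proof -
  obtain B where B: "{x \<in> space lborel. \<not> P x} \<subseteq> B" "B \<in> null_sets (lborel :: 'b measure)"
    using AE_E[OF assms] by (metis null_setsI)
  have "UNIV \<times> B \<in> null_sets (lborel \<Otimes>\<^sub>M lborel :: ('a \<times> 'b) measure)"
    by (rule null_sets_Times(2)[OF B(2), where 'b='a])
  then show ?thesis by (rule AE_I') (use B(1) in auto)
qed

locale energy_space =
  fixes m :: "'a::euclidean_space \<Rightarrow> real" and \<kappa> \<beta> :: real and \<Omega> :: "'a set"
  assumes density: "sphere_density m" and open_domain: "open \<Omega>" and nonempty: "\<Omega> \<noteq> {}"
begin

abbreviation "V \<equiv> V_space m \<kappa> \<beta> \<Omega>"
abbreviation "k \<equiv> kernel m \<kappa> \<beta>"

text \<open>Absorbing the square root of the kernel gives a linear map into L2 of the product with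
  \<open>a_form\<close> as the pulled-back inner product, so both parts of the norm become L2 norms
  and share the same lemmas.\<close>

definition increment :: "('a \<Rightarrow> real) \<Rightarrow> 'a \<times> 'a \<Rightarrow> real" where
  "increment p z = (p (fst z) - p (snd z)) * sqrt (k (fst z - snd z))"

definition b_form :: "('a \<Rightarrow> real) \<Rightarrow> ('a \<Rightarrow> real) \<Rightarrow> real" where
  "b_form = L2_functional \<Omega>"

definition a_form :: "('a \<Rightarrow> real) \<Rightarrow> ('a \<Rightarrow> real) \<Rightarrow> real" where
  "a_form = energy_form m \<kappa> \<beta>"

lemma L2_eq: "L2 \<Omega> = sqint (lebesgue_on \<Omega>)"
  by (auto simp: L2_def sqint_def)

lemma increment_measurable:
  assumes "p \<in> borel_measurable lebesgue"
  shows "increment p \<in> borel_measurable lebesgue"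
proof -
  have "(\<lambda>z::'a \<times> 'a. sqrt (k (fst z - snd z))) \<in> borel_measurable lebesgue"
    using lebesgue_measurable_diff_pair[OF kernel_measurable[OF density]] by simp
  moreover have "(\<lambda>z::'a \<times> 'a. p (fst z) - p (snd z)) \<in> borel_measurable lebesgue"
    by (intro borel_measurable_diff lebesgue_measurable_fst lebesgue_measurable_snd assms)
  ultimately show ?thesis unfolding increment_def by (rule borel_measurable_times[rotated])
qed

lemma increment_mult: "increment p z * increment q z = (p (fst z) - p (snd z)) * (q (fst z) - q (snd z)) * k (fst z - snd z)"
proof -
  have "sqrt (k (fst z - snd z)) * sqrt (k (fst z - snd z)) = k (fst z - snd z)"
    using kernel_nonneg[OF density] by simp
  moreover have "increment p z * increment q z = (p (fst z) - p (snd z)) * (q (fst z) - q (snd z)) *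
      (sqrt (k (fst z - snd z)) * sqrt (k (fst z - snd z)))"
    unfolding increment_def by (simp only: mult_ac)
  ultimately show ?thesis by (simp only:)
qed

lemma V_eq: "V = {p \<in> borel_measurable lebesgue. p \<in> sqint (lebesgue_on \<Omega>) \<and> increment p \<in> sqint lebesgue}"
proof -
  have "(increment p z)\<^sup>2 = (case z of (X, Y) \<Rightarrow> (p X - p Y)\<^sup>2 * k (X - Y))" for p z
    by (simp add: power2_eq_square increment_mult split_beta)
  then show ?thesis
    using increment_measurable by (auto simp: V_space_def L2_eq sqint_def)
qed

lemma a_form_eq: "a_form p q = (LINT z|lebesgue. increment p z * increment q z)"
  unfolding a_form_def energy_form_def increment_mult case_prod_unfold by (rule refl)

lemma b_form_eq: "b_form p q = (LINT x|lebesgue_on \<Omega>. p x * q x)"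
  by (simp add: b_form_def L2_functional_def)

lemma increment_add: "increment (p + q) = increment p + increment q"
  by (simp add: fun_eq_iff increment_def algebra_simps)

lemma increment_scale: "increment (c *\<^sub>R p) = c *\<^sub>R increment p"
  by (simp add: fun_eq_iff increment_def algebra_simps)

lemma increment_diff: "increment (p - q) = increment p - increment q"
  by (simp add: fun_eq_iff increment_def algebra_simps)

sublocale S\<Omega>: semi_inner "sqint (lebesgue_on \<Omega>)" "\<lambda>f g. LINT x|lebesgue_on \<Omega>. f x * g x"
  by (rule semi_inner_sqint)

sublocale SE: semi_inner "sqint (lebesgue :: ('a \<times> 'a) measure)" "\<lambda>f g. LINT x|lebesgue. f x * g x"
  by (rule semi_inner_sqint)

lemma VD: 
  assumes "p \<in> V"
  shows "p \<in> borel_measurable lebesgue" "p \<in> sqint (lebesgue_on \<Omega>)" "increment p \<in> sqint lebesgue"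
  using assms unfolding V_eq by auto

lemma subspace_V: "subspace V"
proof (rule subspaceI)
  have "increment 0 = 0" by (simp add: fun_eq_iff increment_def)
  moreover have "(0 :: 'a \<Rightarrow> real) \<in> borel_measurable lebesgue" unfolding zero_fun_def by (rule measurable_const) simp
  ultimately show "0 \<in> V" unfolding V_eq using S\<Omega>.mem(1) SE.mem(1) by (simp only: mem_Collect_eq)
next
  fix p q assume p: "p \<in> V" and q: "q \<in> V"
  have "p + q \<in> borel_measurable lebesgue" unfolding plus_fun_def using VD(1)[OF p] VD(1)[OF q] by (rule borel_measurable_add)
  then show "p + q \<in> V"
    unfolding V_eq increment_add mem_Collect_eq
    using S\<Omega>.mem(2)[OF VD(2)[OF p] VD(2)[OF q]] SE.mem(2)[OF VD(3)[OF p] VD(3)[OF q]] by blast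
next
  fix c p assume p: "p \<in> V"
  have "c *\<^sub>R p \<in> borel_measurable lebesgue" unfolding scaleR_fun_def using VD(1)[OF p] by (intro borel_measurable_scaleR) auto
  then show "c *\<^sub>R p \<in> V"
    unfolding V_eq increment_scale mem_Collect_eq
    using S\<Omega>.mem(4)[OF VD(2)[OF p]] SE.mem(4)[OF VD(3)[OF p]] by blast
qed

sublocale b: semi_inner V b_form
proof
  show "subspace V" by (rule subspace_V)
  fix p assume p: "p \<in> V"
  { fix q r assume q: "q \<in> V" and r: "r \<in> V"
    show "b_form (p + q) r = b_form p r + b_form q r"
      unfolding b_form_eq by (rule S\<Omega>.add_left[OF VD(2)[OF p] VD(2)[OF q] VD(2)[OF r]]) }
  { fix q c assume q: "q \<in> V"
    show "b_form (c *\<^sub>R p) q = c * b_form p q"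
      unfolding b_form_eq by (rule S\<Omega>.scale_left[OF VD(2)[OF p] VD(2)[OF q]])
    show "b_form p q = b_form q p" unfolding b_form_eq by (simp add: mult.commute) }
  show "0 \<le> b_form p p" unfolding b_form_eq by (rule integral_nonneg_AE) simp
qed

sublocale a: semi_inner V a_form
proof
  show "subspace V" by (rule subspace_V)
  fix p assume p: "p \<in> V"
  { fix q r assume q: "q \<in> V" and r: "r \<in> V"
    show "a_form (p + q) r = a_form p r + a_form q r"
      unfolding a_form_eq increment_add by (rule SE.add_left[OF VD(3)[OF p] VD(3)[OF q] VD(3)[OF r]]) }
  { fix q c assume q: "q \<in> V"
    show "a_form (c *\<^sub>R p) q = c * a_form p q"
      unfolding a_form_eq increment_scale by (rule SE.scale_left[OF VD(3)[OF p] VD(3)[OF q]])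
    show "a_form p q = a_form q p" unfolding a_form_eq by (simp add: mult.commute) }
  show "0 \<le> a_form p p" unfolding a_form_eq by (rule integral_nonneg_AE) simp
qed

definition ip_form :: "('a \<Rightarrow> real) \<Rightarrow> ('a \<Rightarrow> real) \<Rightarrow> real" where
  "ip_form p q = b_form p q + a_form p q"

lemma V_norm_eq: "V_norm m \<kappa> \<beta> \<Omega> = (\<lambda>p. sqrt (ip_form p p))"
proof
  fix p
  have "(L2_norm \<Omega> p)\<^sup>2 = b_form p p"
    unfolding L2_norm_def b_form_eq by (simp add: power2_eq_square integral_nonneg_AE)
  moreover have "(LINT (X, Y)|lebesgue. (p X - p Y)\<^sup>2 * k (X - Y)) = a_form p p"
    unfolding a_form_eq increment_mult by (simp add: power2_eq_square case_prod_unfold)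
  ultimately show "V_norm m \<kappa> \<beta> \<Omega> p = sqrt (ip_form p p)" by (simp add: V_norm_def ip_form_def)
qed

sublocale ip: semi_inner V ip_form
proof
  show "subspace V" by (rule subspace_V)
qed (simp_all add: ip_form_def b.bilinear a.bilinear b.ip_nonneg a.ip_nonneg b.commute a.commute algebra_simps)

text \<open>Of the two alternatives for an invariant set, being null is excluded because
  \<open>E\<close> contains almost all of a nonempty open set.\<close>

lemma AE_full_of_kernel_invariant:
  assumes E: "E \<in> sets lebesgue" and \<Omega>: "AE x in lebesgue_on \<Omega>. x \<in> E"
    and inv: "AE z in (lebesgue :: ('a \<times> 'a) measure). k (fst z - snd z) \<noteq> 0 \<longrightarrow> (fst z \<in> E \<longleftrightarrow> snd z \<in> E)"
  shows "AE x in lebesgue. x \<in> E"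
proof -
  have C: "{z. k z \<noteq> 0} \<in> sets lebesgue"
    using measurable_sets[OF kernel_measurable[OF density, of \<kappa> \<beta>], of "- {0}"] by (simp add: vimage_def)
  have "(AE x in lebesgue. x \<in> E) \<or> (AE x in lebesgue. x \<notin> E)"
    using AE_constant_of_translation_invariant[OF E C kernel_support_not_null[OF density]] inv by simp
  moreover have "\<not> (AE x in lebesgue. x \<notin> E)"
  proof
    assume n: "AE x in lebesgue. x \<notin> E"
    have "AE x in lebesgue. x \<in> \<Omega> \<longrightarrow> x \<in> E"
      using \<Omega> open_domain by (subst (asm) AE_restrict_space_iff) auto
    with n have "AE x in lebesgue. x \<notin> \<Omega>" by eventually_elim auto
    then have "\<Omega> \<in> null_sets lebesgue"
      using completion.null_sets_iff_AE[of \<Omega> lborel] by auto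
    then have "negligible \<Omega>" by (simp add: negligible_iff_null_sets)
    then show False using open_domain nonempty open_not_negligible by blast
  qed
  ultimately show ?thesis by blast
qed

text \<open>The zero set of \<open>p\<close> contains almost all of \<Omega> and is invariant along
  the kernel. This turns seminorm zero, which is what the abstract uniqueness yields, into equality
  almost everywhere on the whole space.\<close>

lemma AE_zero_of_norm_zero:
  assumes p: "p \<in> V" and z: "ip_form p p = 0"
  shows "AE x in lebesgue. p x = 0"
proof -
  have b0: "b_form p p = 0" and a0: "a_form p p = 0"
    using z b.ip_nonneg[OF p] a.ip_nonneg[OF p] by (auto simp: ip_form_def)
  have "AE x in lebesgue_on \<Omega>. p x * p x = 0"
    using b0 VD(2)[OF p] unfolding b_form_eq
    by (subst (asm) integral_nonneg_eq_0_iff_AE) (auto simp: sqint_def power2_eq_square)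
  then have 1: "AE x in lebesgue_on \<Omega>. x \<in> {x. p x = 0}" by eventually_elim simp
  have "AE w in (lebesgue :: ('a \<times> 'a) measure). increment p w * increment p w = 0"
    using a0 VD(3)[OF p] unfolding a_form_eq
    by (subst (asm) integral_nonneg_eq_0_iff_AE) (auto simp: sqint_def power2_eq_square)
  then have 2: "AE w in (lebesgue :: ('a \<times> 'a) measure). k (fst w - snd w) \<noteq> 0 \<longrightarrow> (fst w \<in> {x. p x = 0} \<longleftrightarrow> snd w \<in> {x. p x = 0})"
    by eventually_elim (auto simp: increment_def)
  have "{x. p x = 0} \<in> sets lebesgue"
    using measurable_sets[OF VD(1)[OF p], of "{0}"] by (simp add: vimage_def)
  from AE_full_of_kernel_invariant[OF this 1 2] show ?thesis by simp
qed

lemma V_complete: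
  assumes u: "\<And>j. u j \<in> V" and s: "summable (\<lambda>j. sqrt (ip_form (u (Suc j) - u j) (u (Suc j) - u j)))"
  shows "\<exists>l\<in>V. (\<lambda>j. sqrt (ip_form (u j - l) (u j - l))) \<longlonglongrightarrow> 0"
proof -
  have d: "u i - u j \<in> V" for i j by (rule ip.mem(3)[OF u u])
  have sb: "summable (\<lambda>j. sqrt (LINT x|lebesgue_on \<Omega>. (u (Suc j) x - u j x)\<^sup>2))"
  proof (rule summable_comparison_test[OF exI[of _ 0] s], intro allI impI)
    fix j
    have "(LINT x|lebesgue_on \<Omega>. (u (Suc j) x - u j x)\<^sup>2) = b_form (u (Suc j) - u j) (u (Suc j) - u j)"
      by (simp add: b_form_eq power2_eq_square)
    also have "\<dots> \<le> ip_form (u (Suc j) - u j) (u (Suc j) - u j)"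
      using a.ip_nonneg[OF d] by (simp only: ip_form_def) simp
    finally show "norm (sqrt (LINT x|lebesgue_on \<Omega>. (u (Suc j) x - u j x)\<^sup>2)) \<le> sqrt (ip_form (u (Suc j) - u j) (u (Suc j) - u j))"
      by (simp add: integral_nonneg_AE)
  qed
  have sa: "summable (\<lambda>j. sqrt (LINT z|lebesgue. (increment (u (Suc j)) z - increment (u j) z)\<^sup>2))"
  proof (rule summable_comparison_test[OF exI[of _ 0] s], intro allI impI)
    fix j
    have "(LINT z|lebesgue. (increment (u (Suc j)) z - increment (u j) z)\<^sup>2) = a_form (u (Suc j) - u j) (u (Suc j) - u j)"
      unfolding a_form_eq increment_diff by (simp add: power2_eq_square)
    also have "\<dots> \<le> ip_form (u (Suc j) - u j) (u (Suc j) - u j)"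
      using b.ip_nonneg[OF d] by (simp only: ip_form_def) simp
    finally show "norm (sqrt (LINT z|lebesgue. (increment (u (Suc j)) z - increment (u j) z)\<^sup>2)) \<le> sqrt (ip_form (u (Suc j) - u j) (u (Suc j) - u j))"
      by (simp add: integral_nonneg_AE)
  qed
  have um: "u j \<in> borel_measurable lebesgue" for j by (rule VD(1)[OF u])
  note B = sqint_complete[OF VD(2)[OF u] sb]
  note A = sqint_complete[OF VD(3)[OF u] sa]
  define E where "E = {x. convergent (\<lambda>j. u j x)}"
  have E: "E \<in> sets lebesgue"
  proof -
    have "{x \<in> space lebesgue. Cauchy (\<lambda>j. u j x)} \<in> sets lebesgue" by (rule sets_Collect_Cauchy[OF um])
    then show ?thesis by (simp add: E_def Cauchy_convergent_iff)
  qed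
  have 1: "AE x in lebesgue_on \<Omega>. x \<in> E" using B(1) by (simp add: E_def)
  have 2: "AE w in (lebesgue :: ('a \<times> 'a) measure). k (fst w - snd w) \<noteq> 0 \<longrightarrow> (fst w \<in> E \<longleftrightarrow> snd w \<in> E)"
    using A(1)
  proof eventually_elim
    fix w assume c: "convergent (\<lambda>j. increment (u j) w)"
    show "k (fst w - snd w) \<noteq> 0 \<longrightarrow> (fst w \<in> E \<longleftrightarrow> snd w \<in> E)"
    proof
      assume "k (fst w - snd w) \<noteq> 0"
      then have "sqrt (k (fst w - snd w)) \<noteq> 0" by simp
      then have "(\<lambda>j. u j (fst w) - u j (snd w)) = (\<lambda>j. increment (u j) w * inverse (sqrt (k (fst w - snd w))))"
        by (simp add: increment_def fun_eq_iff)
      then have cd: "convergent (\<lambda>j. u j (fst w) - u j (snd w))"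
        using convergent_mult[OF c convergent_const] by simp
      have "convergent (\<lambda>j. u j (fst w))" if "convergent (\<lambda>j. u j (snd w))"
        using convergent_add[OF cd that] by simp
      moreover have "convergent (\<lambda>j. u j (snd w))" if "convergent (\<lambda>j. u j (fst w))"
        using convergent_diff[OF that cd] by simp
      ultimately show "fst w \<in> E \<longleftrightarrow> snd w \<in> E" by (auto simp: E_def)
    qed
  qed
  have full: "AE x in lebesgue. x \<in> E" by (rule AE_full_of_kernel_invariant[OF E 1 2])
  define l where "l x = lim (\<lambda>j. u j x)" for x
  have lm: "l \<in> borel_measurable lebesgue" unfolding l_def by (rule borel_measurable_lim_metric[OF um])
  have lim: "AE x in lebesgue. (\<lambda>j. u j x) \<longlonglongrightarrow> l x"
    using full by eventually_elim (simp add: E_def l_def convergent_LIMSEQ_iff)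
  have lim\<Omega>: "AE x in lebesgue_on \<Omega>. (\<lambda>j. u j x) \<longlonglongrightarrow> l x"
    using B(1) by eventually_elim (simp add: l_def convergent_LIMSEQ_iff)
  have lm\<Omega>: "l \<in> borel_measurable (lebesgue_on \<Omega>)" using lm by (rule measurable_restrict_space1)
  have lB: "l \<in> sqint (lebesgue_on \<Omega>)" "(\<lambda>j. sqrt (LINT x|lebesgue_on \<Omega>. (u j x - l x)\<^sup>2)) \<longlonglongrightarrow> 0"
    using B(2)[OF lm\<Omega> lim\<Omega>] by auto
  \<comment> \<open>Both coordinates range over the whole space, so convergence almost everywhere on
    \<Omega> would not be enough here.\<close>
  have limA: "AE w in (lebesgue :: ('a \<times> 'a) measure). (\<lambda>j. increment (u j) w) \<longlonglongrightarrow> increment l w"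
  proof -
    have 0: "AE x in (lborel :: 'a measure). (\<lambda>j. u j x) \<longlonglongrightarrow> l x" using lim by (simp add: AE_completion_iff)
    have "AE w in (lborel \<Otimes>\<^sub>M lborel :: ('a \<times> 'a) measure). (\<lambda>j. u j (fst w)) \<longlonglongrightarrow> l (fst w)"
      by (rule AE_product_fst[OF 0])
    moreover have "AE w in (lborel \<Otimes>\<^sub>M lborel :: ('a \<times> 'a) measure). (\<lambda>j. u j (snd w)) \<longlonglongrightarrow> l (snd w)"
      by (rule AE_product_snd[OF 0])
    ultimately have "AE w in (lborel \<Otimes>\<^sub>M lborel :: ('a \<times> 'a) measure). (\<lambda>j. increment (u j) w) \<longlonglongrightarrow> increment l w"
      by eventually_elim (auto simp: increment_def intro!: tendsto_intros)
    then have "AE w in (lborel :: ('a \<times> 'a) measure). (\<lambda>j. increment (u j) w) \<longlonglongrightarrow> increment l w"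
      by (subst (asm) lborel_prod)
    then show ?thesis by (rule AE_completion)
  qed
  have lA: "increment l \<in> sqint lebesgue" "(\<lambda>j. sqrt (LINT w|lebesgue. (increment (u j) w - increment l w)\<^sup>2)) \<longlonglongrightarrow> 0"
    using A(2)[OF increment_measurable[OF lm] limA] by auto
  have lV: "l \<in> V" unfolding V_eq using lm lB(1) lA(1) by blast
  have "(\<lambda>j. sqrt (LINT x|lebesgue_on \<Omega>. (u j x - l x)\<^sup>2) + sqrt (LINT w|lebesgue. (increment (u j) w - increment l w)\<^sup>2)) \<longlonglongrightarrow> 0"
    using tendsto_add[OF lB(2) lA(2)] by simp
  then have "(\<lambda>j. sqrt (ip_form (u j - l) (u j - l))) \<longlonglongrightarrow> 0"
  proof (rule squeeze_zero)
    fix j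
    have "b_form (u j - l) (u j - l) = (LINT x|lebesgue_on \<Omega>. (u j x - l x)\<^sup>2)"
      by (simp add: b_form_eq power2_eq_square)
    moreover have "a_form (u j - l) (u j - l) = (LINT w|lebesgue. (increment (u j) w - increment l w)\<^sup>2)"
      unfolding a_form_eq increment_diff by (simp add: power2_eq_square)
    ultimately have e: "ip_form (u j - l) (u j - l) = (LINT x|lebesgue_on \<Omega>. (u j x - l x)\<^sup>2) + (LINT w|lebesgue. (increment (u j) w - increment l w)\<^sup>2)"
      by (simp only: ip_form_def)
    show "\<bar>sqrt (ip_form (u j - l) (u j - l))\<bar> \<le> sqrt (LINT x|lebesgue_on \<Omega>. (u j x - l x)\<^sup>2) + sqrt (LINT w|lebesgue. (increment (u j) w - increment l w)\<^sup>2)"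
      unfolding e by (simp add: integral_nonneg_AE sqrt_add_le_add_sqrt)
  qed
  with lV show ?thesis by blast
qed

sublocale ip: semi_hilbert V ip_form
  by unfold_locales (rule V_complete)

end

section \<open>The Neumann problem\<close>

lemma seminormed_L2: "seminormed (L2 \<Omega>) (L2_norm \<Omega>)"
proof -
  interpret S: semi_inner "sqint (lebesgue_on \<Omega>)" "\<lambda>f g. LINT x|lebesgue_on \<Omega>. f x * g x" by (rule semi_inner_sqint)
  have "L2_norm \<Omega> = (\<lambda>f. sqrt (LINT x|lebesgue_on \<Omega>. f x * f x))"
    by (simp add: L2_norm_def fun_eq_iff power2_eq_square)
  moreover have "L2 \<Omega> = sqint (lebesgue_on \<Omega>)" by (auto simp: L2_def sqint_def)
  ultimately show ?thesis using S.seminormed_axioms by simp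
qed

lemma L2_functional_le:
  assumes "f \<in> L2 \<Omega>" "g \<in> L2 \<Omega>"
  shows "\<bar>L2_functional \<Omega> f g\<bar> \<le> L2_norm \<Omega> f * L2_norm \<Omega> g"
proof -
  interpret S: semi_inner "sqint (lebesgue_on \<Omega>)" "\<lambda>f g. LINT x|lebesgue_on \<Omega>. f x * g x" by (rule semi_inner_sqint)
  have "L2 \<Omega> = sqint (lebesgue_on \<Omega>)" by (auto simp: L2_def sqint_def)
  then show ?thesis
    using S.Cauchy_Schwarz[of f g] assms by (simp add: L2_functional_def L2_norm_def power2_eq_square)
qed

context energy_space
begin

lemma L2_functional_add_right:
  assumes "f \<in> L2 \<Omega>" "u \<in> V" "v \<in> V"
  shows "L2_functional \<Omega> f (u + v) = L2_functional \<Omega> f u + L2_functional \<Omega> f v"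
  using S\<Omega>.add_right[OF VD(2)[OF assms(2)] VD(2)[OF assms(3)], of f] assms(1)
  by (simp add: L2_functional_def L2_eq)

lemma L2_functional_scale_right: "L2_functional \<Omega> f (d *\<^sub>R u) = d * L2_functional \<Omega> f u"
  by (simp add: L2_functional_def mult.left_commute)

lemma L2_functional_diff_left:
  assumes "f \<in> L2 \<Omega>" "g \<in> L2 \<Omega>" "u \<in> V"
  shows "L2_functional \<Omega> (f - g) u = L2_functional \<Omega> f u - L2_functional \<Omega> g u"
  using S\<Omega>.diff_left[of f g u] assms VD(2)[OF assms(3)]
  by (simp add: L2_functional_def L2_eq)

lemma L2_norm_le_V_norm:
  assumes "u \<in> V"
  shows "L2_norm \<Omega> u = sqrt (b_form u u)" "L2_norm \<Omega> u \<le> V_norm m \<kappa> \<beta> \<Omega> u"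
proof -
  show "L2_norm \<Omega> u = sqrt (b_form u u)" by (simp add: L2_norm_def b_form_eq power2_eq_square)
  then show "L2_norm \<Omega> u \<le> V_norm m \<kappa> \<beta> \<Omega> u"
    using a.ip_nonneg[OF assms] by (simp add: V_norm_eq ip_form_def)
qed

end

theorem theorem6p7:
  fixes \<Omega> :: "'a::euclidean_space set"
    and T \<kappa> \<beta> :: real
    and m p0 :: "'a \<Rightarrow> real"
    and f :: "real \<Rightarrow> 'a \<Rightarrow> real"
    and g :: "real \<Rightarrow> ('a \<Rightarrow> real) \<Rightarrow> real"
  assumes "open \<Omega>" and "connected \<Omega>" and "\<Omega> \<noteq> {}"
    and "T > 0" and "\<kappa> \<ge> 0" and "\<beta> \<in> {0<..<1} \<union> {1<..<2}"
    and "sphere_density m" and "symmetric_density m"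
    and "p0 \<in> L2 \<Omega>"
    and "f \<in> L2_time T (L2 \<Omega>) (L2_norm \<Omega>)"
    and "g \<in> L2_time T (dual_space (V_space m \<kappa> \<beta> \<Omega>) (V_norm m \<kappa> \<beta> \<Omega>))
                        (dual_norm (V_space m \<kappa> \<beta> \<Omega>) (V_norm m \<kappa> \<beta> \<Omega>))"
    and "nondegenerate m"
  shows "\<exists>p. weak_solution m \<kappa> \<beta> \<Omega> T f g p0 p \<and>
    (\<forall>p'. weak_solution m \<kappa> \<beta> \<Omega> T f g p0 p' \<longrightarrow>
       (AE t in lebesgue_on {0<..<T}. AE X in lebesgue. p' t X = p t X))"
proof -
  define c where "c = 1 / (2 * \<bar>Gamma (- \<beta>)\<bar>)"
  \<comment> \<open>\<open>Gamma\<close> takes the value 0 exactly at its poles, so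
    \<open>c > 0\<close> amounts to \<open>- \<beta>\<close> not being a nonpositive
    integer.\<close>
  have "- \<beta> \<notin> \<int>\<^sub>\<le>\<^sub>0"
  proof
    assume "- \<beta> \<in> \<int>\<^sub>\<le>\<^sub>0"
    then obtain n :: int where "- \<beta> = of_int n" by (auto elim: nonpos_Ints_cases)
    then have "\<beta> = of_int (- n)" by simp
    moreover from this have "0 < - n" "- n < 2" "- n \<noteq> 1" using assms(6) by auto
    ultimately show False by linarith
  qed
  then have c: "c > 0" by (simp add: c_def Gamma_eq_zero_iff)
  interpret E: energy_space m \<kappa> \<beta> \<Omega>
    by unfold_locales (use assms in auto)
  interpret P: parabolic E.V E.b_form E.a_form E.ip_form "V_norm m \<kappa> \<beta> \<Omega>" c T
    by unfold_locales (auto simp: E.ip_form_def E.V_norm_eq c assms(4))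
  have sub: "u \<in> L2 \<Omega>" if "u \<in> E.V" for u using E.VD(2)[OF that] by (simp add: E.L2_eq)
  have dual: "L2_functional \<Omega> h \<in> P.V'" if h: "h \<in> L2 \<Omega>" for h
  proof (rule P.F.dualI[where C="L2_norm \<Omega> h"])
    fix u assume u: "u \<in> E.V"
    have "\<bar>L2_functional \<Omega> h u\<bar> \<le> L2_norm \<Omega> h * L2_norm \<Omega> u" by (rule L2_functional_le[OF h sub[OF u]])
    also have "\<dots> \<le> L2_norm \<Omega> h * V_norm m \<kappa> \<beta> \<Omega> u"
      by (intro mult_left_mono E.L2_norm_le_V_norm(2)[OF u] seminormed.nonneg[OF seminormed_L2 h])
    finally show "\<bar>L2_functional \<Omega> h u\<bar> \<le> L2_norm \<Omega> h * V_norm m \<kappa> \<beta> \<Omega> u" .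
  qed (rule E.L2_functional_add_right[OF h], assumption+, rule E.L2_functional_scale_right)
  have dual_norm: "P.N' (L2_functional \<Omega> h) \<le> 1 * L2_norm \<Omega> h" if h: "h \<in> L2 \<Omega>" for h
  proof -
    have "P.N' (L2_functional \<Omega> h) \<le> L2_norm \<Omega> h"
    proof (rule P.F.dual_norm_le[OF _ seminormed.nonneg[OF seminormed_L2 h]])
      fix u assume u: "u \<in> E.V"
      have "\<bar>L2_functional \<Omega> h u\<bar> \<le> L2_norm \<Omega> h * L2_norm \<Omega> u" by (rule L2_functional_le[OF h sub[OF u]])
      also have "\<dots> \<le> L2_norm \<Omega> h * V_norm m \<kappa> \<beta> \<Omega> u"
        by (intro mult_left_mono E.L2_norm_le_V_norm(2)[OF u] seminormed.nonneg[OF seminormed_L2 h])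
      finally show "\<bar>L2_functional \<Omega> h u\<bar> \<le> L2_norm \<Omega> h * V_norm m \<kappa> \<beta> \<Omega> u" .
    qed
    then show ?thesis by simp
  qed
  have dual_norm_diff: "P.N' (L2_functional \<Omega> h - L2_functional \<Omega> k) \<le> 1 * L2_norm \<Omega> (h - k)"
    if h: "h \<in> L2 \<Omega>" and k: "k \<in> L2 \<Omega>" for h k
  proof -
    have hk: "h - k \<in> L2 \<Omega>" by (rule seminormed.mem(3)[OF seminormed_L2 h k])
    have "P.N' (L2_functional \<Omega> h - L2_functional \<Omega> k) \<le> L2_norm \<Omega> (h - k)"
    proof (rule P.F.dual_norm_le[OF _ seminormed.nonneg[OF seminormed_L2 hk]])
      fix u assume u: "u \<in> E.V"
      have "\<bar>(L2_functional \<Omega> h - L2_functional \<Omega> k) u\<bar> = \<bar>L2_functional \<Omega> (h - k) u\<bar>"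
        using E.L2_functional_diff_left[OF h k u] by simp
      also have "\<dots> \<le> L2_norm \<Omega> (h - k) * L2_norm \<Omega> u" by (rule L2_functional_le[OF hk sub[OF u]])
      also have "\<dots> \<le> L2_norm \<Omega> (h - k) * V_norm m \<kappa> \<beta> \<Omega> u"
        by (intro mult_left_mono E.L2_norm_le_V_norm(2)[OF u] seminormed.nonneg[OF seminormed_L2 hk])
      finally show "\<bar>(L2_functional \<Omega> h - L2_functional \<Omega> k) u\<bar> \<le> L2_norm \<Omega> (h - k) * V_norm m \<kappa> \<beta> \<Omega> u" .
    qed
    then show ?thesis by simp
  qed
  define Ff where "Ff t = L2_functional \<Omega> (f t)" for t
  have fL: "Ff \<in> L2t P.I P.V' P.N'"
    using P.I.L2t_image[OF seminormed_L2 assms(10)[unfolded L2_time_eq] dual dual_norm_diff dual_norm P.F.seminormed_dual]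
    unfolding Ff_def .
  have gL: "g \<in> L2t P.I P.V' P.N'" using assms(11) unfolding L2_time_eq .
  \<comment> \<open>Source and Neumann datum enter the abstract equation as one dual-valued
    right-hand side.\<close>
  define F where "F t = Ff t - g t" for t
  have FL: "F \<in> L2t P.I P.V' P.N'" unfolding F_def by (rule P.I.L2t_diff[OF P.F.seminormed_dual fL gL])
  have rhs: "(LINT t|P.I. F t (q t)) = (LINT t|P.I. (LINT X|lebesgue_on \<Omega>. f t X * q t X)) - (LINT t|P.I. g t (q t))"
    if q: "q \<in> L2t P.I E.V (V_norm m \<kappa> \<beta> \<Omega>)" for q
    using P.F.pairing_bound(1)[OF complete_time fL q] P.F.pairing_bound(1)[OF complete_time gL q]
    by (simp add: F_def Ff_def L2_functional_def)
  define l0 where "l0 = L2_functional \<Omega> p0"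
  have l0: "l0 \<in> P.V'" unfolding l0_def by (rule dual[OF assms(9)])
  have l0_bound: "\<bar>l0 u\<bar> \<le> L2_norm \<Omega> p0 * sqrt (E.b_form u u)" if u: "u \<in> E.V" for u
    using L2_functional_le[OF assms(9) sub[OF u]] unfolding l0_def E.L2_norm_le_V_norm(1)[OF u] .
  \<comment> \<open>The definition of a weak solution in the language of the abstract equation,
    shared by existence and uniqueness.\<close>
  have ws: "weak_solution m \<kappa> \<beta> \<Omega> T f g p0 p \<longleftrightarrow>
      p \<in> L2t P.I E.V (V_norm m \<kappa> \<beta> \<Omega>) \<and> (\<lambda>t. E.b_form (p t)) \<in> L2t P.I P.V' P.N' \<and>
      has_initial_value T E.V (V_norm m \<kappa> \<beta> \<Omega>) (\<lambda>t. E.b_form (p t)) l0 \<and>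
      (\<exists>D\<in>L2t P.I P.V' P.N'. has_weak_time_deriv T E.V (\<lambda>t. E.b_form (p t)) D \<and>
        (\<forall>q\<in>L2t P.I E.V (V_norm m \<kappa> \<beta> \<Omega>).
          (LINT t|P.I. D t (q t)) + c * (LINT t|P.I. E.a_form (p t) (q t)) = (LINT t|P.I. F t (q t))))" for p
    unfolding weak_solution_def Let_def L2_time_eq E.b_form_def E.a_form_def c_def l0_def
    using rhs by (intro conj_cong refl bex_cong ball_cong) simp_all
  obtain p where p: "p \<in> L2t P.I E.V (V_norm m \<kappa> \<beta> \<Omega>)"
    "has_initial_value T E.V (V_norm m \<kappa> \<beta> \<Omega>) (\<lambda>t. E.b_form (p t)) l0"
    "has_weak_time_deriv T E.V (\<lambda>t. E.b_form (p t)) (\<lambda>t v. F t v - c * E.a_form (p t) v)"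
    "(\<lambda>t v. F t v - c * E.a_form (p t) v) \<in> L2t P.I P.V' P.N'"
    using P.weak_solution_exists[OF FL l0 l0_bound] by blast
  \<comment> \<open>For \<open>D = F - c a(p)\<close> the equation reduces to linearity of the
    integral; the substance is that this \<open>D\<close> is the time derivative.\<close>
  have eq: "(LINT t|P.I. F t (q t) - c * E.a_form (p t) (q t)) + c * (LINT t|P.I. E.a_form (p t) (q t)) = (LINT t|P.I. F t (q t))"
    if q: "q \<in> L2t P.I E.V (V_norm m \<kappa> \<beta> \<Omega>)" for q
    using P.F.pairing_bound(1)[OF complete_time FL q] P.bounded_form_integral(1)[OF P.bounded_forms(2) p(1) q] by simp
  have "weak_solution m \<kappa> \<beta> \<Omega> T f g p0 p"
    unfolding ws using p eq P.bounded_form_L2t[OF P.bounded_forms(1) p(1)] by blast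
  moreover have "AE t in P.I. AE X in lebesgue. p' t X = p t X" if p': "weak_solution m \<kappa> \<beta> \<Omega> T f g p0 p'" for p'
  proof -
    obtain D where D: "p' \<in> L2t P.I E.V (V_norm m \<kappa> \<beta> \<Omega>)" "D \<in> L2t P.I P.V' P.N'"
      "has_initial_value T E.V (V_norm m \<kappa> \<beta> \<Omega>) (\<lambda>t. E.b_form (p' t)) l0"
      "has_weak_time_deriv T E.V (\<lambda>t. E.b_form (p' t)) D"
      "\<And>q. q \<in> L2t P.I E.V (V_norm m \<kappa> \<beta> \<Omega>) \<Longrightarrow>
        (LINT t|P.I. D t (q t)) + c * (LINT t|P.I. E.a_form (p' t) (q t)) = (LINT t|P.I. F t (q t))"
      using p' unfolding ws by blast
    have "AE t in P.I. p' t - p t \<in> E.V \<and> E.ip_form (p' t - p t) (p' t - p t) = 0"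
      by (rule P.weak_solution_unique[OF FL D p(1) p(4) p(2) p(3) eq])
    then show ?thesis
    proof eventually_elim
      fix t assume "p' t - p t \<in> E.V \<and> E.ip_form (p' t - p t) (p' t - p t) = 0"
      then have "AE X in lebesgue. (p' t - p t) X = 0" using E.AE_zero_of_norm_zero by blast
      then show "AE X in lebesgue. p' t X = p t X" by eventually_elim simp
    qed
  qed
  ultimately show ?thesis by blast
qed

end
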